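(* Let $Q$ be a manifold with a fixed torsion-free connection. Consider an underactuated system $(H,\mathcal{W})$ with $H:T^{\ast}Q\to\mathbb{R}$ simple and $\mathcal{W}$ given by a linear subbundle $W\subset T^{\ast}Q$, and a critical point $\alpha^{\bullet}\in T^{\ast}Q$ of $X_H$. If $Y\in\mathfrak{X}(T^{\ast}Q)$ is a vector field with image in $\mathcal{W}$ for which there is a simple Lyapunov function for $X_H+Y$ and $\alpha^{\bullet}$, then $Y$ is given by the simple LCB method.
   Context: All manifolds are smooth and finite dimensional and all maps are smooth. $\pi:T^{\ast}Q\to Q$ is the cotangent bundle; $X_H$ is the Hamiltonian vector field of $H$ for the canonical symplectic form (in canonical coordinates $\dot q^i=\partial H/\partial p_i$, $\dot p_i=-\partial H/\partial q^i$); $\{F,G\}=\frac{\partial F}{\partial q^i}\frac{\partial G}{\partial p_i}-\frac{\partial G}{\partial q^i}\frac{\partial F}{\partial p_i}$. A critical point of a vector field is a zero of it. For $\alpha,y\in T^{\ast}_qQ$, $\operatorname{vlift}_\alpha(y)=\frac{d}{ds}|_0(\alpha+sy)\in T_\alpha T^{\ast}Q$. The vertical lift of a fiber preserving map $y:T^{\ast}Q\to T^{\ast}Q$ is $Y(\alpha)=\operatorname{vlift}_\alpha(y(\alpha))$. "$\mathcal{W}$ is given by $W$" means $\mathcal{W}_\alpha=\operatorname{vlift}_\alpha(W_{\pi(\alpha)})$ for all $\alpha$; the rank of $W$ (number of actuators) is at least 1. A function is positive definite w.r.t. $\alpha^{\bullet}$ if it is non-negative and vanishes only at $\alpha^{\bullet}$.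 A Lyapunov function for a vector field $X$ and a critical point $\alpha^{\bullet}$ of $X$ (in particular $X(\alpha^\bullet)=0$) is a smooth function $\hat H$, positive definite w.r.t. $\alpha^{\bullet}$, with $\langle d\hat H(\alpha),X(\alpha)\rangle\le0$ for all $\alpha$. A function $H$ on $T^{\ast}Q$ is simple if $H=\mathfrak{H}+h\circ\pi$ with $h\in C^\infty(Q)$ and $\mathfrak{H}(\alpha)=\frac12\langle\alpha,\rho^\sharp(\alpha)\rangle$ for a Riemannian metric $\rho$ on $Q$. For another simple function write $\hat H=\hat{\mathfrak{H}}+\hat h\circ\pi$, with metric $\hat\rho$. Fiber derivative: $\mathbb{F}F:T^{\ast}Q\to TQ$, $\langle\sigma,\mathbb{F}F(\alpha)\rangle=\frac{d}{ds}|_0F(\alpha+s\sigma)$; so $\mathbb{F}H=\mathbb{F}\mathfrak{H}=\rho^\sharp$, $\mathbb{F}\hat H=\mathbb{F}\hat{\mathfrak{H}}=\hat\rho^\sharp$. The fixed torsion-free connection on $TQ$ induces the dual one on $T^{\ast}Q$. Base derivative: $\mathbb{B}F:T^{\ast}Q\to T^{\ast}Q$, $\langle\mathbb{B}F(\alpha),v\rangle=\frac{d}{ds}|_0F(u(s))$, where $u$ is a horizontal (parallel) curve in $T^{\ast}Q$ with $u(0)=\alpha$ whose projection to $Q$ has velocity $v$ at $s=0$. For $F$ on the Whitney sum $T^{\ast}Q\times T^{\ast}Q$, $\langle\mathbb{B}F(\alpha_1,\alpha_2),v\rangle=\frac{d}{ds}|_0F(u_1(s),u_2(s))$ with $u_1,u_2$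 horizontal over the same base curve, of velocity $v$ at $s=0$, and $u_i(0)=\alpha_i$. Given simple $H,\hat H$, put $\mathfrak{b}(\alpha,\sigma)=\frac12\langle\alpha,\rho^\sharp(\sigma)\rangle$, $\hat{\mathfrak{b}}(\alpha,\sigma)=\frac12\langle\alpha,\hat\rho^\sharp(\sigma)\rangle$, $\hat g(\alpha,\sigma)=\langle\alpha,\mathbb{F}\hat H(\sigma)\rangle=2\hat{\mathfrak b}(\alpha,\sigma)$, $$\Upsilon(\alpha_1,\alpha_2,\alpha_3)=\langle\mathbb{B}\hat{\mathfrak{b}}(\alpha_1,\alpha_2),\mathbb{F}\mathfrak{H}(\alpha_3)\rangle-\langle\mathbb{B}\mathfrak{b}(\alpha_1,\alpha_2),\mathbb{F}\hat{\mathfrak{H}}(\alpha_3)\rangle,$$ and $\hat W=\mathbb{F}\hat{\mathfrak{H}}^{-1}(W^0)$, where $W^0\subset TQ$ is the annihilator of $W$. Then $\hat W$ is the $\hat g$-orthogonal complement of $W$; let $P$ be the orthogonal projection onto $W$. Simple LCB method: $Y$ is given by it iff it is obtained as follows. (1) Find a simple $\hat H$, positive definite w.r.t. $\alpha^{\bullet}$, with $\{\hat H,H\}(\sigma)=0$ for all $\sigma\in\hat W$. (2) Define $z_\perp:T^{\ast}Q\to\hat W$ by $\hat g(z_\perp(\alpha),\sigma)=0$ for $\sigma\in W$ and $\hat g(z_\perp(\alpha),\sigma)=-\Upsilon(\alpha,\alpha,\sigma)$ for $\sigma\in\hat W$. (3) Fix a non-negative $\mu:T^{\ast}Q\to\mathbb{R}$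 and a fiber preserving map $x:T^{\ast}Q\to T^{\ast}Q$ with image in $W$ such that the formula $x(\alpha)-\frac{\hat g(x(\alpha),P(\alpha))+\mu(\alpha)-\hat g(z_\perp(\alpha),\alpha)}{\hat g(P(\alpha),P(\alpha))}P(\alpha)$, $\alpha\notin\hat W$, extends to a smooth map on all of $T^{\ast}Q$ and tends to $0$ as $\alpha\to\alpha^{\bullet}$; let $z_{\parallel}$ be that extension. (4) Put $z=z_{\parallel}-z_\perp$, $y(\alpha)=z(\alpha)-\mathbb{F}\hat H^{-1}\big(\mathbb{F}H(\mathbb{B}\hat H(\alpha))-\mathbb{F}\hat H(\mathbb{B}H(\alpha))\big)$ and let $Y$ be the vertical lift of $y$. *)

theory Defs
  imports "HOL-Analysis.Analysis"
begin

section \<open>Smooth maps between open subsets of normed spaces\<close>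

text \<open>The set \<open>S\<close> is meant to be open, so that the derivatives are unambiguous.\<close>

primrec ck_on :: "nat \<Rightarrow> 'a::real_normed_vector set \<Rightarrow> ('a \<Rightarrow> 'b::real_normed_vector) \<Rightarrow> bool"
  where
    "ck_on 0 S f \<longleftrightarrow> continuous_on S f"
  | "ck_on (Suc k) S f \<longleftrightarrow>
       f differentiable_on S \<and> (\<forall>v. ck_on k S (\<lambda>x. frechet_derivative f (at x) v))"

definition smooth_on :: "'a::real_normed_vector set \<Rightarrow> ('a \<Rightarrow> 'b::real_normed_vector) \<Rightarrow> bool"
  where "smooth_on S f \<longleftrightarrow> (\<forall>k. ck_on k S f)"


section \<open>Manifolds\<close>

text \<open>
  A manifold is given by a smooth atlas. A chart is a pair of a domain and a coordinate map; the
  values of the coordinate map outside the domain are irrelevant. The points of the manifold are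
  those covered by charts, and its topology is the one for which all charts are homeomorphisms
  onto open sets.
\<close>

type_synonym ('q, 'e) chart = "'q set \<times> ('q \<Rightarrow> 'e)"
type_synonym ('q, 'e) atlas = "('q, 'e) chart set"

definition chart_inv :: "('q, 'e) chart \<Rightarrow> 'e \<Rightarrow> 'q"
  where "chart_inv c = inv_into (fst c) (snd c)"

definition transition :: "('q, 'e) chart \<Rightarrow> ('q, 'f) chart \<Rightarrow> 'e \<Rightarrow> 'f"
  where "transition c d = snd d \<circ> chart_inv c"

definition smooth_atlas :: "('q, 'e::real_normed_vector) atlas \<Rightarrow> bool"
  where "smooth_atlas A \<longleftrightarrow>
    (\<forall>c\<in>A. inj_on (snd c) (fst c) \<and> open (snd c ` fst c)) \<and>
    (\<forall>c\<in>A. \<forall>d\<in>A. open (snd c ` (fst c \<inter> fst d)) \<and>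
       smooth_on (snd c ` (fst c \<inter> fst d)) (transition c d))"

definition points :: "('q, 'e) atlas \<Rightarrow> 'q set"
  where "points A = (\<Union>c\<in>A. fst c)"

definition atlas_topology :: "('q, 'e::real_normed_vector) atlas \<Rightarrow> 'q topology"
  where "atlas_topology A =
    topology (\<lambda>S. S \<subseteq> points A \<and> (\<forall>c\<in>A. open (snd c ` (S \<inter> fst c))))"

definition manifold :: "('q, 'e::real_normed_vector) atlas \<Rightarrow> bool"
  where "manifold A \<longleftrightarrow> smooth_atlas A \<and>
    Hausdorff_space (atlas_topology A) \<and> second_countable (atlas_topology A)"

definition euclidean_atlas :: "('e, 'e) atlas"
  where "euclidean_atlas = {(UNIV, id)}"

text \<open>Smooth maps between manifolds, defined on an open subset \<open>S\<close> of the first one.\<close>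

definition smooth_map_on ::
  "'m set \<Rightarrow> ('m, 'e::real_normed_vector) atlas \<Rightarrow> ('n, 'f::real_normed_vector) atlas \<Rightarrow>
    ('m \<Rightarrow> 'n) \<Rightarrow> bool"
  where "smooth_map_on S A B f \<longleftrightarrow>
    continuous_map (subtopology (atlas_topology A) S) (atlas_topology B) f \<and>
    (\<forall>c\<in>A. \<forall>d\<in>B. smooth_on (snd c ` (S \<inter> fst c \<inter> f -` fst d)) (snd d \<circ> f \<circ> chart_inv c))"

abbreviation smooth_map ::
  "('m, 'e::real_normed_vector) atlas \<Rightarrow> ('n, 'f::real_normed_vector) atlas \<Rightarrow> ('m \<Rightarrow> 'n) \<Rightarrow> bool"
  where "smooth_map A B f \<equiv> smooth_map_on (points A) A B f"

abbreviation smooth_fun_on ::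
  "'m set \<Rightarrow> ('m, 'e::real_normed_vector) atlas \<Rightarrow> ('m \<Rightarrow> real) \<Rightarrow> bool"
  where "smooth_fun_on S A f \<equiv> smooth_map_on S A euclidean_atlas f"

abbreviation smooth_fun :: "('m, 'e::real_normed_vector) atlas \<Rightarrow> ('m \<Rightarrow> real) \<Rightarrow> bool"
  where "smooth_fun A f \<equiv> smooth_fun_on (points A) A f"


section \<open>Tangent and cotangent bundles\<close>

text \<open>
  Fix at each point \<open>q\<close> a preferred chart of the atlas. A tangent vector at \<open>q\<close> is represented by
  its coordinates in the preferred chart at \<open>q\<close>, so that each tangent space is a copy of the model
  space. A covector at \<open>q\<close> is likewise represented by its components in the preferred chart at
  \<open>q\<close>; the pairing of a covector \<open>a\<close> with a tangent vector \<open>v\<close> at the same point is then the inner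
  product \<open>a \<bullet> v\<close> of the model space. The tangent (cotangent) bundle consists of the pairs
  \<open>(q, v)\<close> (the pairs \<open>(q, a)\<close>), and the usual coordinate changes enter through the charts induced
  on these bundles by the charts of the base.
\<close>

definition chart_at :: "('q, 'e) atlas \<Rightarrow> 'q \<Rightarrow> ('q, 'e) chart"
  where "chart_at A q = (SOME c. c \<in> A \<and> q \<in> fst c)"

text \<open>Coordinates in the chart \<open>c\<close> of the tangent vector (covector) at \<open>q\<close> represented by \<open>v\<close>.\<close>

definition vector_coord ::
  "('q, 'e::real_normed_vector) atlas \<Rightarrow> ('q, 'e) chart \<Rightarrow> 'q \<Rightarrow> 'e \<Rightarrow> 'e"
  where "vector_coord A c q v =
    frechet_derivative (transition (chart_at A q) c) (at (snd (chart_at A q) q)) v"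

definition covector_coord ::
  "('q, 'e::euclidean_space) atlas \<Rightarrow> ('q, 'e) chart \<Rightarrow> 'q \<Rightarrow> 'e \<Rightarrow> 'e"
  where "covector_coord A c q a =
    adjoint (frechet_derivative (transition c (chart_at A q)) (at (snd c q))) a"

definition tangent_atlas ::
  "('q, 'e::real_normed_vector) atlas \<Rightarrow> ('q \<times> 'e, 'e \<times> 'e) atlas"
  where "tangent_atlas A =
    (\<lambda>c. (fst c \<times> UNIV, \<lambda>(q, v). (snd c q, vector_coord A c q v))) ` A"

definition cotangent_atlas ::
  "('q, 'e::euclidean_space) atlas \<Rightarrow> ('q \<times> 'e, 'e \<times> 'e) atlas"
  where "cotangent_atlas A =
    (\<lambda>c. (fst c \<times> UNIV, \<lambda>(q, a). (snd c q, covector_coord A c q a))) ` A"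

definition smooth_vector_field_on ::
  "'q set \<Rightarrow> ('q, 'e::real_normed_vector) atlas \<Rightarrow> ('q \<Rightarrow> 'e) \<Rightarrow> bool"
  where "smooth_vector_field_on S A X \<longleftrightarrow> smooth_map_on S A (tangent_atlas A) (\<lambda>q. (q, X q))"

definition smooth_covector_field_on ::
  "'q set \<Rightarrow> ('q, 'e::euclidean_space) atlas \<Rightarrow> ('q \<Rightarrow> 'e) \<Rightarrow> bool"
  where "smooth_covector_field_on S A w \<longleftrightarrow>
    smooth_map_on S A (cotangent_atlas A) (\<lambda>q. (q, w q))"

text \<open>\<open>dfun A f q v\<close> is \<open>\<langle>df(q), v\<rangle>\<close>.\<close>

definition dfun ::
  "('q, 'e::real_normed_vector) atlas \<Rightarrow> ('q \<Rightarrow> real) \<Rightarrow> 'q \<Rightarrow> 'e \<Rightarrow> real"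
  where "dfun A f q v =
    frechet_derivative (f \<circ> chart_inv (chart_at A q)) (at (snd (chart_at A q) q)) v"

definition velocity ::
  "('q, 'e::real_normed_vector) atlas \<Rightarrow> (real \<Rightarrow> 'q) \<Rightarrow> real \<Rightarrow> 'e"
  where "velocity A \<gamma> s = vector_derivative (snd (chart_at A (\<gamma> s)) \<circ> \<gamma>) (at s)"


section \<open>Hamiltonian vector fields\<close>

text \<open>
  Every chart of \<open>cotangent_atlas A\<close> is a system of canonical coordinates \<open>(q, p)\<close>, in particular
  the preferred one at \<open>\<alpha>\<close>, with respect to which tangent vectors at \<open>\<alpha>\<close> are represented.
\<close>

definition d_dq ::
  "('q, 'e::euclidean_space) atlas \<Rightarrow> ('q \<times> 'e \<Rightarrow> real) \<Rightarrow> 'q \<times> 'e \<Rightarrow> 'e \<Rightarrow> real"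
  where "d_dq A F \<alpha> b = dfun (cotangent_atlas A) F \<alpha> (b, 0)"

definition d_dp ::
  "('q, 'e::euclidean_space) atlas \<Rightarrow> ('q \<times> 'e \<Rightarrow> real) \<Rightarrow> 'q \<times> 'e \<Rightarrow> 'e \<Rightarrow> real"
  where "d_dp A F \<alpha> b = dfun (cotangent_atlas A) F \<alpha> (0, b)"

definition hamiltonian_vf ::
  "('q, 'e::euclidean_space) atlas \<Rightarrow> ('q \<times> 'e \<Rightarrow> real) \<Rightarrow> 'q \<times> 'e \<Rightarrow> 'e \<times> 'e"
  where "hamiltonian_vf A H \<alpha> =
    ((\<Sum>b\<in>Basis. d_dp A H \<alpha> b *\<^sub>R b), - (\<Sum>b\<in>Basis. d_dq A H \<alpha> b *\<^sub>R b))"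

definition poisson ::
  "('q, 'e::euclidean_space) atlas \<Rightarrow> ('q \<times> 'e \<Rightarrow> real) \<Rightarrow> ('q \<times> 'e \<Rightarrow> real) \<Rightarrow> 'q \<times> 'e \<Rightarrow> real"
  where "poisson A F G \<alpha> =
    (\<Sum>b\<in>Basis. d_dq A F \<alpha> b * d_dp A G \<alpha> b - d_dq A G \<alpha> b * d_dp A F \<alpha> b)"

definition vlift ::
  "('q, 'e::euclidean_space) atlas \<Rightarrow> 'q \<times> 'e \<Rightarrow> 'e \<Rightarrow> 'e \<times> 'e"
  where "vlift A \<alpha> y = velocity (cotangent_atlas A) (\<lambda>s. (fst \<alpha>, snd \<alpha> + s *\<^sub>R y)) 0"


section \<open>Torsion-free connections and horizontal curves of covectors\<close>

text \<open>
  \<open>nabla q v X\<close> is the covariant derivative \<open>\<nabla>\<^sub>v X\<close> of a smooth vector field \<open>X\<close>, defined in a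
  neighbourhood of \<open>q\<close>, in the direction of the tangent vector \<open>v\<close> at \<open>q\<close>. Vector fields defined
  on an open set \<open>S\<close> are total functions with irrelevant values outside \<open>S\<close>; the fourth condition
  says that these values, and more generally the values away from \<open>q\<close>, play no role. The last
  condition is \<open>\<nabla>\<^sub>X Y - \<nabla>\<^sub>Y X = [X, Y]\<close>, with the Lie bracket acting on functions as a derivation.
\<close>

definition torsion_free_connection ::
  "('q, 'e::real_normed_vector) atlas \<Rightarrow> ('q \<Rightarrow> 'e \<Rightarrow> ('q \<Rightarrow> 'e) \<Rightarrow> 'e) \<Rightarrow> bool"
  where "torsion_free_connection A nabla \<longleftrightarrow>
    (\<forall>S X Y. openin (atlas_topology A) S \<and>
       smooth_vector_field_on S A X \<and> smooth_vector_field_on S A Y \<longrightarrow>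
       (\<forall>q\<in>S. linear (\<lambda>v. nabla q v X)) \<and>
       (\<forall>q\<in>S. \<forall>v. nabla q v (\<lambda>r. X r + Y r) = nabla q v X + nabla q v Y) \<and>
       (\<forall>f. smooth_fun_on S A f \<longrightarrow>
          (\<forall>q\<in>S. \<forall>v. nabla q v (\<lambda>r. f r *\<^sub>R X r) = dfun A f q v *\<^sub>R X q + f q *\<^sub>R nabla q v X)) \<and>
       ((\<forall>q\<in>S. X q = Y q) \<longrightarrow> (\<forall>q\<in>S. \<forall>v. nabla q v X = nabla q v Y)) \<and>
       smooth_vector_field_on S A (\<lambda>q. nabla q (X q) Y) \<and>
       (\<forall>f. smooth_fun_on S A f \<longrightarrow>
          (\<forall>q\<in>S. dfun A f q (nabla q (X q) Y - nabla q (Y q) X) =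
             dfun A (\<lambda>r. dfun A f r (Y r)) q (X q) - dfun A (\<lambda>r. dfun A f r (X r)) q (Y q))))"

text \<open>
  For a curve \<open>u\<close> in the cotangent bundle over a base curve \<open>\<gamma>\<close>, the dual covariant derivative
  along \<open>\<gamma>\<close> is determined by \<open>\<langle>Du/ds, X\<rangle> = d/ds \<langle>u, X \<circ> \<gamma>\<rangle> - \<langle>u, \<nabla>\<^bsub>\<gamma>'\<^esub> X\<rangle>\<close>. The curve is
  horizontal (parallel) iff this vanishes for all local vector fields \<open>X\<close> at all times.
\<close>

definition horizontal_curve ::
  "('q, 'e::euclidean_space) atlas \<Rightarrow> ('q \<Rightarrow> 'e \<Rightarrow> ('q \<Rightarrow> 'e) \<Rightarrow> 'e) \<Rightarrow>
    real set \<Rightarrow> (real \<Rightarrow> 'q \<times> 'e) \<Rightarrow> bool"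
  where "horizontal_curve A nabla I u \<longleftrightarrow>
    smooth_map_on I euclidean_atlas (cotangent_atlas A) u \<and>
    (\<forall>s\<in>I. \<forall>S X. openin (atlas_topology A) S \<and> fst (u s) \<in> S \<and> smooth_vector_field_on S A X \<longrightarrow>
       ((\<lambda>t. snd (u t) \<bullet> X (fst (u t))) has_real_derivative
          snd (u s) \<bullet> nabla (fst (u s)) (velocity A (fst \<circ> u) s) X) (at s))"


section \<open>Fiber and base derivatives\<close>

text \<open>
  The fiber derivative (a map from the cotangent to the tangent bundle) and the base derivative (a
  map of the cotangent bundle into itself) preserve base points; only the fiber components of their
  values are recorded.
\<close>

definition fiber_deriv :: "('q \<times> 'e::real_inner \<Rightarrow> real) \<Rightarrow> 'q \<times> 'e \<Rightarrow> 'e"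
  where "fiber_deriv F \<alpha> =
    (THE v. \<forall>\<sigma>. ((\<lambda>s. F (fst \<alpha>, snd \<alpha> + s *\<^sub>R \<sigma>)) has_real_derivative (\<sigma> \<bullet> v)) (at 0))"

definition base_deriv ::
  "('q, 'e::euclidean_space) atlas \<Rightarrow> ('q \<Rightarrow> 'e \<Rightarrow> ('q \<Rightarrow> 'e) \<Rightarrow> 'e) \<Rightarrow>
    ('q \<times> 'e \<Rightarrow> real) \<Rightarrow> 'q \<times> 'e \<Rightarrow> 'e"
  where "base_deriv A nabla F \<alpha> =
    (THE \<beta>. \<forall>\<epsilon>>0. \<forall>u. horizontal_curve A nabla {-\<epsilon><..<\<epsilon>} u \<and> u 0 = \<alpha> \<longrightarrow>
       ((\<lambda>s. F (u s)) has_real_derivative (\<beta> \<bullet> velocity A (fst \<circ> u) 0)) (at 0))"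

text \<open>
  Functions on the Whitney sum are functions of two covectors, of interest only if these have the
  same base point.
\<close>

definition base_deriv2 ::
  "('q, 'e::euclidean_space) atlas \<Rightarrow> ('q \<Rightarrow> 'e \<Rightarrow> ('q \<Rightarrow> 'e) \<Rightarrow> 'e) \<Rightarrow>
    ('q \<times> 'e \<Rightarrow> 'q \<times> 'e \<Rightarrow> real) \<Rightarrow> 'q \<times> 'e \<Rightarrow> 'q \<times> 'e \<Rightarrow> 'e"
  where "base_deriv2 A nabla F \<alpha>1 \<alpha>2 =
    (THE \<beta>. \<forall>\<epsilon>>0. \<forall>u1 u2.
       horizontal_curve A nabla {-\<epsilon><..<\<epsilon>} u1 \<and> horizontal_curve A nabla {-\<epsilon><..<\<epsilon>} u2 \<and>
       (\<forall>s\<in>{-\<epsilon><..<\<epsilon>}. fst (u1 s) = fst (u2 s)) \<and> u1 0 = \<alpha>1 \<and> u2 0 = \<alpha>2 \<longrightarrow>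
       ((\<lambda>s. F (u1 s) (u2 s)) has_real_derivative (\<beta> \<bullet> velocity A (fst \<circ> u1) 0)) (at 0))"


section \<open>Simple functions and Lyapunov functions\<close>

definition riemannian_metric ::
  "('q, 'e::euclidean_space) atlas \<Rightarrow> ('q \<Rightarrow> 'e \<Rightarrow> 'e \<Rightarrow> real) \<Rightarrow> bool"
  where "riemannian_metric A \<rho> \<longleftrightarrow>
    (\<forall>q\<in>points A. bilinear (\<rho> q) \<and> (\<forall>v w. \<rho> q v w = \<rho> q w v) \<and> (\<forall>v. v \<noteq> 0 \<longrightarrow> \<rho> q v v > 0)) \<and>
    (\<forall>S X Y. openin (atlas_topology A) S \<and>
       smooth_vector_field_on S A X \<and> smooth_vector_field_on S A Y \<longrightarrow>
       smooth_fun_on S A (\<lambda>q. \<rho> q (X q) (Y q)))"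

definition sharp :: "('q \<Rightarrow> 'e::euclidean_space \<Rightarrow> 'e \<Rightarrow> real) \<Rightarrow> 'q \<times> 'e \<Rightarrow> 'e"
  where "sharp \<rho> \<alpha> = (THE v. \<forall>w. \<rho> (fst \<alpha>) v w = snd \<alpha> \<bullet> w)"

definition kinetic :: "('q \<Rightarrow> 'e::euclidean_space \<Rightarrow> 'e \<Rightarrow> real) \<Rightarrow> 'q \<times> 'e \<Rightarrow> real"
  where "kinetic \<rho> \<alpha> = 1/2 * (snd \<alpha> \<bullet> sharp \<rho> \<alpha>)"

definition kinetic_form ::
  "('q \<Rightarrow> 'e::euclidean_space \<Rightarrow> 'e \<Rightarrow> real) \<Rightarrow> 'q \<times> 'e \<Rightarrow> 'q \<times> 'e \<Rightarrow> real"
  where "kinetic_form \<rho> \<alpha> \<sigma> = 1/2 * (snd \<alpha> \<bullet> sharp \<rho> \<sigma>)"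

text \<open>\<open>H\<close> is simple, with metric \<open>\<rho>\<close> and potential \<open>h\<close> (both are determined by \<open>H\<close>).\<close>

definition simple_on_cotangent ::
  "('q, 'e::euclidean_space) atlas \<Rightarrow> ('q \<times> 'e \<Rightarrow> real) \<Rightarrow>
    ('q \<Rightarrow> 'e \<Rightarrow> 'e \<Rightarrow> real) \<Rightarrow> ('q \<Rightarrow> real) \<Rightarrow> bool"
  where "simple_on_cotangent A H \<rho> h \<longleftrightarrow>
    riemannian_metric A \<rho> \<and> smooth_fun A h \<and>
    (\<forall>\<alpha>\<in>points (cotangent_atlas A). H \<alpha> = kinetic \<rho> \<alpha> + h (fst \<alpha>))"

definition positive_definite_at :: "('m, 'f) atlas \<Rightarrow> ('m \<Rightarrow> real) \<Rightarrow> 'm \<Rightarrow> bool"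
  where "positive_definite_at B F x0 \<longleftrightarrow>
    (\<forall>x\<in>points B. F x \<ge> 0 \<and> (F x = 0 \<longleftrightarrow> x = x0))"

definition critical_point ::
  "('m, 'f::real_normed_vector) atlas \<Rightarrow> ('m \<Rightarrow> 'f) \<Rightarrow> 'm \<Rightarrow> bool"
  where "critical_point B X x0 \<longleftrightarrow> x0 \<in> points B \<and> X x0 = 0"

definition lyapunov_function ::
  "('m, 'f::real_normed_vector) atlas \<Rightarrow> ('m \<Rightarrow> 'f) \<Rightarrow> 'm \<Rightarrow> ('m \<Rightarrow> real) \<Rightarrow> bool"
  where "lyapunov_function B X x0 V \<longleftrightarrow>
    critical_point B X x0 \<and> smooth_fun B V \<and> positive_definite_at B V x0 \<and>
    (\<forall>x\<in>points B. dfun B V x (X x) \<le> 0)"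


section \<open>Actuation\<close>

definition subbundle ::
  "('q, 'e::euclidean_space) atlas \<Rightarrow> nat \<Rightarrow> ('q \<Rightarrow> 'e set) \<Rightarrow> bool"
  where "subbundle A k W \<longleftrightarrow>
    (\<forall>q\<in>points A. subspace (W q) \<and> dim (W q) = k \<and>
       (\<exists>S w. openin (atlas_topology A) S \<and> q \<in> S \<and>
          (\<forall>i<k. smooth_covector_field_on S A (w i)) \<and>
          (\<forall>r\<in>S. span ((\<lambda>i. w i r) ` {..<k}) = W r)))"

definition annihilator :: "('q \<Rightarrow> 'e::real_inner set) \<Rightarrow> 'q \<Rightarrow> 'e set"
  where "annihilator W q = {v. \<forall>w\<in>W q. w \<bullet> v = 0}"


section \<open>The simple LCB method\<close>

text \<open>Below \<open>Hh\<close>, with metric \<open>\<rho>h\<close> and potential \<open>hh\<close>, is the Lyapunov function ("H hat").\<close>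

definition Upsilon ::
  "('q, 'e::euclidean_space) atlas \<Rightarrow> ('q \<Rightarrow> 'e \<Rightarrow> ('q \<Rightarrow> 'e) \<Rightarrow> 'e) \<Rightarrow>
    ('q \<Rightarrow> 'e \<Rightarrow> 'e \<Rightarrow> real) \<Rightarrow> ('q \<Rightarrow> 'e \<Rightarrow> 'e \<Rightarrow> real) \<Rightarrow> 'q \<times> 'e \<Rightarrow> 'q \<times> 'e \<Rightarrow> 'q \<times> 'e \<Rightarrow> real"
  where "Upsilon A nabla \<rho> \<rho>h \<alpha>1 \<alpha>2 \<alpha>3 =
    base_deriv2 A nabla (kinetic_form \<rho>h) \<alpha>1 \<alpha>2 \<bullet> fiber_deriv (kinetic \<rho>) \<alpha>3 -
    base_deriv2 A nabla (kinetic_form \<rho>) \<alpha>1 \<alpha>2 \<bullet> fiber_deriv (kinetic \<rho>h) \<alpha>3"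

definition ghat :: "('q \<times> 'e::euclidean_space \<Rightarrow> real) \<Rightarrow> 'q \<Rightarrow> 'e \<Rightarrow> 'e \<Rightarrow> real"
  where "ghat Hh q a b = a \<bullet> fiber_deriv Hh (q, b)"

definition What ::
  "('q \<Rightarrow> 'e::euclidean_space \<Rightarrow> 'e \<Rightarrow> real) \<Rightarrow> ('q \<Rightarrow> 'e set) \<Rightarrow> 'q \<Rightarrow> 'e set"
  where "What \<rho>h W q = {a. fiber_deriv (kinetic \<rho>h) (q, a) \<in> annihilator W q}"

definition proj ::
  "('q \<times> 'e::euclidean_space \<Rightarrow> real) \<Rightarrow> ('q \<Rightarrow> 'e set) \<Rightarrow> 'q \<times> 'e \<Rightarrow> 'e"
  where "proj Hh W \<alpha> =
    (THE w. w \<in> W (fst \<alpha>) \<and> (\<forall>\<sigma>\<in>W (fst \<alpha>). ghat Hh (fst \<alpha>) (snd \<alpha> - w) \<sigma> = 0))"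

text \<open>
  A fiber preserving map of the cotangent bundle into itself is represented by its fiber component
  \<open>y\<close>; the map itself is \<open>\<alpha> \<mapsto> (fst \<alpha>, y \<alpha>)\<close>.
\<close>

definition smooth_fiber_preserving ::
  "('q, 'e::euclidean_space) atlas \<Rightarrow> ('q \<times> 'e \<Rightarrow> 'e) \<Rightarrow> bool"
  where "smooth_fiber_preserving A y \<longleftrightarrow>
    smooth_map (cotangent_atlas A) (cotangent_atlas A) (\<lambda>\<alpha>. (fst \<alpha>, y \<alpha>))"

definition lcb_formula ::
  "('q \<times> 'e::euclidean_space \<Rightarrow> real) \<Rightarrow> ('q \<Rightarrow> 'e set) \<Rightarrow> ('q \<times> 'e \<Rightarrow> 'e) \<Rightarrow>
    ('q \<times> 'e \<Rightarrow> 'e) \<Rightarrow> ('q \<times> 'e \<Rightarrow> real) \<Rightarrow> 'q \<times> 'e \<Rightarrow> 'e"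
  where "lcb_formula Hh W zperp x \<mu> \<alpha> =
    (let q = fst \<alpha>; P = proj Hh W \<alpha> in
      x \<alpha> - ((ghat Hh q (x \<alpha>) P + \<mu> \<alpha> - ghat Hh q (zperp \<alpha>) (snd \<alpha>)) / ghat Hh q P P) *\<^sub>R P)"

text \<open>
  The extension \<open>zpar\<close> is unique, as the complement of \<open>What\<close> is dense when \<open>W\<close> has rank at
  least 1.
\<close>

definition given_by_simple_LCB_method ::
  "('q, 'e::euclidean_space) atlas \<Rightarrow> ('q \<Rightarrow> 'e \<Rightarrow> ('q \<Rightarrow> 'e) \<Rightarrow> 'e) \<Rightarrow>
    ('q \<times> 'e \<Rightarrow> real) \<Rightarrow> ('q \<Rightarrow> 'e \<Rightarrow> 'e \<Rightarrow> real) \<Rightarrow> ('q \<Rightarrow> 'e set) \<Rightarrow> 'q \<times> 'e \<Rightarrow>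
    ('q \<times> 'e \<Rightarrow> 'e \<times> 'e) \<Rightarrow> bool"
  where "given_by_simple_LCB_method A nabla H \<rho> W \<alpha>0 Y \<longleftrightarrow>
    (let B = cotangent_atlas A in
     \<exists>Hh \<rho>h hh zperp \<mu> x zpar z y.
      \<comment> \<open>step 1\<close>
      simple_on_cotangent A Hh \<rho>h hh \<and>
      positive_definite_at B Hh \<alpha>0 \<and>
      (\<forall>\<sigma>\<in>points B. snd \<sigma> \<in> What \<rho>h W (fst \<sigma>) \<longrightarrow> poisson A Hh H \<sigma> = 0) \<and>
      \<comment> \<open>step 2\<close>
      smooth_fiber_preserving A zperp \<and>
      (\<forall>\<alpha>\<in>points B.
         zperp \<alpha> \<in> What \<rho>h W (fst \<alpha>) \<and>
         (\<forall>\<sigma>\<in>W (fst \<alpha>). ghat Hh (fst \<alpha>) (zperp \<alpha>) \<sigma> = 0) \<and>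
         (\<forall>\<sigma>\<in>What \<rho>h W (fst \<alpha>).
            ghat Hh (fst \<alpha>) (zperp \<alpha>) \<sigma> = - Upsilon A nabla \<rho> \<rho>h \<alpha> \<alpha> (fst \<alpha>, \<sigma>))) \<and>
      \<comment> \<open>step 3\<close>
      smooth_fun B \<mu> \<and> (\<forall>\<alpha>\<in>points B. \<mu> \<alpha> \<ge> 0) \<and>
      smooth_fiber_preserving A x \<and> (\<forall>\<alpha>\<in>points B. x \<alpha> \<in> W (fst \<alpha>)) \<and>
      smooth_fiber_preserving A zpar \<and>
      (\<forall>\<alpha>\<in>points B. snd \<alpha> \<notin> What \<rho>h W (fst \<alpha>) \<longrightarrow> zpar \<alpha> = lcb_formula Hh W zperp x \<mu> \<alpha>) \<and>
      limitin (atlas_topology B) (\<lambda>\<alpha>. (fst \<alpha>, lcb_formula Hh W zperp x \<mu> \<alpha>)) (fst \<alpha>0, 0)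
        (atin_within (atlas_topology B) \<alpha>0 {\<alpha>. snd \<alpha> \<notin> What \<rho>h W (fst \<alpha>)}) \<and>
      \<comment> \<open>step 4\<close>
      (\<forall>\<alpha>\<in>points B. z \<alpha> = zpar \<alpha> - zperp \<alpha>) \<and>
      (\<forall>\<alpha>\<in>points B.
         y \<alpha> = z \<alpha> - inv (\<lambda>a. fiber_deriv Hh (fst \<alpha>, a))
           (fiber_deriv H (fst \<alpha>, base_deriv A nabla Hh \<alpha>) -
            fiber_deriv Hh (fst \<alpha>, base_deriv A nabla H \<alpha>))) \<and>
      (\<forall>\<alpha>\<in>points B. Y \<alpha> = vlift A \<alpha> (y \<alpha>)))"

end

theory Submission
  imports Defs
begin

text \<open>
  Write \<open>Hh\<close> for the given Lyapunov function, \<open>y\<close> for the fiber component of \<open>Y\<close>, and \<open>D\<close> for the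
  fiber preserving map determined by \<open>ghat (D \<alpha>) \<sigma> = B Hh(\<alpha>) \<cdot> F H(\<sigma>) - B H(\<alpha>) \<cdot> F Hh(\<sigma>)\<close>. As the
  connection has no torsion, \<open>ghat (D \<alpha>) \<alpha>\<close> is the Poisson bracket \<open>{Hh, H}\<close>, so the Lyapunov
  inequality says that \<open>ghat (y \<alpha> + D \<alpha>) \<alpha> \<le> 0\<close>. On \<open>What\<close> the term with \<open>y\<close> vanishes, and the
  bracket, an odd function of the covector, vanishes as well, together with its linear part;
  therefore \<open>D\<close> represents \<open>Upsilon\<close> on \<open>What\<close>. Splitting \<open>D\<close> orthogonally, one may take \<open>zperp =
  P D - D\<close>, \<open>zpar = x = y + P D\<close> and \<open>\<mu> \<alpha> = - ghat (y \<alpha> + D \<alpha>) \<alpha>\<close>: the coefficient of \<open>P\<close> in the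
  formula of step 3 is then zero.

  The base derivatives are defined by a definite description over all horizontal curves. Their
  uniqueness rests on the existence of parallel transport, a linear differential equation in a
  chart. Smoothness of musical maps and projections comes from the Gram-Schmidt process with
  smooth coefficients.
\<close>

section \<open>Calculus of smooth maps\<close>

text \<open>Step 4 leaves no freedom in the choice of \<open>z\<close>: it has to be
  \<open>y + D\<close>. Its component in W must then be \<open>zpar\<close> and its component in
  What the negative of \<open>zperp\<close>; this is the origin of the witnesses. The formula of
  step 3 is singular on What, where the projection of the covector vanishes. Letting
  \<open>x\<close> be the extension itself and \<open>\<mu>\<close> the exact rate of decrease of
  the Lyapunov function removes the singular term, so that no quotient ever has to be extended. The
  limit at \<open>\<alpha>0\<close> is 0 because \<open>\<alpha>0\<close> is a zero of X_H, a zero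
  of X_H + Y and a minimum of the Lyapunov function, which makes \<open>y\<close> and
  \<open>D\<close> vanish there. Much of the rest is shaped by the representation of vectors and
  covectors by coordinates in a preferred chart, chosen arbitrarily at each point. A smooth field
  need not have a continuous representative, so smoothness is always expressed by components in one
  fixed chart. Moreover, the preferred chart of the cotangent bundle at a covector need not be
  induced by the preferred chart of the base.\<close>

lemma ck_on_cong:
  assumes "open S" "\<And>x. x \<in> S \<Longrightarrow> f x = g x"
  shows "ck_on k S f \<longleftrightarrow> ck_on k S g"
  using assms(2)
proof (induction k arbitrary: f g)
  case 0
  then show ?case by (simp cong: continuous_on_cong)
next
  case (Suc k)
  have imp: "ck_on (Suc k) S g'" if "ck_on (Suc k) S f'" "\<And>x. x \<in> S \<Longrightarrow> f' x = g' x" for f' g' :: "'a \<Rightarrow> 'b"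
  proof -
    have d: "f' differentiable (at x)" if "x \<in> S" for x
      using \<open>ck_on (Suc k) S f'\<close> that assms(1) by (simp add: differentiable_on_eq_differentiable_at)
    then have "g' differentiable (at x)" if "x \<in> S" for x
      by (metis assms(1) differentiable_def has_derivative_transform_within_open that \<open>\<And>x. x \<in> S \<Longrightarrow> f' x
        = g' x\<close>)
    \<comment> \<open>As S is open, both functions agree in a neighbourhood of x. This is what makes
      the arbitrary values of coordinate maps outside their domains harmless.\<close>
    moreover have "frechet_derivative f' (at x) = frechet_derivative g' (at x)" if "x \<in> S" for x
      using frechet_derivative_transform_within_open[OF d[OF that] assms(1) that] \<open>\<And>x. x \<in> S \<Longrightarrow> f' x =
        g' x\<close> by blast
    ultimately show ?thesis
      using that(1) Suc.IH[of "\<lambda>x. frechet_derivative f' (at x) v" "\<lambda>x. frechet_derivative g' (at x) v"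
        for v]
      by (auto simp: differentiable_on_eq_differentiable_at[OF assms(1)])
  qed
  show ?case
    using imp[of f g, OF _ Suc.prems] imp[of g f, OF _ Suc.prems[symmetric]] by blast
qed

text \<open>Any explicit derivative may stand in for \<open>frechet_derivative\<close>; the rules
  for products, compositions and reciprocals are proved by exhibiting one.\<close>

lemma ck_on_SucI:
  assumes "open S" "\<And>x. x \<in> S \<Longrightarrow> (f has_derivative f' x) (at x)" "\<And>v. ck_on k S (\<lambda>x. f' x v)"
  shows "ck_on (Suc k) S f"
proof -
  have "ck_on k S (\<lambda>x. frechet_derivative f (at x) v)" for v
    using ck_on_cong[OF assms(1), of "\<lambda>x. f' x v" "\<lambda>x. frechet_derivative f (at x) v" k] assms(3)[of v]
      frechet_derivative_at[OF assms(2)] by metis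
  moreover have "f differentiable_on S"
    using assms(2) by (auto simp: differentiable_on_eq_differentiable_at[OF assms(1)] differentiable_def)
  ultimately show ?thesis by simp
qed

lemma ck_on_Suc_has_derivative:
  assumes "open S" "ck_on (Suc k) S f" "x \<in> S"
  shows "(f has_derivative frechet_derivative f (at x)) (at x)"
  using assms by (simp add: differentiable_on_eq_differentiable_at frechet_derivative_works)

lemma ck_on_Suc_imp: "ck_on (Suc k) S f \<Longrightarrow> ck_on k S f"
proof (induction k arbitrary: f)
  case 0
  then show ?case by (simp add: differentiable_imp_continuous_on)
next
  case (Suc k)
  then show ?case using ck_on.simps(2) by blast
qed

lemma ck_on_continuous: "ck_on k S f \<Longrightarrow> continuous_on S f"
  by (cases k) (auto intro: differentiable_imp_continuous_on)

lemma ck_on_subset: "ck_on k S f \<Longrightarrow> T \<subseteq> S \<Longrightarrow> ck_on k T f"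
  by (induction k arbitrary: f) (auto intro: continuous_on_subset differentiable_on_subset)

text \<open>Needed for subbundles: the covector fields that span them exist only near each
  point.\<close>

lemma ck_on_local:
  assumes "open S" "\<And>x. x \<in> S \<Longrightarrow> \<exists>T. open T \<and> x \<in> T \<and> ck_on k (S \<inter> T) f"
  shows "ck_on k S f"
  using assms(2)
proof (induction k arbitrary: f)
  case 0
  have "isCont f x" if x: "x \<in> S" for x
  proof -
    obtain T where T: "open T" "x \<in> T" "continuous_on (S \<inter> T) f"
      using 0 x by auto
    then show ?thesis
      using assms(1) x continuous_on_interior by (metis IntI interior_open open_Int)
  qed
  then show ?case
    by (simp add: continuous_at_imp_continuous_on)
next
  case (Suc k)
  have d: "f differentiable (at x)" if x: "x \<in> S" for x
  proof -
    obtain T where T: "open T" "x \<in> T" "f differentiable_on (S \<inter> T)"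
      using Suc.prems x by (metis ck_on.simps(2))
    then show ?thesis
      using assms(1) x by (metis IntI at_within_open differentiable_on_def open_Int)
  qed
  have "ck_on k S (\<lambda>x. frechet_derivative f (at x) v)" for v
  proof (rule Suc.IH)
    fix x assume x: "x \<in> S"
    show "\<exists>T. open T \<and> x \<in> T \<and> ck_on k (S \<inter> T) (\<lambda>x. frechet_derivative f (at x) v)"
      using Suc.prems[OF x] by (metis ck_on.simps(2))
  qed
  then show ?case using d assms(1) by (simp add: differentiable_on_eq_differentiable_at)
qed

lemma ck_on_const: "open S \<Longrightarrow> ck_on k S (\<lambda>x. c)"
proof (induction k arbitrary: c)
  case (Suc k)
  show ?case by (rule ck_on_SucI[of S _ "\<lambda>x v. 0"]) (use Suc in \<open>auto\<close>)
qed simp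

lemma ck_on_bounded_linear:
  assumes "bounded_linear h" "open S" "ck_on k S f"
  shows "ck_on k S (\<lambda>x. h (f x))"
  using assms(3)
proof (induction k arbitrary: f)
  case 0
  then show ?case using assms(1) by (auto intro: bounded_linear.continuous_on)
next
  case (Suc k)
  show ?case
  proof (rule ck_on_SucI[OF assms(2)])
    show "((\<lambda>x. h (f x)) has_derivative (\<lambda>v. h (frechet_derivative f (at x) v))) (at x)" if "x \<in> S" for x
      using bounded_linear.has_derivative[OF assms(1) ck_on_Suc_has_derivative[OF assms(2) Suc.prems
        that]] .
    show "ck_on k S (\<lambda>x. h (frechet_derivative f (at x) v))" for v
      using Suc by auto
  qed
qed

lemma ck_on_id: "open S \<Longrightarrow> ck_on k S (\<lambda>x. x)"
proof (cases k)
  case (Suc j)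
  assume "open S"
  then show ?thesis unfolding Suc
    by (intro ck_on_SucI[of S _ "\<lambda>x v. v"]) (auto intro: ck_on_const)
qed simp

lemma ck_on_add:
  assumes "open S" "ck_on k S f" "ck_on k S g"
  shows "ck_on k S (\<lambda>x. f x + g x)"
  using assms(2,3)
proof (induction k arbitrary: f g)
  case 0
  then show ?case by (auto intro: continuous_on_add)
next
  case (Suc k)
  show ?case
  proof (rule ck_on_SucI[OF assms(1)])
    show "((\<lambda>x. f x + g x) has_derivative (\<lambda>v. frechet_derivative f (at x) v + frechet_derivative g (at
      x) v)) (at x)"
      if "x \<in> S" for x
      using ck_on_Suc_has_derivative[OF assms(1) _ that] Suc.prems by (intro has_derivative_add) auto
    show "ck_on k S (\<lambda>x. frechet_derivative f (at x) v + frechet_derivative g (at x) v)" for v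
      using Suc by auto
  qed
qed

lemma ck_on_sum:
  assumes "open S" "\<And>i. i \<in> I \<Longrightarrow> ck_on k S (f i)"
  shows "ck_on k S (\<lambda>x. \<Sum>i\<in>I. f i x)"
  using assms(2)
  by (induction I rule: infinite_finite_induct) (auto intro: ck_on_const ck_on_add assms(1))

lemma ck_on_bilinear:
  assumes "bounded_bilinear pr" "open S" "ck_on k S f" "ck_on k S g"
  shows "ck_on k S (\<lambda>x. pr (f x) (g x))"
  using assms(3,4)
proof (induction k arbitrary: f g)
  case 0
  then show ?case using assms(1) by (auto intro: bounded_bilinear.continuous_on)
next
  case (Suc k)
  show ?case
  proof (rule ck_on_SucI[OF assms(2)])
    show "((\<lambda>x. pr (f x) (g x)) has_derivative
        (\<lambda>v. pr (f x) (frechet_derivative g (at x) v) + pr (frechet_derivative f (at x) v) (g x))) (at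
          x)"
      if "x \<in> S" for x
      by (rule bounded_bilinear.FDERIV[OF assms(1) ck_on_Suc_has_derivative[OF assms(2) Suc.prems(1)
        that] ck_on_Suc_has_derivative[OF assms(2) Suc.prems(2) that]])
    show "ck_on k S (\<lambda>x. pr (f x) (frechet_derivative g (at x) v) + pr (frechet_derivative f (at x) v)
      (g x))" for v
      \<comment> \<open>The product rule keeps one factor undifferentiated, and this factor is used
        with one degree of smoothness less than it has.\<close>
      using Suc.prems Suc.prems[THEN ck_on_Suc_imp] by (intro ck_on_add[OF assms(2)] Suc.IH) auto
  qed
qed

lemma linear_eq_sum_Basis:
  fixes L :: "'a::euclidean_space \<Rightarrow> 'b::real_vector"
  assumes "linear L"
  shows "L v = (\<Sum>b\<in>Basis. (v \<bullet> b) *\<^sub>R L b)"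
proof -
  have "L v = L (\<Sum>b\<in>Basis. (v \<bullet> b) *\<^sub>R b)" by (simp only: euclidean_representation)
  then show ?thesis by (simp only: linear_sum[OF assms] linear_cmul[OF assms])
qed

text \<open>\<open>ck_on\<close> controls derivatives in constant directions only, whereas the chain
  rule evaluates the derivative of g in the moving direction f'(x) v. Expanding this direction in
  the finite basis of the intermediate space separates the two.\<close>

lemma ck_on_compose:
  fixes f :: "'a::real_normed_vector \<Rightarrow> 'b::euclidean_space" and g :: "'b \<Rightarrow> 'c::real_normed_vector"
  assumes "open S" "open T" "f ` S \<subseteq> T" "ck_on k S f" "ck_on k T g"
  shows "ck_on k S (\<lambda>x. g (f x))"
  using assms(4,5)
proof (induction k arbitrary: g)
  case 0
  then show ?case using assms(3) by (auto intro: continuous_on_compose2)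
next
  case (Suc k)
  let ?f' = "\<lambda>x. frechet_derivative f (at x)" and ?g' = "\<lambda>y. frechet_derivative g (at y)"
  show ?case
  proof (rule ck_on_SucI[OF assms(1)])
    fix x assume x: "x \<in> S"
    have f: "(f has_derivative ?f' x) (at x)"
      by (rule ck_on_Suc_has_derivative[OF assms(1) Suc.prems(1) x])
    have g: "(g has_derivative ?g' (f x)) (at (f x))"
      using assms(3) x by (intro ck_on_Suc_has_derivative[OF assms(2) Suc.prems(2)]) auto
    have lin: "linear (?g' (f x))" using g has_derivative_linear by blast
    have "(\<lambda>v. \<Sum>b\<in>Basis. (?f' x v \<bullet> b) *\<^sub>R ?g' (f x) b) = (\<lambda>v. ?g' (f x) (?f' x v))"
      by (simp only: linear_eq_sum_Basis[OF lin, symmetric])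
    then show "((\<lambda>x. g (f x)) has_derivative (\<lambda>v. \<Sum>b\<in>Basis. (?f' x v \<bullet> b) *\<^sub>R ?g' (f x) b)) (at x)"
      using has_derivative_compose[OF f g] by simp
  next
    fix v
    have "ck_on k S (\<lambda>x. ?g' (f x) b)" for b
      using Suc.prems by (intro Suc.IH) (auto intro: ck_on_Suc_imp)
    then show "ck_on k S (\<lambda>x. \<Sum>b\<in>Basis. (?f' x v \<bullet> b) *\<^sub>R ?g' (f x) b)"
      using Suc.prems(1)
      by (intro ck_on_sum ck_on_bilinear[OF bounded_bilinear_scaleR]
          ck_on_bounded_linear[OF bounded_linear_inner_left] assms(1)) auto
  qed
qed

lemma ck_on_inverse:
  fixes f :: "'a::real_normed_vector \<Rightarrow> real"
  assumes "open S" "ck_on k S f" "\<And>x. x \<in> S \<Longrightarrow> f x \<noteq> 0"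
  shows "ck_on k S (\<lambda>x. inverse (f x))"
  using assms(2)
proof (induction k)
  case 0
  then show ?case using assms(3) by (auto intro!: continuous_intros)
next
  case (Suc k)
  show ?case
  proof (rule ck_on_SucI[OF assms(1)])
    show "((\<lambda>x. inverse (f x)) has_derivative (\<lambda>v. - (inverse (f x) * frechet_derivative f (at x) v *
      inverse (f x)))) (at x)"
      if "x \<in> S" for x
      by (rule Deriv.has_derivative_inverse[OF assms(3)[OF that] ck_on_Suc_has_derivative[OF assms(1)
        Suc.prems that]])
    have "ck_on k S (\<lambda>x. inverse (f x) * frechet_derivative f (at x) v * inverse (f x))" for v
      using Suc ck_on_Suc_imp[OF Suc.prems] by (intro ck_on_bilinear[OF bounded_bilinear_mult]
        assms(1)) auto
    then show "ck_on k S (\<lambda>x. - (inverse (f x) * frechet_derivative f (at x) v * inverse (f x)))" for v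
      using ck_on_bounded_linear[OF bounded_linear_minus[OF bounded_linear_ident] assms(1)] by blast
  qed
qed

section \<open>Closure rules for infinitely differentiable maps\<close>

lemma smooth_on_cong:
  "open S \<Longrightarrow> (\<And>x. x \<in> S \<Longrightarrow> f x = g x) \<Longrightarrow> smooth_on S f \<longleftrightarrow> smooth_on S g"
  using ck_on_cong unfolding smooth_on_def by blast

lemma smooth_on_continuous: "smooth_on S f \<Longrightarrow> continuous_on S f"
  unfolding smooth_on_def using ck_on_continuous by blast

lemma smooth_on_subset: "smooth_on S f \<Longrightarrow> T \<subseteq> S \<Longrightarrow> smooth_on T f"
  unfolding smooth_on_def using ck_on_subset by blast

lemma smooth_on_local:
  "open S \<Longrightarrow> (\<And>x. x \<in> S \<Longrightarrow> \<exists>T. open T \<and> x \<in> T \<and> smooth_on (S \<inter> T) f) \<Longrightarrow> smooth_on S f"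
  unfolding smooth_on_def using ck_on_local by metis

lemma smooth_on_const: "open S \<Longrightarrow> smooth_on S (\<lambda>x. c)"
  unfolding smooth_on_def using ck_on_const by blast

lemma smooth_on_bounded_linear:
  "bounded_linear h \<Longrightarrow> open S \<Longrightarrow> smooth_on S f \<Longrightarrow> smooth_on S (\<lambda>x. h (f x))"
  unfolding smooth_on_def using ck_on_bounded_linear by blast

lemma smooth_on_id: "open S \<Longrightarrow> smooth_on S (\<lambda>x. x)"
  unfolding smooth_on_def using ck_on_id by blast

lemma smooth_on_add:
  "open S \<Longrightarrow> smooth_on S f \<Longrightarrow> smooth_on S g \<Longrightarrow> smooth_on S (\<lambda>x. f x + g x)"
  unfolding smooth_on_def using ck_on_add by blast

lemma smooth_on_uminus: "open S \<Longrightarrow> smooth_on S f \<Longrightarrow> smooth_on S (\<lambda>x. - f x)"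
  by (rule smooth_on_bounded_linear[OF bounded_linear_minus[OF bounded_linear_ident]])

lemma smooth_on_diff:
  "open S \<Longrightarrow> smooth_on S f \<Longrightarrow> smooth_on S g \<Longrightarrow> smooth_on S (\<lambda>x. f x - g x)"
  using smooth_on_add[OF _ _ smooth_on_uminus, of S f g] by simp

lemma smooth_on_sum:
  "open S \<Longrightarrow> (\<And>i. i \<in> I \<Longrightarrow> smooth_on S (f i)) \<Longrightarrow> smooth_on S (\<lambda>x. \<Sum>i\<in>I. f i x)"
  unfolding smooth_on_def using ck_on_sum by metis

lemma smooth_on_bilinear:
  "bounded_bilinear pr \<Longrightarrow> open S \<Longrightarrow> smooth_on S f \<Longrightarrow> smooth_on S g \<Longrightarrow>
    smooth_on S (\<lambda>x. pr (f x) (g x))"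
  unfolding smooth_on_def using ck_on_bilinear by blast

lemmas smooth_on_mult = smooth_on_bilinear[OF bounded_bilinear_mult]
lemmas smooth_on_scaleR = smooth_on_bilinear[OF bounded_bilinear_scaleR]
lemmas smooth_on_inner = smooth_on_bilinear[OF bounded_bilinear_inner]

lemma smooth_on_compose:
  fixes f :: "'a::real_normed_vector \<Rightarrow> 'b::euclidean_space" and g :: "'b \<Rightarrow> 'c::real_normed_vector"
  shows "open S \<Longrightarrow> open T \<Longrightarrow> smooth_on T g \<Longrightarrow> smooth_on S f \<Longrightarrow> f ` S \<subseteq> T \<Longrightarrow>
    smooth_on S (\<lambda>x. g (f x))"
  unfolding smooth_on_def using ck_on_compose by blast

lemma smooth_on_divide:
  fixes f g :: "'a::real_normed_vector \<Rightarrow> real"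
  shows "open S \<Longrightarrow> smooth_on S f \<Longrightarrow> smooth_on S g \<Longrightarrow> (\<And>x. x \<in> S \<Longrightarrow> g x \<noteq> 0) \<Longrightarrow>
    smooth_on S (\<lambda>x. f x / g x)"
  using smooth_on_mult[of S f "\<lambda>x. inverse (g x)"] ck_on_inverse[of S _ g]
  unfolding smooth_on_def by (simp add: divide_inverse)

lemma smooth_on_Pair:
  "open S \<Longrightarrow> smooth_on S f \<Longrightarrow> smooth_on S g \<Longrightarrow> smooth_on S (\<lambda>x. (f x, g x))"
  using smooth_on_add[of S "\<lambda>x. (f x, 0)" "\<lambda>x. (0, g x)"]
    smooth_on_bounded_linear[OF bounded_linear_Pair[OF bounded_linear_ident bounded_linear_zero], of S f]
    smooth_on_bounded_linear[OF bounded_linear_Pair[OF bounded_linear_zero bounded_linear_ident], of S g]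
  by simp

lemma smooth_on_has_derivative:
  "open S \<Longrightarrow> smooth_on S f \<Longrightarrow> x \<in> S \<Longrightarrow> (f has_derivative frechet_derivative f (at x)) (at x)"
  unfolding smooth_on_def using ck_on_Suc_has_derivative by blast

lemma smooth_on_frechet_derivative:
  "smooth_on S f \<Longrightarrow> smooth_on S (\<lambda>x. frechet_derivative f (at x) v)"
  unfolding smooth_on_def using ck_on.simps(2) by blast

text \<open>Same device as in the chain rule: a family of linear maps is known through its values on
  the basis, in which the moving argument is expanded.\<close>

lemma smooth_on_linear_apply:
  fixes v :: "'a::real_normed_vector \<Rightarrow> 'b::euclidean_space" and L :: "'a \<Rightarrow> 'b \<Rightarrow> 'c::real_normed_vector"
  assumes "open S" "\<And>x. x \<in> S \<Longrightarrow> linear (L x)" "smooth_on S v"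
    "\<And>b. b \<in> Basis \<Longrightarrow> smooth_on S (\<lambda>x. L x b)"
  shows "smooth_on S (\<lambda>x. L x (v x))"
proof -
  have "L x (v x) = (\<Sum>b\<in>Basis. (v x \<bullet> b) *\<^sub>R L x b)" if "x \<in> S" for x
    using linear_eq_sum_Basis[OF assms(2)[OF that]] .
  moreover have "smooth_on S (\<lambda>x. \<Sum>b\<in>Basis. (v x \<bullet> b) *\<^sub>R L x b)"
    by (intro smooth_on_sum smooth_on_scaleR smooth_on_inner smooth_on_const assms)
  ultimately show ?thesis
    by (subst smooth_on_cong[OF assms(1)])
qed

text \<open>The components of the adjoint are inner products with the columns of L, so no smoothness
  of the adjoint itself is presupposed.\<close>

lemma smooth_on_adjoint_apply:
  fixes v :: "'a::real_normed_vector \<Rightarrow> 'b::euclidean_space" and L :: "'a \<Rightarrow> 'b \<Rightarrow> 'b"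
  assumes "open S" "\<And>x. x \<in> S \<Longrightarrow> linear (L x)" "smooth_on S v"
    "\<And>b. b \<in> Basis \<Longrightarrow> smooth_on S (\<lambda>x. L x b)"
  shows "smooth_on S (\<lambda>x. adjoint (L x) (v x))"
proof -
  have "adjoint (L x) (v x) = (\<Sum>b\<in>Basis. (v x \<bullet> L x b) *\<^sub>R b)" if "x \<in> S" for x
    using euclidean_representation[of "adjoint (L x) (v x)"] adjoint_clauses(2)[OF assms(2)[OF that]]
      by simp
  moreover have "smooth_on S (\<lambda>x. \<Sum>b\<in>Basis. (v x \<bullet> L x b) *\<^sub>R b)"
    by (intro smooth_on_sum smooth_on_scaleR smooth_on_inner smooth_on_const assms)
  ultimately show ?thesis
    by (subst smooth_on_cong[OF assms(1)])
qed

lemma smooth_on_bilinear_apply: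
  fixes v w :: "'a::real_normed_vector \<Rightarrow> 'b::euclidean_space" and g :: "'a \<Rightarrow> 'b \<Rightarrow> 'b \<Rightarrow>
    'c::real_normed_vector"
  assumes "open S" "\<And>x. x \<in> S \<Longrightarrow> bilinear (g x)" "smooth_on S v" "smooth_on S w"
    "\<And>b b'. b \<in> Basis \<Longrightarrow> b' \<in> Basis \<Longrightarrow> smooth_on S (\<lambda>x. g x b b')"
  shows "smooth_on S (\<lambda>x. g x (v x) (w x))"
proof (rule smooth_on_linear_apply[OF assms(1) _ assms(4)])
  show "linear (g x (v x))" if "x \<in> S" for x using assms(2)[OF that] by (simp add: bilinear_def)
  show "smooth_on S (\<lambda>x. g x (v x) b)" if "b \<in> Basis" for b
    by (rule smooth_on_linear_apply[OF assms(1) _ assms(3), of "\<lambda>x a. g x a b"])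
      (use assms(2) assms(5)[OF _ that] in \<open>auto simp: bilinear_def\<close>)
qed

section \<open>Smooth Riesz representation\<close>

text \<open>
  The induction is the Gram-Schmidt process: \<open>u\<close> is the part of \<open>w n\<close> orthogonal to the span of
  the earlier vectors.
\<close>

lemma smooth_riesz:
  fixes g :: "'a::real_normed_vector \<Rightarrow> 'e::euclidean_space \<Rightarrow> 'e \<Rightarrow> real" and n :: nat
  assumes S: "open S"
    and bil: "\<And>z. z \<in> S \<Longrightarrow> bilinear (g z)"
    and sym: "\<And>z a b. z \<in> S \<Longrightarrow> g z a b = g z b a"
    and pos: "\<And>z a. z \<in> S \<Longrightarrow> a \<noteq> 0 \<Longrightarrow> g z a a > 0"
    and g: "\<And>b b'. b \<in> Basis \<Longrightarrow> b' \<in> Basis \<Longrightarrow> smooth_on S (\<lambda>z. g z b b')"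
    and w: "\<And>i. i < n \<Longrightarrow> smooth_on S (w i)"
    and indep: "\<And>i z. i < n \<Longrightarrow> z \<in> S \<Longrightarrow> w i z \<notin> span ((\<lambda>j. w j z) ` {..<i})"
    and lin: "\<And>z. z \<in> S \<Longrightarrow> linear (l z)"
    and l: "\<And>b. b \<in> Basis \<Longrightarrow> smooth_on S (\<lambda>z. l z b)"
  shows "\<exists>v. smooth_on S v \<and> (\<forall>z\<in>S. v z \<in> span ((\<lambda>j. w j z) ` {..<n}) \<and> (\<forall>i<n. g z (v z) (w i z) = l z
    (w i z)))"
  using w indep lin l
proof (induction n arbitrary: l)
  case 0
  show ?case by (rule exI[of _ "\<lambda>z. 0"]) (auto intro: smooth_on_const S)
next
  case (Suc n)
  have lin_right: "linear (g z a)" and lin_left: "linear (\<lambda>b. g z b a)" if "z \<in> S" for z a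
    using bil[OF that] by (auto simp: bilinear_def)
  have ex: "\<exists>v. smooth_on S v \<and> (\<forall>z\<in>S. v z \<in> span ((\<lambda>j. w j z) ` {..<n}) \<and> (\<forall>i<n. g z (v z) (w i z) =
    l' z (w i z)))"
    if "\<And>z. z \<in> S \<Longrightarrow> linear (l' z)" "\<And>b. b \<in> Basis \<Longrightarrow> smooth_on S (\<lambda>z. l' z b)" for l'
    by (rule Suc.IH[of l', OF Suc.prems(1,2)]) (simp_all add: that)
  obtain v where v: "smooth_on S v" and v_span: "\<And>z. z \<in> S \<Longrightarrow> v z \<in> span ((\<lambda>j. w j z) ` {..<n})"
    and v_eq: "\<And>z i. z \<in> S \<Longrightarrow> i < n \<Longrightarrow> g z (v z) (w i z) = l z (w i z)"
    using ex[of l, OF Suc.prems(3,4)] by blast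
  \<comment> \<open>Second use of the induction hypothesis, now for the functional
    \<open>g z (w n z)\<close>: the vector p that represents it on the span of the earlier vectors
    is the orthogonal projection of \<open>w n z\<close> to this span. This is why l is kept
    arbitrary.\<close>
  have "smooth_on S (\<lambda>z. g z (w n z) b)" if "b \<in> Basis" for b
    by (rule smooth_on_bilinear_apply[OF S bil Suc.prems(1)[of n] smooth_on_const[OF S] g]) auto
  then obtain p where p: "smooth_on S p" and p_span: "\<And>z. z \<in> S \<Longrightarrow> p z \<in> span ((\<lambda>j. w j z) ` {..<n})"
    and p_eq: "\<And>z i. z \<in> S \<Longrightarrow> i < n \<Longrightarrow> g z (p z) (w i z) = g z (w n z) (w i z)"
    using ex[of "\<lambda>z. g z (w n z)", OF lin_right] by blast
  define u where "u z = w n z - p z" for z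
  have u: "smooth_on S u" unfolding u_def using Suc.prems(1) p S by (intro smooth_on_diff) auto
  have u_nz: "u z \<noteq> 0" if "z \<in> S" for z
    using Suc.prems(2)[of n z] p_span[OF that] that by (auto simp: u_def)
  have u_orth: "g z u' (u z) = 0" if z: "z \<in> S" and "u' \<in> span ((\<lambda>j. w j z) ` {..<n})" for z u'
  proof (rule span_induct[OF that(2)])
    show "subspace {a. g z a (u z) = 0}"
      using lin_left[OF z, of "u z"] linear_0[OF lin_left[OF z]] by (auto simp: subspace_def linear_iff)
  next
    fix a assume "a \<in> (\<lambda>j. w j z) ` {..<n}"
    then obtain j where j: "j < n" "a = w j z" by auto
    have "g z (u z) a = 0"
      using p_eq[OF z j(1)] linear_diff[OF lin_left[OF z, of a]] by (simp add: u_def j(2))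
    then show "g z a (u z) = 0" using sym[OF z] by metis
  qed
  \<comment> \<open>The correction along u does not disturb the equations already solved, because u
    is orthogonal to the earlier vectors. Since v is orthogonal to u as well, the coefficient makes
    the equation hold at u, hence at w n = u + p.\<close>
  define v' where "v' z = v z + (l z (u z) / g z (u z) (u z)) *\<^sub>R u z" for z
  have "g z (u z) (u z) \<noteq> 0" if "z \<in> S" for z
    using pos[OF that u_nz[OF that]] by simp
  moreover have "smooth_on S (\<lambda>z. l z (u z))" "smooth_on S (\<lambda>z. g z (u z) (u z))"
    by (rule smooth_on_linear_apply[OF S Suc.prems(3) u Suc.prems(4)] smooth_on_bilinear_apply[OF S bil
      u u g]; assumption)+
  ultimately have "smooth_on S (\<lambda>z. l z (u z) / g z (u z) (u z))"
    by (intro smooth_on_divide S)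
  then have "smooth_on S v'"
    unfolding v'_def by (intro smooth_on_add smooth_on_scaleR S u v)
  moreover have "v' z \<in> span ((\<lambda>j. w j z) ` {..<Suc n}) \<and> (\<forall>i<Suc n. g z (v' z) (w i z) = l z (w i z))"
    if z: "z \<in> S" for z
  proof
    have mono: "span ((\<lambda>j. w j z) ` {..<n}) \<subseteq> span ((\<lambda>j. w j z) ` {..<Suc n})"
      by (intro span_mono) auto
    have "w n z \<in> span ((\<lambda>j. w j z) ` {..<Suc n})" by (rule span_base) auto
    then show "v' z \<in> span ((\<lambda>j. w j z) ` {..<Suc n})"
      using mono v_span[OF z] p_span[OF z] unfolding v'_def u_def
      by (intro span_add span_scale span_diff) auto
    have step: "g z (v' z) a = g z (v z) a + (l z (u z) / g z (u z) (u z)) * g z (u z) a" for a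
      unfolding v'_def using lin_left[OF z, of a] by (simp add: linear_iff)
    have eq_span: "g z (v' z) a = l z a" if "a \<in> span ((\<lambda>j. w j z) ` {..<n})" for a
    proof -
      have "g z (v z) a = l z a"
      proof (rule span_induct[OF that])
        show "subspace {a. g z (v z) a = l z a}"
          using lin_right[OF z, of "v z"] Suc.prems(3)[OF z] linear_0[OF lin_right[OF z]] linear_0[OF
            Suc.prems(3)[OF z]]
          by (auto simp: subspace_def linear_iff)
      qed (use v_eq z in auto)
      then show ?thesis using step u_orth[OF z that] sym[OF z, of "u z" a] by simp
    qed
    have "g z (v' z) (u z) = l z (u z)"
      using step u_orth[OF z v_span[OF z]] pos[OF z u_nz[OF z]] by simp
    moreover have "w n z = u z + p z" by (simp add: u_def)
    ultimately have "g z (v' z) (w n z) = l z (w n z)"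
      using eq_span[OF p_span[OF z]] linear_add[OF lin_right[OF z]] linear_add[OF Suc.prems(3)[OF z]]
        by metis
    then show "\<forall>i<Suc n. g z (v' z) (w i z) = l z (w i z)"
      using eq_span[OF span_base] by (auto simp: less_Suc_eq)
  qed
  ultimately show ?case by blast
qed

section \<open>Linear differential equations\<close>

text \<open>Picard iteration: the integral operator is a contraction on a short interval. A short
  time suffices, since parallel transport is needed only to realize an initial velocity.\<close>

lemma linear_ode_exists:
  fixes N :: "real \<Rightarrow> 'e::euclidean_space \<Rightarrow> 'e"
  assumes "\<delta> > 0" and lin: "\<And>s. s \<in> {-\<delta>..\<delta>} \<Longrightarrow> linear (N s)"
    and cont: "\<And>b. b \<in> Basis \<Longrightarrow> continuous_on {-\<delta>..\<delta>} (\<lambda>s. N s b)"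
  shows "\<exists>\<epsilon>>0. \<epsilon> \<le> \<delta> \<and> (\<exists>p. p 0 = p0 \<and> (\<forall>s\<in>{-\<epsilon><..<\<epsilon>}. (p has_vector_derivative N s (p s)) (at s)))"
proof -
  have "\<forall>b\<in>Basis. \<exists>K. \<forall>s\<in>{-\<delta>..\<delta>}. norm (N s b) \<le> K"
    using compact_continuous_image[OF cont compact_Icc] compact_imp_bounded
    by (fastforce simp: bounded_iff)
  then obtain K0 where K0: "\<And>b s. b \<in> Basis \<Longrightarrow> s \<in> {-\<delta>..\<delta>} \<Longrightarrow> norm (N s b) \<le> K0 b"
    by metis
  define K where "K = (\<Sum>b\<in>Basis. \<bar>K0 b\<bar>)"
  have "K \<ge> 0" by (simp add: K_def sum_nonneg)
  have K: "norm (N s v) \<le> K * norm v" if s: "s \<in> {-\<delta>..\<delta>}" for s v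
  proof -
    have "norm (N s v) \<le> (\<Sum>b\<in>Basis. norm ((v \<bullet> b) *\<^sub>R N s b))"
      using linear_eq_sum_Basis[OF lin[OF s], of v] norm_sum by metis
    also have "\<dots> \<le> (\<Sum>b\<in>Basis. norm v * \<bar>K0 b\<bar>)"
      using order_trans[OF K0[OF _ s] abs_ge_self] Basis_le_norm[of _ v] by (auto intro!: sum_mono
        mult_mono)
    finally show ?thesis by (simp add: K_def sum_distrib_left mult.commute)
  qed
  \<comment> \<open>A difference of two values of the operator contains two integrals over intervals
    of length at most 2 \<epsilon>, so the Lipschitz constant is at most 4 \<epsilon> K. The factor
    8 brings it down to 1/2, and K + 1 keeps the denominator positive when K = 0.\<close>
  define \<epsilon> where "\<epsilon> = min \<delta> (1 / (8 * (K + 1)))"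
  have "\<epsilon> > 0" "\<epsilon> \<le> \<delta>" using assms(1) \<open>K \<ge> 0\<close> by (auto simp: \<epsilon>_def)
  have "\<epsilon> * (8 * (K + 1)) \<le> 1"
    using \<open>K \<ge> 0\<close> by (simp add: \<epsilon>_def min_def field_simps)
  then have small: "4 * \<epsilon> * K \<le> 1/2"
    using \<open>\<epsilon> > 0\<close> by (simp add: algebra_simps)
  \<comment> \<open>Clamping the time to the short interval turns the operator into one on the
    bounded continuous functions on the whole line, a complete space that is available as a
    type.\<close>
  define c where "c s = max (-\<epsilon>) (min \<epsilon> s)" for s :: real
  have c: "c s \<in> {-\<epsilon>..\<epsilon>}" for s using \<open>\<epsilon> > 0\<close> by (auto simp: c_def)
  have c_id: "c s = s" if "s \<in> {-\<epsilon>..\<epsilon>}" for s using that by (auto simp: c_def)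
  have Nf_cont: "continuous_on {-\<epsilon>..a} (\<lambda>t. N t (f t))" if "continuous_on UNIV f" "a \<le> \<epsilon>" for f a
  proof -
    have "continuous_on {-\<epsilon>..a} (\<lambda>t. \<Sum>b\<in>Basis. (f t \<bullet> b) *\<^sub>R N t b)"
      using that \<open>\<epsilon> \<le> \<delta>\<close>
      by (intro continuous_intros continuous_on_subset[OF cont]) (auto intro: continuous_on_subset)
    then show ?thesis
      by (rule continuous_on_eq) (use that \<open>\<epsilon> \<le> \<delta>\<close> in \<open>simp add: linear_eq_sum_Basis[OF lin, symmetric]\<close>)
  qed
  \<comment> \<open>The integral from 0 to s, written as a difference of integrals that start at
    -\<epsilon>, so that negative s needs no separate treatment.\<close>
  define F where "F f s = p0 + (integral {-\<epsilon>..c s} (\<lambda>t. N t (f t)) - integral {-\<epsilon>..0} (\<lambda>t. N t (f t)))"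
    for f s
  have F_cont: "continuous_on UNIV (F f)" if "continuous_on UNIV f" for f
  proof -
    have "continuous_on {-\<epsilon>..\<epsilon>} (\<lambda>x. integral {-\<epsilon>..x} (\<lambda>t. N t (f t)))"
      by (intro indefinite_integral_continuous_1 integrable_continuous_real Nf_cont that) simp
    moreover have "continuous_on UNIV c"
      unfolding c_def by (intro continuous_intros)
    ultimately have "continuous_on UNIV (\<lambda>s. integral {-\<epsilon>..c s} (\<lambda>t. N t (f t)))"
      by (rule continuous_on_compose2) (use c in blast)
    then show ?thesis unfolding F_def by (intro continuous_intros)
  qed
  have F_bcont: "F f \<in> bcontfun" if "continuous_on UNIV f" for f
  proof -
    have "F f s = F f (c s)" for s using c_id[OF c] by (simp add: F_def)
    then have "range (F f) \<subseteq> F f ` {-\<epsilon>..\<epsilon>}"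
      using imageI[OF c, of "F f"] by (intro image_subsetI) simp
    moreover have "bounded (F f ` {-\<epsilon>..\<epsilon>})"
      using F_cont[OF that] by (intro compact_imp_bounded compact_continuous_image) (auto intro:
        continuous_on_subset)
    ultimately show ?thesis
      using F_cont[OF that] bounded_subset by (auto simp: bcontfun_def)
  qed
  define \<Phi> where "\<Phi> f = Bcontfun (F (apply_bcontfun f))" for f
  have \<Phi>: "apply_bcontfun (\<Phi> f) = F (apply_bcontfun f)" for f
    unfolding \<Phi>_def by (rule Bcontfun_inverse) (intro F_bcont continuous_on_apply_bcontfun)
  have "dist (\<Phi> f) (\<Phi> g) \<le> 1/2 * dist f g" for f g
  proof (rule dist_bound)
    fix s
    let ?f = "apply_bcontfun f" and ?g = "apply_bcontfun g"
    have int: "norm (integral {-\<epsilon>..a} (\<lambda>t. N t (?f t)) - integral {-\<epsilon>..a} (\<lambda>t. N t (?g t))) \<le> 2 * \<epsilon> * K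
      * dist f g"
      if a: "a \<in> {-\<epsilon>..\<epsilon>}" for a
    proof -
      have "integral {-\<epsilon>..a} (\<lambda>t. N t (?f t)) - integral {-\<epsilon>..a} (\<lambda>t. N t (?g t))
          = integral {-\<epsilon>..a} (\<lambda>t. N t (?f t) - N t (?g t))"
        using a by (intro integral_diff[symmetric] integrable_continuous_real Nf_cont
          continuous_on_apply_bcontfun) auto
      moreover have "norm (integral {-\<epsilon>..a} (\<lambda>t. N t (?f t) - N t (?g t))) \<le> (K * dist f g) * (a - - \<epsilon>)"
      proof (rule integral_bound)
        show "continuous_on {-\<epsilon>..a} (\<lambda>t. N t (?f t) - N t (?g t))"
          using a by (intro continuous_on_diff Nf_cont continuous_on_apply_bcontfun) auto
        fix t assume "t \<in> {-\<epsilon>..a}"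
        then have t: "t \<in> {-\<delta>..\<delta>}" using a \<open>\<epsilon> \<le> \<delta>\<close> by auto
        have "norm (N t (?f t) - N t (?g t)) \<le> K * norm (?f t - ?g t)"
          using K[OF t] linear_diff[OF lin[OF t]] by metis
        also have "\<dots> \<le> K * dist f g"
          using dist_bounded[of f t g] \<open>K \<ge> 0\<close> by (simp add: dist_norm mult_left_mono)
        finally show "norm (N t (?f t) - N t (?g t)) \<le> K * dist f g" .
      qed (use a in auto)
      moreover have "(K * dist f g) * (a - - \<epsilon>) \<le> (K * dist f g) * (2 * \<epsilon>)"
        using a \<open>K \<ge> 0\<close> by (intro mult_left_mono) auto
      ultimately show ?thesis by (simp add: mult_ac)
    qed
    have "dist (\<Phi> f s) (\<Phi> g s) =
      norm ((integral {-\<epsilon>..c s} (\<lambda>t. N t (?f t)) - integral {-\<epsilon>..c s} (\<lambda>t. N t (?g t)))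
        - (integral {-\<epsilon>..0} (\<lambda>t. N t (?f t)) - integral {-\<epsilon>..0} (\<lambda>t. N t (?g t))))"
      unfolding \<Phi> F_def dist_norm by (simp add: algebra_simps)
    also have "\<dots> \<le> 2 * \<epsilon> * K * dist f g + 2 * \<epsilon> * K * dist f g"
      by (rule order_trans[OF norm_triangle_ineq4 add_mono[OF int[OF c] int]]) (use \<open>\<epsilon> > 0\<close> in auto)
    also have "\<dots> = 4 * \<epsilon> * K * dist f g" by simp
    also have "\<dots> \<le> 1/2 * dist f g" using small by (intro mult_right_mono) auto
    finally show "dist (\<Phi> f s) (\<Phi> g s) \<le> 1/2 * dist f g" .
  qed
  then obtain f where "\<Phi> f = f"
    using banach_fix_type[of "1/2" \<Phi>] by auto
  then have fix_eq: "apply_bcontfun f s = F (apply_bcontfun f) s" for s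
    using \<Phi>[of f] by simp
  let ?p = "apply_bcontfun f"
  have "?p 0 = p0"
    using fix_eq[of 0] \<open>\<epsilon> > 0\<close> by (simp add: F_def c_id)
  moreover have "(?p has_vector_derivative N s (?p s)) (at s)" if s: "s \<in> {-\<epsilon><..<\<epsilon>}" for s
  proof -
    have "((\<lambda>u. integral {-\<epsilon>..u} (\<lambda>t. N t (?p t))) has_vector_derivative N s (?p s)) (at s within
      {-\<epsilon>..\<epsilon>})"
      using s by (intro integral_has_vector_derivative Nf_cont continuous_on_apply_bcontfun) auto
    moreover have "at s within {-\<epsilon>..\<epsilon>} = at s"
      using s by (intro at_within_interior) (simp add: interior_atLeastAtMost_real)
    ultimately have "((\<lambda>u. p0 + (integral {-\<epsilon>..u} (\<lambda>t. N t (?p t)) - integral {-\<epsilon>..0} (\<lambda>t. N t (?p t))))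
        has_vector_derivative N s (?p s)) (at s)"
      by (auto intro!: derivative_eq_intros)
    moreover have "p0 + (integral {-\<epsilon>..u} (\<lambda>t. N t (?p t)) - integral {-\<epsilon>..0} (\<lambda>t. N t (?p t))) = ?p u"
      if "u \<in> {-\<epsilon><..<\<epsilon>}" for u
      using fix_eq[of u] that by (simp add: F_def c_id)
    ultimately show ?thesis
      by (rule has_vector_derivative_transform_within_open[OF _ open_greaterThanLessThan s])
  qed
  ultimately show ?thesis using \<open>\<epsilon> > 0\<close> \<open>\<epsilon> \<le> \<delta>\<close> by blast
qed

text \<open>Bootstrapping: if p is of class k, the equation shows that its derivative is of class k,
  hence p is of class k + 1.\<close>

lemma linear_ode_smooth:
  fixes N :: "real \<Rightarrow> 'e::euclidean_space \<Rightarrow> 'e"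
  assumes I: "open I" and lin: "\<And>s. s \<in> I \<Longrightarrow> linear (N s)"
    and N: "\<And>b. b \<in> Basis \<Longrightarrow> smooth_on I (\<lambda>s. N s b)"
    and p: "\<And>s. s \<in> I \<Longrightarrow> (p has_vector_derivative N s (p s)) (at s)"
  shows "smooth_on I p"
proof -
  have "ck_on k I p" for k
  proof (induction k)
    case 0
    show ?case
      unfolding ck_on.simps by (intro continuous_at_imp_continuous_on ballI
        has_vector_derivative_continuous[OF p])
  next
    case (Suc k)
    show ?case
    proof (rule ck_on_SucI[OF I])
      fix s assume s: "s \<in> I"
      show "(p has_derivative (\<lambda>v. v *\<^sub>R (\<Sum>b\<in>Basis. (p s \<bullet> b) *\<^sub>R N s b))) (at s)"
        using p[OF s] linear_eq_sum_Basis[OF lin[OF s], of "p s"] by (simp add: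
          has_vector_derivative_def)
    next
      fix v :: real
      have "ck_on k I (\<lambda>s. (p s \<bullet> b) *\<^sub>R N s b)" if "b \<in> Basis" for b
        by (rule ck_on_bilinear[OF bounded_bilinear_scaleR I
              ck_on_bounded_linear[OF bounded_linear_inner_left I Suc] N[OF that, unfolded
                smooth_on_def, rule_format]])
      then show "ck_on k I (\<lambda>s. v *\<^sub>R (\<Sum>b\<in>Basis. (p s \<bullet> b) *\<^sub>R N s b))"
        by (intro ck_on_bounded_linear[OF bounded_linear_scaleR_right I] ck_on_sum I)
    qed
  qed
  then show ?thesis by (simp add: smooth_on_def)
qed

section \<open>Atlases\<close>

text \<open>The constructor \<open>topology\<close> says nothing until its argument is known to
  describe a topology. Injectivity of the charts is what lets images commute with
  intersections.\<close>

lemma openin_atlas_topology: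
  assumes inj: "\<forall>c\<in>M. inj_on (snd c) (fst c)"
  shows "openin (atlas_topology M) S \<longleftrightarrow> S \<subseteq> points M \<and> (\<forall>c\<in>M. open (snd c ` (S \<inter> fst c)))"
proof -
  have Int: "snd c ` (S \<inter> T \<inter> fst c) = snd c ` (S \<inter> fst c) \<inter> snd c ` (T \<inter> fst c)" if "c \<in> M" for S T c
  proof -
    have "S \<inter> T \<inter> fst c = (S \<inter> fst c) \<inter> (T \<inter> fst c)" by blast
    then show ?thesis
      by (simp only: inj_on_image_Int[OF inj[rule_format, OF that] inf_le2 inf_le2])
  qed
  have Union: "snd c ` (\<Union>K \<inter> fst c) = (\<Union>k\<in>K. snd c ` (k \<inter> fst c))" for c :: "'a set \<times> ('a \<Rightarrow> 'b)" and K
    by blast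
  have "istopology (\<lambda>S. S \<subseteq> points M \<and> (\<forall>c\<in>M. open (snd c ` (S \<inter> fst c))))"
    unfolding istopology_def by (auto simp: Int Union)
  then show ?thesis
    by (simp add: atlas_topology_def topology_inverse')
qed

lemma topspace_atlas_topology:
  assumes inj: "\<forall>c\<in>M. inj_on (snd c) (fst c)"
    and op: "\<forall>c\<in>M. \<forall>d\<in>M. open (snd c ` (fst c \<inter> fst d))"
  shows "topspace (atlas_topology M) = points M"
proof -
  have "snd c ` (points M \<inter> fst c) = (\<Union>d\<in>M. snd c ` (fst c \<inter> fst d))" if "c \<in> M" for c
    by (auto simp: points_def)
  then have "openin (atlas_topology M) (points M)"
    unfolding openin_atlas_topology[OF inj] using op by (simp add: open_UN)
  moreover have "S \<subseteq> points M" if "openin (atlas_topology M) S" for S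
    using that openin_atlas_topology[OF inj] by blast
  ultimately show ?thesis
    by (metis openin_subset openin_topspace subset_antisym)
qed

text \<open>Continuity, a separate clause of \<open>smooth_map_on\<close>, follows from the local
  representatives: in a chart of the source, the preimage of an open set is the union, over the
  target charts, of preimages under these representatives.\<close>

lemma smooth_map_onI:
  assumes injM: "\<forall>c\<in>M. inj_on (snd c) (fst c)" and injN: "\<forall>c\<in>N. inj_on (snd c) (fst c)"
    and topN: "topspace (atlas_topology N) = points N"
    and S: "openin (atlas_topology M) S" and f: "f ` S \<subseteq> points N"
    and op: "\<And>c d. c \<in> M \<Longrightarrow> d \<in> N \<Longrightarrow> open (snd c ` (S \<inter> fst c \<inter> f -` fst d))"
    and sm: "\<And>c d. c \<in> M \<Longrightarrow> d \<in> N \<Longrightarrow>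
      smooth_on (snd c ` (S \<inter> fst c \<inter> f -` fst d)) (snd d \<circ> f \<circ> chart_inv c)"
  shows "smooth_map_on S M N f"
proof -
  have S_top: "topspace (subtopology (atlas_topology M) S) = S"
    using openin_subset[OF S] by auto
  have "openin (atlas_topology M) {x \<in> S. f x \<in> U}" if U: "openin (atlas_topology N) U" for U
    unfolding openin_atlas_topology[OF injM]
  proof (intro conjI ballI)
    show "{x \<in> S. f x \<in> U} \<subseteq> points M"
      using S openin_atlas_topology[OF injM] by blast
  next
    fix c assume c: "c \<in> M"
    have left: "chart_inv c (snd c q) = q" if "q \<in> fst c" for q
      using injM c that by (simp add: chart_inv_def)
    let ?D = "\<lambda>d. snd c ` (S \<inter> fst c \<inter> f -` fst d)" and ?h = "\<lambda>d. snd d \<circ> f \<circ> chart_inv c"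
    have "snd c ` ({x \<in> S. f x \<in> U} \<inter> fst c) = (\<Union>d\<in>N. ?D d \<inter> ?h d -` (snd d ` (U \<inter> fst d)))"
    proof (intro equalityI subsetI)
      fix x assume "x \<in> snd c ` ({x \<in> S. f x \<in> U} \<inter> fst c)"
      then obtain q where q: "q \<in> S" "f q \<in> U" "q \<in> fst c" "x = snd c q" by blast
      then obtain d where d: "d \<in> N" "f q \<in> fst d"
        using f by (auto simp: points_def)
      have "x \<in> ?D d \<inter> ?h d -` (snd d ` (U \<inter> fst d))" using q d left by auto
      then show "x \<in> (\<Union>d\<in>N. ?D d \<inter> ?h d -` (snd d ` (U \<inter> fst d)))" using d by blast
    next
      fix x assume "x \<in> (\<Union>d\<in>N. ?D d \<inter> ?h d -` (snd d ` (U \<inter> fst d)))"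
      then obtain d q where d: "d \<in> N" and q: "q \<in> S" "q \<in> fst c" "f q \<in> fst d" "x = snd c q"
        and "?h d x \<in> snd d ` (U \<inter> fst d)" by blast
      then have "snd d (f q) \<in> snd d ` (U \<inter> fst d)" using left by simp
      then have "f q \<in> U" using injN d q(3) by (auto dest: inj_onD)
      then show "x \<in> snd c ` ({x \<in> S. f x \<in> U} \<inter> fst c)" using q by blast
    qed
    moreover have "open (?D d \<inter> ?h d -` (snd d ` (U \<inter> fst d)))" if d: "d \<in> N" for d
      using U d openin_atlas_topology[OF injN]
      by (intro continuous_open_preimage smooth_on_continuous sm op c) auto
    ultimately show "open (snd c ` ({x \<in> S. f x \<in> U} \<inter> fst c))" by auto
  qed
  then have "openin (subtopology (atlas_topology M) S) {x \<in> S. f x \<in> U}"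
    if "openin (atlas_topology N) U" for U
    using that openin_open_subtopology[OF S] by auto
  then have "continuous_map (subtopology (atlas_topology M) S) (atlas_topology N) f"
    unfolding continuous_map_def S_top topN using f by auto
  then show ?thesis using sm by (simp add: smooth_map_on_def)
qed

lemma openin_euclidean_atlas: "openin (atlas_topology euclidean_atlas) S \<longleftrightarrow> open S"
  by (subst openin_atlas_topology) (auto simp: euclidean_atlas_def points_def)

lemma points_euclidean_atlas [simp]: "points euclidean_atlas = UNIV"
  by (simp add: euclidean_atlas_def points_def)

lemma topspace_euclidean_atlas: "topspace (atlas_topology euclidean_atlas) = UNIV"
  by (subst topspace_atlas_topology) (auto simp: euclidean_atlas_def points_def)

lemma chart_inv_euclidean [simp]: "chart_inv (UNIV, id) x = x"
  by (simp add: chart_inv_def)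

lemma smooth_fun_on_iff:
  assumes inj: "\<forall>c\<in>M. inj_on (snd c) (fst c)" and S: "openin (atlas_topology M) S"
  shows "smooth_fun_on S M f \<longleftrightarrow> (\<forall>c\<in>M. smooth_on (snd c ` (S \<inter> fst c)) (f \<circ> chart_inv c))"
proof
  assume "smooth_fun_on S M f"
  then show "\<forall>c\<in>M. smooth_on (snd c ` (S \<inter> fst c)) (f \<circ> chart_inv c)"
    by (simp add: smooth_map_on_def euclidean_atlas_def)
next
  assume *: "\<forall>c\<in>M. smooth_on (snd c ` (S \<inter> fst c)) (f \<circ> chart_inv c)"
  have "\<forall>c\<in>M. open (snd c ` (S \<inter> fst c))"
    using S openin_atlas_topology[OF inj] by blast
  then show "smooth_fun_on S M f"
    using * by (intro smooth_map_onI[OF inj _ _ S]) (simp_all add: topspace_euclidean_atlas, simp_all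
      add: euclidean_atlas_def)
qed

lemma has_vector_derivative_direction:
  assumes "(F has_derivative F') (at z)"
  shows "((\<lambda>s. F (z + s *\<^sub>R v)) has_vector_derivative F' v) (at 0)"
proof -
  have "((\<lambda>s. z + s *\<^sub>R v) has_derivative (\<lambda>s. s *\<^sub>R v)) (at 0)"
    by (auto intro!: derivative_eq_intros)
  from has_derivative_compose[OF this, of F F'] assms
  have "((\<lambda>s. F (z + s *\<^sub>R v)) has_derivative (\<lambda>s. F' (s *\<^sub>R v))) (at 0)" by simp
  then show ?thesis
    using has_derivative_linear[OF assms] by (simp add: has_vector_derivative_def linear_cmul)
qed

section \<open>Charts, coordinate changes and their Jacobians\<close>

locale atlas_geometry =
  fixes A :: "('q, 'e::euclidean_space) atlas"
  assumes smooth_atlas: "smooth_atlas A"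
begin

abbreviation "vcoord \<equiv> vector_coord A"
abbreviation "ccoord \<equiv> covector_coord A"

lemma inj_chart: "c \<in> A \<Longrightarrow> inj_on (snd c) (fst c)"
  and open_chart: "c \<in> A \<Longrightarrow> open (snd c ` fst c)"
  and open_overlap: "c \<in> A \<Longrightarrow> d \<in> A \<Longrightarrow> open (snd c ` (fst c \<inter> fst d))"
  and smooth_transition: "c \<in> A \<Longrightarrow> d \<in> A \<Longrightarrow> smooth_on (snd c ` (fst c \<inter> fst d)) (transition c d)"
  using smooth_atlas by (auto simp: smooth_atlas_def)

lemma inj_charts: "\<forall>c\<in>A. inj_on (snd c) (fst c)"
  using inj_chart by blast

lemma chart_inv_left [simp]: "c \<in> A \<Longrightarrow> q \<in> fst c \<Longrightarrow> chart_inv c (snd c q) = q"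
  using inj_chart by (simp add: chart_inv_def)

lemma chart_inv_in: "x \<in> snd c ` fst c \<Longrightarrow> chart_inv c x \<in> fst c"
  and chart_inv_right: "x \<in> snd c ` fst c \<Longrightarrow> snd c (chart_inv c x) = x"
  by (simp_all add: chart_inv_def inv_into_into f_inv_into_f)

lemma transition_eq [simp]: "c \<in> A \<Longrightarrow> q \<in> fst c \<Longrightarrow> transition c d (snd c q) = snd d q"
  by (simp add: transition_def)

lemma chart_at: "q \<in> points A \<Longrightarrow> chart_at A q \<in> A" "q \<in> points A \<Longrightarrow> q \<in> fst (chart_at A q)"
  unfolding chart_at_def points_def by (metis (mono_tags, lifting) UN_E someI_ex)+

lemma chart_points: "c \<in> A \<Longrightarrow> q \<in> fst c \<Longrightarrow> q \<in> points A"
  by (auto simp: points_def)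

lemma openin_iff: "openin (atlas_topology A) S \<longleftrightarrow> S \<subseteq> points A \<and> (\<forall>c\<in>A. open (snd c ` (S \<inter> fst c)))"
  by (rule openin_atlas_topology[OF inj_charts])

lemma topspace_eq: "topspace (atlas_topology A) = points A"
  by (rule topspace_atlas_topology[OF inj_charts]) (simp add: open_overlap)

lemma openin_chart: "c \<in> A \<Longrightarrow> openin (atlas_topology A) (fst c)"
  using open_overlap by (auto simp: openin_iff points_def Int_commute)

lemma image_Int: "c \<in> A \<Longrightarrow> snd c ` (S \<inter> fst c \<inter> fst d) = snd c ` (S \<inter> fst c) \<inter> snd c ` (fst c \<inter> fst d)"
  using inj_on_image_Int[OF inj_chart, of c "S \<inter> fst c" "fst c \<inter> fst d"] by (simp add: Int_assoc)

definition jac :: "('q, 'e) chart \<Rightarrow> ('q, 'e) chart \<Rightarrow> 'q \<Rightarrow> 'e \<Rightarrow> 'e"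
  where "jac c d q = frechet_derivative (transition c d) (at (snd c q))"

lemma jac_has_derivative:
  assumes "c \<in> A" "d \<in> A" "q \<in> fst c" "q \<in> fst d"
  shows "(transition c d has_derivative jac c d q) (at (snd c q))"
  unfolding jac_def using assms
  by (intro smooth_on_has_derivative[OF open_overlap smooth_transition]) auto

lemma linear_jac: "c \<in> A \<Longrightarrow> d \<in> A \<Longrightarrow> q \<in> fst c \<Longrightarrow> q \<in> fst d \<Longrightarrow> linear (jac c d q)"
  using jac_has_derivative has_derivative_linear by blast

text \<open>Chain rule on a triple overlap, that is, the cocycle identity. The transformation laws
  of vector and covector components derive from it.\<close>

lemma jac_comp:
  assumes "c \<in> A" "d \<in> A" "e \<in> A" "q \<in> fst c" "q \<in> fst d" "q \<in> fst e"
  shows "jac d e q (jac c d q v) = jac c e q v"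
proof -
  have "(transition d e has_derivative jac d e q) (at (transition c d (snd c q)))"
    using jac_has_derivative[of d e q] assms by simp
  from has_derivative_compose[OF jac_has_derivative[of c d q] this] assms
  have "((\<lambda>x. transition d e (transition c d x)) has_derivative (\<lambda>v. jac d e q (jac c d q v))) (at (snd
    c q))"
    by simp
  then have "(transition c e has_derivative (\<lambda>v. jac d e q (jac c d q v))) (at (snd c q))"
    by (rule has_derivative_transform_within_open[OF _ open_overlap[OF assms(1,2)]]) (use assms in auto)
  then show ?thesis
    using has_derivative_unique[OF jac_has_derivative[of c e q]] assms by metis
qed

lemma jac_id:
  assumes "c \<in> A" "q \<in> fst c"
  shows "jac c c q v = v"
proof -
  have "(transition c c has_derivative (\<lambda>v. v)) (at (snd c q))"
    by (rule has_derivative_transform_within_open[OF has_derivative_ident open_chart[OF assms(1)]])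
      (use assms in auto)
  then show ?thesis
    using has_derivative_unique[OF jac_has_derivative[of c c q]] assms by metis
qed

lemma smooth_jac:
  assumes "c \<in> A" "d \<in> A"
  shows "smooth_on (snd c ` (fst c \<inter> fst d)) (\<lambda>x. jac c d (chart_inv c x) v)"
proof -
  have "smooth_on (snd c ` (fst c \<inter> fst d)) (\<lambda>x. frechet_derivative (transition c d) (at x) v)"
    by (rule smooth_on_frechet_derivative[OF smooth_transition[OF assms]])
  then show ?thesis
    by (rule smooth_on_cong[THEN iffD1, rotated 2]) (use assms in \<open>auto simp: jac_def open_overlap\<close>)
qed

text \<open>The backward Jacobian as a function of the coordinates of c. Composing with the
  transition map avoids the inversion of matrices.\<close>

lemma smooth_jac':
  assumes "c \<in> A" "d \<in> A"
  shows "smooth_on (snd c ` (fst c \<inter> fst d)) (\<lambda>x. jac d c (chart_inv c x) v)"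
proof -
  have "smooth_on (snd c ` (fst c \<inter> fst d)) (\<lambda>x. jac d c (chart_inv d (transition c d x)) v)"
    by (rule smooth_on_compose[OF open_overlap[OF assms] open_overlap[OF assms(2,1)]
          smooth_jac[OF assms(2,1)] smooth_transition[OF assms]]) (use assms in auto)
  then show ?thesis
    by (rule smooth_on_cong[THEN iffD1, rotated 2]) (use assms in \<open>auto simp: open_overlap\<close>)
qed

subsection \<open>Coordinates of vectors and covectors\<close>

text \<open>Representative at q of the tangent vector with components v in c. For fixed v this is a
  smooth field with constant components in c, although its representative may jump with the
  preferred chart.\<close>

definition frame :: "('q, 'e) chart \<Rightarrow> 'q \<Rightarrow> 'e \<Rightarrow> 'e"
  where "frame c q = jac c (chart_at A q) q"

text \<open>The covector at q with prescribed components in c, contragredient to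
  \<open>frame\<close>. Being the adjoint of \<open>vcoord\<close>, it can be paired with vectors
  without inverting anything.\<close>

definition cocoord_inv :: "('q, 'e) chart \<Rightarrow> 'q \<Rightarrow> 'e \<Rightarrow> 'e"
  where "cocoord_inv c q = adjoint (jac (chart_at A q) c q)"

lemma vector_coord_jac: "vcoord c q = jac (chart_at A q) c q"
  by (simp add: vector_coord_def jac_def fun_eq_iff)

lemma covector_coord_frame: "ccoord c q = adjoint (frame c q)"
  by (simp add: covector_coord_def frame_def jac_def fun_eq_iff)

context
  fixes c q
  assumes c: "c \<in> A" and q: "q \<in> fst c"
begin

lemma linear_vector_coord: "linear (vcoord c q)"
  and linear_frame: "linear (frame c q)"
  unfolding vector_coord_jac frame_def using c q chart_at[OF chart_points[OF c q]] by (auto intro!: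
    linear_jac)

lemma linear_covector_coord: "linear (ccoord c q)"
  and linear_cocoord_inv: "linear (cocoord_inv c q)"
  unfolding covector_coord_frame cocoord_inv_def vector_coord_jac[symmetric]
  using linear_vector_coord linear_frame by (auto intro: adjoint_linear)

lemma vector_coord_frame [simp]: "vcoord c q (frame c q v) = v"
  and frame_vector_coord [simp]: "frame c q (vcoord c q v) = v"
  unfolding vector_coord_jac frame_def using c q chart_at[OF chart_points[OF c q]]
  by (simp_all add: jac_comp jac_id)

lemma inner_covector_coord: "ccoord c q a \<bullet> v = a \<bullet> frame c q v"
  unfolding covector_coord_frame by (rule adjoint_clauses(2)[OF linear_frame])

lemma inner_cocoord_inv: "cocoord_inv c q p \<bullet> v = p \<bullet> vcoord c q v"
  unfolding cocoord_inv_def vector_coord_jac[symmetric]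
  by (rule adjoint_clauses(2)[OF linear_vector_coord])

lemma covector_coord_inv [simp]: "ccoord c q (cocoord_inv c q p) = p"
  by (rule vector_eq_rdot[THEN iffD1]) (simp add: inner_covector_coord inner_cocoord_inv)

lemma cocoord_inv_covector_coord [simp]: "cocoord_inv c q (ccoord c q a) = a"
  by (rule vector_eq_rdot[THEN iffD1]) (simp add: inner_covector_coord inner_cocoord_inv)

lemma vector_coord_change: "d \<in> A \<Longrightarrow> q \<in> fst d \<Longrightarrow> vcoord d q v = jac c d q (vcoord c q v)"
  unfolding vector_coord_jac using c q chart_at[OF chart_points[OF c q]] by (simp add: jac_comp)

lemma frame_change: "d \<in> A \<Longrightarrow> q \<in> fst d \<Longrightarrow> frame d q v = frame c q (jac d c q v)"
  unfolding frame_def using c q chart_at[OF chart_points[OF c q]] by (simp add: jac_comp)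

text \<open>Invariance of the pairing with tangent vectors forces the adjoint of the backward
  Jacobian.\<close>

lemma covector_coord_change:
  assumes "d \<in> A" "q \<in> fst d"
  shows "ccoord d q a = adjoint (jac d c q) (ccoord c q a)"
proof (rule vector_eq_rdot[THEN iffD1], rule allI)
  fix v
  have "ccoord d q a \<bullet> v = a \<bullet> frame d q v"
    unfolding covector_coord_frame using assms chart_at[OF chart_points[OF c q]]
    by (intro adjoint_clauses(2)) (simp add: frame_def linear_jac)
  also have "\<dots> = adjoint (jac d c q) (ccoord c q a) \<bullet> v"
    unfolding frame_change[OF assms] using c q assms by (simp add: adjoint_clauses(2) linear_jac
      inner_covector_coord)
  finally show "ccoord d q a \<bullet> v = adjoint (jac d c q) (ccoord c q a) \<bullet> v" .
qed

end

subsection \<open>The charts of the tangent and cotangent bundles\<close>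

definition tchart :: "('q, 'e) chart \<Rightarrow> ('q \<times> 'e, 'e \<times> 'e) chart"
  where "tchart c = (fst c \<times> UNIV, \<lambda>(q, v). (snd c q, vcoord c q v))"

definition cochart :: "('q, 'e) chart \<Rightarrow> ('q \<times> 'e, 'e \<times> 'e) chart"
  where "cochart c = (fst c \<times> UNIV, \<lambda>(q, a). (snd c q, ccoord c q a))"

abbreviation phase :: "('q, 'e) chart \<Rightarrow> ('e \<times> 'e) set"
  where "phase c \<equiv> snd c ` fst c \<times> UNIV"

abbreviation cotb :: "('q \<times> 'e, 'e \<times> 'e) atlas" where "cotb \<equiv> cotangent_atlas A"

lemma tangent_atlas_eq: "tangent_atlas A = tchart ` A"
  and cotangent_atlas_eq: "cotb = cochart ` A"
  by (simp_all add: tangent_atlas_def cotangent_atlas_def tchart_def cochart_def)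

lemma fst_tchart [simp]: "fst (tchart c) = fst c \<times> UNIV"
  and snd_tchart [simp]: "snd (tchart c) (q, v) = (snd c q, vcoord c q v)"
  and fst_cochart [simp]: "fst (cochart c) = fst c \<times> UNIV"
  and snd_cochart [simp]: "snd (cochart c) (q, a) = (snd c q, ccoord c q a)"
  by (simp_all add: tchart_def cochart_def)

lemma inj_tchart: "c \<in> A \<Longrightarrow> inj_on (snd (tchart c)) (fst (tchart c))"
  by (auto intro!: inj_onI dest: inj_onD[OF inj_chart]) (metis frame_vector_coord inj_chart inj_onD)

lemma inj_cochart: "c \<in> A \<Longrightarrow> inj_on (snd (cochart c)) (fst (cochart c))"
  by (auto intro!: inj_onI dest: inj_onD[OF inj_chart]) (metis cocoord_inv_covector_coord inj_chart
    inj_onD)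

lemma inj_tangent_atlas: "\<forall>C\<in>tangent_atlas A. inj_on (snd C) (fst C)"
  and inj_cotangent_atlas: "\<forall>C\<in>cotb. inj_on (snd C) (fst C)"
  using inj_tchart inj_cochart by (auto simp: tangent_atlas_eq cotangent_atlas_eq)

lemma tchart_image: "c \<in> A \<Longrightarrow> snd (tchart c) ` ((S \<inter> fst c) \<times> UNIV) = snd c ` (S \<inter> fst c) \<times> UNIV"
proof (intro equalityI subsetI)
  fix z assume "c \<in> A" "z \<in> snd c ` (S \<inter> fst c) \<times> (UNIV :: 'e set)"
  then obtain q where q: "q \<in> S" "q \<in> fst c" "z = (snd c q, snd z)" by force
  then have "z = snd (tchart c) (q, frame c q (snd z))" using \<open>c \<in> A\<close> by simp
  then show "z \<in> snd (tchart c) ` ((S \<inter> fst c) \<times> UNIV)" using q by blast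
qed auto

lemma cochart_image: "c \<in> A \<Longrightarrow> snd (cochart c) ` ((S \<inter> fst c) \<times> UNIV) = snd c ` (S \<inter> fst c) \<times> UNIV"
proof (intro equalityI subsetI)
  fix z assume "c \<in> A" "z \<in> snd c ` (S \<inter> fst c) \<times> (UNIV :: 'e set)"
  then obtain q where q: "q \<in> S" "q \<in> fst c" "z = (snd c q, snd z)" by force
  then have "z = snd (cochart c) (q, cocoord_inv c q (snd z))" using \<open>c \<in> A\<close> by simp
  then show "z \<in> snd (cochart c) ` ((S \<inter> fst c) \<times> UNIV)" using q by blast
qed auto

lemma points_tangent: "points (tangent_atlas A) = points A \<times> UNIV"
  and points_cotangent: "points cotb = points A \<times> UNIV"
  by (auto simp: points_def tangent_atlas_eq cotangent_atlas_eq)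

lemma cotangent_chart_domain: "c \<in> A \<Longrightarrow> points cotb \<inter> fst (cochart c) = fst c \<times> UNIV"
  and cochart_in: "c \<in> A \<Longrightarrow> cochart c \<in> cotb"
  using chart_points[of c] unfolding points_cotangent by (auto simp: cotangent_atlas_eq)

lemma cochart_image_UNIV: "c \<in> A \<Longrightarrow> snd (cochart c) ` (fst c \<times> UNIV) = phase c"
  using cochart_image[of c UNIV] by simp

lemma open_overlap_tangent: "C \<in> tangent_atlas A \<Longrightarrow> D \<in> tangent_atlas A \<Longrightarrow> open (snd C ` (fst C \<inter> fst D))"
proof -
  assume "C \<in> tangent_atlas A" "D \<in> tangent_atlas A"
  then obtain c d where "c \<in> A" "d \<in> A" "C = tchart c" "D = tchart d" by (auto simp: tangent_atlas_eq)
  moreover from this have "snd C ` (fst C \<inter> fst D) = snd c ` (fst d \<inter> fst c) \<times> UNIV"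
    using tchart_image[of c "fst d"] by (simp add: Times_Int_Times Int_commute)
  ultimately show ?thesis by (simp add: open_Times open_overlap Int_commute)
qed

lemma open_overlap_cotangent: "C \<in> cotb \<Longrightarrow> D \<in> cotb \<Longrightarrow> open (snd C ` (fst C \<inter> fst D))"
proof -
  assume "C \<in> cotb" "D \<in> cotb"
  then obtain c d where "c \<in> A" "d \<in> A" "C = cochart c" "D = cochart d" by (auto simp:
    cotangent_atlas_eq)
  moreover from this have "snd C ` (fst C \<inter> fst D) = snd c ` (fst d \<inter> fst c) \<times> UNIV"
    using cochart_image[of c "fst d"] by (simp add: Times_Int_Times Int_commute)
  ultimately show ?thesis by (simp add: open_Times open_overlap Int_commute)
qed

lemma topspace_tangent: "topspace (atlas_topology (tangent_atlas A)) = points (tangent_atlas A)"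
  by (rule topspace_atlas_topology[OF inj_tangent_atlas]) (simp add: open_overlap_tangent)

lemma topspace_cotangent: "topspace (atlas_topology cotb) = points cotb"
  by (rule topspace_atlas_topology[OF inj_cotangent_atlas]) (simp add: open_overlap_cotangent)

lemma openin_points_cotangent: "openin (atlas_topology cotb) (points cotb)"
  by (metis openin_topspace topspace_cotangent)

lemma chart_inv_cochart:
  assumes "c \<in> A" "x \<in> snd c ` fst c"
  shows "chart_inv (cochart c) (x, p) = (chart_inv c x, cocoord_inv c (chart_inv c x) p)"
  unfolding chart_inv_def[of "cochart c"]
  by (rule inv_into_f_eq[OF inj_cochart[OF assms(1)]]) (use assms chart_inv_in[of x c]
    chart_inv_right[of x c] in auto)

lemma chart_inv_cochart_left: "c \<in> A \<Longrightarrow> q \<in> fst c \<Longrightarrow> chart_inv (cochart c) (snd c q, ccoord c q a) = (q,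
  a)"
  by (simp add: chart_inv_cochart)

text \<open>One representative per chart is enough: for two different charts the components are
  carried over by the Jacobian, which is smooth on the overlap.\<close>

lemma smooth_vector_field_on_iff:
  assumes S: "openin (atlas_topology A) S"
  shows "smooth_vector_field_on S A X \<longleftrightarrow>
    (\<forall>c\<in>A. smooth_on (snd c ` (S \<inter> fst c)) (\<lambda>x. vcoord c (chart_inv c x) (X (chart_inv c x))))"
proof
  assume "smooth_vector_field_on S A X"
  show "\<forall>c\<in>A. smooth_on (snd c ` (S \<inter> fst c)) (\<lambda>x. vcoord c (chart_inv c x) (X (chart_inv c x)))"
  proof
    fix c assume c: "c \<in> A"
    then have "tchart c \<in> tangent_atlas A" by (simp add: tangent_atlas_eq)
    then have "smooth_on (snd c ` (S \<inter> fst c \<inter> (\<lambda>q. (q, X q)) -` fst (tchart c))) (snd (tchart c) \<circ>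
      (\<lambda>q. (q, X q)) \<circ> chart_inv c)"
      using \<open>smooth_vector_field_on S A X\<close>[unfolded smooth_vector_field_on_def smooth_map_on_def, THEN
        conjunct2, THEN bspec, OF c, THEN bspec] by blast
    moreover have "S \<inter> fst c \<inter> (\<lambda>q. (q, X q)) -` fst (tchart c) = S \<inter> fst c" by auto
    ultimately have "smooth_on (snd c ` (S \<inter> fst c)) (snd (tchart c) \<circ> (\<lambda>q. (q, X q)) \<circ> chart_inv c)"
      by metis
    from smooth_on_bounded_linear[OF bounded_linear_snd _ this] c S
    show "smooth_on (snd c ` (S \<inter> fst c)) (\<lambda>x. vcoord c (chart_inv c x) (X (chart_inv c x)))"
      by (simp add: openin_iff)
  qed
next
  assume *: "\<forall>c\<in>A. smooth_on (snd c ` (S \<inter> fst c)) (\<lambda>x. vcoord c (chart_inv c x) (X (chart_inv c x)))"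
  show "smooth_vector_field_on S A X"
    unfolding smooth_vector_field_on_def
  proof (rule smooth_map_onI[OF inj_charts inj_tangent_atlas topspace_tangent S])
    show "(\<lambda>q. (q, X q)) ` S \<subseteq> points (tangent_atlas A)"
      using S by (auto simp: points_tangent openin_iff)
    fix c D assume c: "c \<in> A" and "D \<in> tangent_atlas A"
    then obtain d where d: "d \<in> A" "D = tchart d" by (auto simp: tangent_atlas_eq)
    have S': "S \<inter> fst c \<inter> (\<lambda>q. (q, X q)) -` fst D = S \<inter> fst c \<inter> fst d" using d by auto
    have op: "open (snd c ` (S \<inter> fst c))" using S c by (simp add: openin_iff)
    then have op2: "open (snd c ` (S \<inter> fst c \<inter> fst d))"
      using image_Int[OF c, of S d] open_overlap[OF c d(1)] by auto
    then show "open (snd c ` (S \<inter> fst c \<inter> (\<lambda>q. (q, X q)) -` fst D))" unfolding S' .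
    have sub1: "snd c ` (S \<inter> fst c \<inter> fst d) \<subseteq> snd c ` (fst c \<inter> fst d)"
      and sub2: "snd c ` (S \<inter> fst c \<inter> fst d) \<subseteq> snd c ` (S \<inter> fst c)" by auto
    have "smooth_on (snd c ` (S \<inter> fst c \<inter> fst d)) (\<lambda>x. jac c d (chart_inv c x) (vcoord c (chart_inv c
      x) (X (chart_inv c x))))"
    proof (rule smooth_on_linear_apply[where L = "\<lambda>x. jac c d (chart_inv c x)" and v = "\<lambda>x. vcoord c
      (chart_inv c x) (X (chart_inv c x))", OF op2])
      show "linear (jac c d (chart_inv c x))" if "x \<in> snd c ` (S \<inter> fst c \<inter> fst d)" for x
        using that c d by (auto intro: linear_jac)
      show "smooth_on (snd c ` (S \<inter> fst c \<inter> fst d)) (\<lambda>x. vcoord c (chart_inv c x) (X (chart_inv c x)))"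
        using smooth_on_subset[OF _ sub2] * c by blast
      show "smooth_on (snd c ` (S \<inter> fst c \<inter> fst d)) (\<lambda>x. jac c d (chart_inv c x) b)" for b
        by (rule smooth_on_subset[OF smooth_jac[OF c d(1)] sub1])
    qed
    then have "smooth_on (snd c ` (S \<inter> fst c \<inter> fst d)) (\<lambda>x. (transition c d x, jac c d (chart_inv c x)
      (vcoord c (chart_inv c x) (X (chart_inv c x)))))"
      by (rule smooth_on_Pair[OF op2 smooth_on_subset[OF smooth_transition[OF c d(1)] sub1]])
    moreover have "(transition c d x, jac c d (chart_inv c x) (vcoord c (chart_inv c x) (X (chart_inv c
      x))))
        = (snd D \<circ> (\<lambda>q. (q, X q)) \<circ> chart_inv c) x" if "x \<in> snd c ` (S \<inter> fst c \<inter> fst d)" for x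
      using that c d by (auto simp: vector_coord_change[of c _ d])
    ultimately show "smooth_on (snd c ` (S \<inter> fst c \<inter> (\<lambda>q. (q, X q)) -` fst D)) (snd D \<circ> (\<lambda>q. (q, X q))
      \<circ> chart_inv c)"
      unfolding S' by (subst smooth_on_cong[OF op2, symmetric]) auto
  qed
qed

lemma smooth_covector_field_onD:
  assumes S: "openin (atlas_topology A) S" and w: "smooth_covector_field_on S A w" and c: "c \<in> A"
  shows "smooth_on (snd c ` (S \<inter> fst c)) (\<lambda>x. ccoord c (chart_inv c x) (w (chart_inv c x)))"
proof -
  have "smooth_on (snd c ` (S \<inter> fst c \<inter> (\<lambda>q. (q, w q)) -` fst (cochart c))) (snd (cochart c) \<circ> (\<lambda>q. (q,
    w q)) \<circ> chart_inv c)"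
    using w[unfolded smooth_covector_field_on_def smooth_map_on_def, THEN conjunct2, rule_format, OF c
      cochart_in[OF c]] .
  moreover have "S \<inter> fst c \<inter> (\<lambda>q. (q, w q)) -` fst (cochart c) = S \<inter> fst c" by auto
  ultimately have "smooth_on (snd c ` (S \<inter> fst c)) (snd (cochart c) \<circ> (\<lambda>q. (q, w q)) \<circ> chart_inv c)"
    by metis
  from smooth_on_bounded_linear[OF bounded_linear_snd _ this] c S show ?thesis
    by (simp add: openin_iff)
qed

text \<open>Smoothness in one suitable target chart spreads to all others through the change of
  cotangent coordinates. Curves inside one chart and fiber preserving maps both admit such a
  chart.\<close>

lemma smooth_map_cotangentI:
  fixes M :: "('m, 'f::real_normed_vector) atlas"
  assumes injM: "\<forall>C\<in>M. inj_on (snd C) (fst C)" and S: "openin (atlas_topology M) S"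
    and chart: "\<And>C. C \<in> M \<Longrightarrow> \<exists>c\<in>A. fst ` f ` (S \<inter> fst C) \<subseteq> fst c \<and>
      smooth_on (snd C ` (S \<inter> fst C)) (\<lambda>z. snd c (fst (f (chart_inv C z)))) \<and>
      smooth_on (snd C ` (S \<inter> fst C)) (\<lambda>z. ccoord c (fst (f (chart_inv C z))) (snd (f (chart_inv C z))))"
  shows "smooth_map_on S M cotb f"
proof (rule smooth_map_onI[OF injM inj_cotangent_atlas topspace_cotangent S])
  show "f ` S \<subseteq> points cotb"
  proof (rule image_subsetI)
    fix m assume m: "m \<in> S"
    then obtain C where C: "C \<in> M" "m \<in> fst C"
      using S openin_atlas_topology[OF injM] by (auto simp: points_def)
    from chart[OF C(1)] obtain c where "c \<in> A" "fst ` f ` (S \<inter> fst C) \<subseteq> fst c" by blast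
    then have "fst (f m) \<in> points A" using m C chart_points[of c "fst (f m)"] by blast
    then show "f m \<in> points cotb" by (simp add: points_cotangent mem_Times_iff)
  qed
  fix C D assume C: "C \<in> M" and "D \<in> cotb"
  then obtain d where d: "d \<in> A" "D = cochart d" by (auto simp: cotangent_atlas_eq)
  from chart[OF C] obtain c where c: "c \<in> A" and sub: "fst ` f ` (S \<inter> fst C) \<subseteq> fst c"
    and sm1: "smooth_on (snd C ` (S \<inter> fst C)) (\<lambda>z. snd c (fst (f (chart_inv C z))))"
    and sm2: "smooth_on (snd C ` (S \<inter> fst C)) (\<lambda>z. ccoord c (fst (f (chart_inv C z))) (snd (f
      (chart_inv C z))))"
    by blast
  have left: "chart_inv C (snd C m) = m" if "m \<in> fst C" for m
    using injM C that by (simp add: chart_inv_def)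
  let ?h = "\<lambda>z. snd c (fst (f (chart_inv C z)))"
  let ?D = "snd C ` (S \<inter> fst C \<inter> f -` fst D)"
  have op: "open (snd C ` (S \<inter> fst C))" using S C openin_atlas_topology[OF injM] by blast
  \<comment> \<open>The domain of the representative is exhibited as the preimage of a chart
    overlap, from which its openness follows.\<close>
  have D: "?D = snd C ` (S \<inter> fst C) \<inter> ?h -` (snd c ` (fst c \<inter> fst d))"
  proof (intro equalityI subsetI)
    fix z assume "z \<in> ?D"
    then obtain m where m: "m \<in> S" "m \<in> fst C" "f m \<in> fst D" "z = snd C m" by blast
    then have "fst (f m) \<in> fst c" "fst (f m) \<in> fst d" using sub d by (auto simp: mem_Times_iff)
    then show "z \<in> snd C ` (S \<inter> fst C) \<inter> ?h -` (snd c ` (fst c \<inter> fst d))" using m left by auto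
  next
    fix z assume "z \<in> snd C ` (S \<inter> fst C) \<inter> ?h -` (snd c ` (fst c \<inter> fst d))"
    then obtain m where m: "m \<in> S" "m \<in> fst C" "z = snd C m" and "snd c (fst (f m)) \<in> snd c ` (fst c \<inter>
      fst d)"
      using left by auto
    moreover have "fst (f m) \<in> fst c" using m sub by blast
    ultimately have "fst (f m) \<in> fst d" using inj_chart[OF c] by (auto dest: inj_onD)
    then have "f m \<in> fst D" using d by (simp add: mem_Times_iff)
    then show "z \<in> ?D" using m by blast
  qed
  show opD: "open ?D"
    unfolding D by (intro continuous_open_preimage smooth_on_continuous sm1 op open_overlap c d)
  have subD: "?D \<subseteq> snd C ` (S \<inter> fst C)" by auto
  have hD: "?h ` ?D \<subseteq> snd c ` (fst c \<inter> fst d)" unfolding D by auto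
  have memD: "fst (f (chart_inv C z)) \<in> fst c" "fst (f (chart_inv C z)) \<in> fst d" if "z \<in> ?D" for z
  proof -
    obtain m where m: "m \<in> S" "m \<in> fst C" "f m \<in> fst D" "z = snd C m" using \<open>z \<in> ?D\<close> by blast
    then show "fst (f (chart_inv C z)) \<in> fst c" "fst (f (chart_inv C z)) \<in> fst d"
      using sub d left by (auto simp: mem_Times_iff image_subset_iff)
  qed
  \<comment> \<open>The change of cotangent coordinates: covector components are pulled back by the
    Jacobian from d to c.\<close>
  have "smooth_on ?D (\<lambda>z. (transition c d (?h z), adjoint (jac d c (chart_inv c (?h z)))
      (ccoord c (fst (f (chart_inv C z))) (snd (f (chart_inv C z))))))"
  proof (intro smooth_on_Pair smooth_on_adjoint_apply[where L = "\<lambda>z. jac d c (chart_inv c (?h z))"] opD)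
    show "smooth_on ?D (\<lambda>z. transition c d (?h z))"
      by (rule smooth_on_compose[OF opD open_overlap[OF c d(1)] smooth_transition[OF c d(1)]
        smooth_on_subset[OF sm1 subD] hD])
    show "linear (jac d c (chart_inv c (?h z)))" if "z \<in> ?D" for z
      using memD[OF that] c d by (auto intro: linear_jac)
    show "smooth_on ?D (\<lambda>z. ccoord c (fst (f (chart_inv C z))) (snd (f (chart_inv C z))))"
      by (rule smooth_on_subset[OF sm2 subD])
    show "smooth_on ?D (\<lambda>z. jac d c (chart_inv c (?h z)) b)" for b
      by (rule smooth_on_compose[OF opD open_overlap[OF c d(1)] smooth_jac'[OF c d(1)]
        smooth_on_subset[OF sm1 subD] hD])
  qed
  moreover have "(transition c d (?h z), adjoint (jac d c (chart_inv c (?h z)))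
      (ccoord c (fst (f (chart_inv C z))) (snd (f (chart_inv C z))))) = (snd D \<circ> f \<circ> chart_inv C) z"
    if "z \<in> ?D" for z
    using memD[OF that] c d by (cases "f (chart_inv C z)") (simp add: covector_coord_change[of c _ d])
  ultimately show "smooth_on ?D (snd D \<circ> f \<circ> chart_inv C)"
    by (subst smooth_on_cong[OF opD, symmetric]) auto
qed

lemma smooth_fiber_preservingI:
  assumes "\<And>c. c \<in> A \<Longrightarrow> smooth_on (phase c)
    (\<lambda>z. ccoord c (chart_inv c (fst z)) (y (chart_inv (cochart c) z)))"
  shows "smooth_fiber_preserving A y"
  unfolding smooth_fiber_preserving_def
proof (rule smooth_map_cotangentI[OF inj_cotangent_atlas openin_points_cotangent])
  fix C assume "C \<in> cotb"
  then obtain c where c: "c \<in> A" "C = cochart c" by (auto simp: cotangent_atlas_eq)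
  have im: "snd C ` (points cotb \<inter> fst C) = phase c"
    unfolding c(2) cotangent_chart_domain[OF c(1)] by (rule cochart_image_UNIV[OF c(1)])
  have op: "open (phase c)" using open_chart[OF c(1)] by (simp add: open_Times)
  have eq: "fst (chart_inv C z) = chart_inv c (fst z)" if "z \<in> phase c" for z
    using that c by (cases z) (auto simp: chart_inv_cochart)
  have "smooth_on (phase c) (\<lambda>z::'e \<times> 'e. fst z)"
    by (rule smooth_on_bounded_linear[OF bounded_linear_fst op smooth_on_id[OF op]])
  then have "smooth_on (phase c) (\<lambda>z. snd c (fst (chart_inv C z)))"
    by (rule smooth_on_cong[OF op, THEN iffD1, rotated]) (use c eq in auto)
  moreover have "smooth_on (phase c)
    (\<lambda>z. ccoord c (fst (chart_inv C z)) (y (chart_inv C z)))"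
    using assms[OF c(1)] unfolding c(2)[symmetric]
    by (rule smooth_on_cong[OF op, THEN iffD1, rotated]) (use eq in auto)
  ultimately show "\<exists>c\<in>A. fst ` (\<lambda>\<alpha>. (fst \<alpha>, y \<alpha>)) ` (points cotb \<inter> fst C) \<subseteq> fst c \<and>
      smooth_on (snd C ` (points cotb \<inter> fst C)) (\<lambda>z. snd c (fst (fst (chart_inv C z), y (chart_inv C
        z)))) \<and>
      smooth_on (snd C ` (points cotb \<inter> fst C))
        (\<lambda>z. ccoord c (fst (fst (chart_inv C z), y (chart_inv C z))) (snd (fst (chart_inv C z), y
          (chart_inv C z))))"
    unfolding im using c by (intro bexI[of _ c]) auto
qed

lemma smooth_fun_cotangent_iff:
  "smooth_fun cotb F \<longleftrightarrow> (\<forall>c\<in>A. smooth_on (phase c) (F \<circ> chart_inv (cochart c)))"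
proof -
  have "snd (cochart c) ` (points cotb \<inter> fst (cochart c)) = phase c" if "c \<in> A" for c
    unfolding cotangent_chart_domain[OF that] by (rule cochart_image_UNIV[OF that])
  then have eq: "smooth_on (snd (cochart c) ` (points cotb \<inter> fst (cochart c))) g \<longleftrightarrow> smooth_on (phase c) g"
    if "c \<in> A" for c and g :: "'e \<times> 'e \<Rightarrow> real"
    using that by simp
  have "(\<forall>C\<in>cotb. P C) \<longleftrightarrow> (\<forall>c\<in>A. P (cochart c))" for P
    by (simp add: cotangent_atlas_eq)
  then show ?thesis
    unfolding smooth_fun_on_iff[OF inj_cotangent_atlas openin_points_cotangent]
    by (simp only:) (intro ball_cong refl eq)
qed

lemma smooth_fun_on_base_iff:
  "openin (atlas_topology A) S \<Longrightarrow>
    smooth_fun_on S A f \<longleftrightarrow> (\<forall>c\<in>A. smooth_on (snd c ` (S \<inter> fst c)) (f \<circ> chart_inv c))"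
  by (rule smooth_fun_on_iff[OF inj_charts])

text \<open>\<open>dfun\<close> refers to the preferred chart at q; the chain rule through the
  transition map makes it computable in any chart.\<close>

lemma dfun_chart:
  assumes "c \<in> A" "q \<in> fst c" "(f \<circ> chart_inv c has_derivative f') (at (snd c q))"
  shows "dfun A f q v = f' (vcoord c q v)"
proof -
  let ?p = "chart_at A q"
  note p = chart_at[OF chart_points[OF assms(1,2)]]
  have "((f \<circ> chart_inv c) has_derivative f') (at (transition ?p c (snd ?p q)))"
    using assms p by simp
  from has_derivative_compose[OF jac_has_derivative[OF p(1) assms(1) p(2) assms(2)] this]
  have "((\<lambda>x. (f \<circ> chart_inv c) (transition ?p c x)) has_derivative (\<lambda>v. f' (vcoord c q v))) (at (snd
    ?p q))"
    by (simp add: vector_coord_jac)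
  then have "(f \<circ> chart_inv ?p has_derivative (\<lambda>v. f' (vcoord c q v))) (at (snd ?p q))"
    by (rule has_derivative_transform_within_open[OF _ open_overlap[OF p(1) assms(1)]]) (use assms p in
      auto)
  then show ?thesis
    unfolding dfun_def using frechet_derivative_at by metis
qed

lemma velocity_chart:
  assumes c: "c \<in> A" and I: "open I" "s \<in> I" "\<And>t. t \<in> I \<Longrightarrow> \<gamma> t \<in> fst c"
    and x: "((\<lambda>t. snd c (\<gamma> t)) has_vector_derivative x') (at s)"
  shows "velocity A \<gamma> s = frame c (\<gamma> s) x'"
proof -
  let ?p = "chart_at A (\<gamma> s)"
  have \<gamma>: "\<gamma> s \<in> fst c" using I by blast
  note p = chart_at[OF chart_points[OF c \<gamma>]]
  from has_derivative_compose[OF x[unfolded has_vector_derivative_def] jac_has_derivative[OF c p(1) \<gamma>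
    p(2)]]
  have "((\<lambda>t. transition c ?p (snd c (\<gamma> t))) has_derivative (\<lambda>t. frame c (\<gamma> s) (t *\<^sub>R x'))) (at s)"
    by (simp add: frame_def)
  then have "((\<lambda>t. transition c ?p (snd c (\<gamma> t))) has_vector_derivative frame c (\<gamma> s) x') (at s)"
    by (simp add: has_vector_derivative_def linear_cmul[OF linear_frame[OF c \<gamma>]])
  then have "((snd ?p \<circ> \<gamma>) has_vector_derivative frame c (\<gamma> s) x') (at s)"
    by (rule has_vector_derivative_transform_within_open[OF _ I(1,2)]) (use I(3) c in auto)
  then show ?thesis unfolding velocity_def by (rule vector_derivative_at)
qed

subsection \<open>Preferred charts of the cotangent bundle\<close>

text \<open>The choice that \<open>chart_at\<close> makes for the cotangent bundle is independent of
  the one it makes for the base, so no more than the existence of an inducing chart d is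
  known.\<close>

lemma chart_at_cotangent:
  assumes "\<alpha> \<in> points cotb"
  obtains d where "d \<in> A" "fst \<alpha> \<in> fst d" "chart_at cotb \<alpha> = cochart d"
proof -
  have "\<exists>C. C \<in> cotb \<and> \<alpha> \<in> fst C" using assms by (auto simp: points_def)
  then have "chart_at cotb \<alpha> \<in> cotb \<and> \<alpha> \<in> fst (chart_at cotb \<alpha>)"
    unfolding chart_at_def by (rule someI_ex)
  then show ?thesis using that by (auto simp: cotangent_atlas_eq)
qed

text \<open>Chart domains of the cotangent bundle are unions of whole fibers, so the predicate
  behind the choice does not see the covector.\<close>

lemma chart_at_cotangent_fiber: "chart_at cotb (q, a) = chart_at cotb (q, b)"
proof -
  have "(q, a) \<in> fst C \<longleftrightarrow> (q, b) \<in> fst C" if "C \<in> cotb" for C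
  proof -
    obtain c where "C = cochart c" using \<open>C \<in> cotb\<close> unfolding cotangent_atlas_eq by blast
    then show ?thesis by simp
  qed
  then have "(\<lambda>C. C \<in> cotb \<and> (q, a) \<in> fst C) = (\<lambda>C. C \<in> cotb \<and> (q, b) \<in> fst C)"
    by blast
  then show ?thesis unfolding chart_at_def by metis
qed

lemma vlift_eq:
  assumes d: "d \<in> A" "fst \<alpha> \<in> fst d" "chart_at cotb \<alpha> = cochart d"
  shows "vlift A \<alpha> w = (0, ccoord d (fst \<alpha>) w)"
proof -
  have "((\<lambda>s. (snd d (fst \<alpha>), ccoord d (fst \<alpha>) (snd \<alpha>) + s *\<^sub>R ccoord d (fst \<alpha>) w))
      has_vector_derivative (0, ccoord d (fst \<alpha>) w)) (at 0)"
    by (auto intro!: derivative_eq_intros)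
  moreover have "snd (chart_at cotb (fst \<alpha>, snd \<alpha> + s *\<^sub>R w)) = snd (cochart d)" for s
    using d(3) chart_at_cotangent_fiber[of "fst \<alpha>" _ "snd \<alpha>"] by simp
  ultimately show ?thesis
    unfolding vlift_def velocity_def
    by (intro vector_derivative_at) (simp add: o_def d(3) linear_add[OF linear_covector_coord[OF d(1,2)]]
        linear_cmul[OF linear_covector_coord[OF d(1,2)]])
qed

text \<open>Changes of cotangent charts are linear on fibers and so map vertical lines to vertical
  lines. The derivative of the image line is computed once by the chain rule and once
  explicitly.\<close>

lemma vector_coord_vlift:
  assumes c: "c \<in> A" "q \<in> fst c"
  shows "vector_coord cotb (cochart c) (q, a) (vlift A (q, a) w) = (0, ccoord c q w)"
proof -
  have "(q, a) \<in> points cotb" using chart_points[OF c] by (simp add: points_cotangent)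
  then obtain d where "d \<in> A" "fst (q, a) \<in> fst d" "chart_at cotb (q, a) = cochart d"
    by (rule chart_at_cotangent)
  then have d: "d \<in> A" "q \<in> fst d" "chart_at cotb (q, a) = cochart d" by simp_all
  let ?D = "snd d ` (fst d \<inter> fst c) \<times> (UNIV :: 'e set)" and ?z = "(snd d q, ccoord d q a)"
  let ?F = "\<lambda>z. (transition d c (fst z), adjoint (jac c d (chart_inv d (fst z))) (snd z))"
  have op: "open ?D" by (simp add: open_Times open_overlap d c)
  have F: "?F z = transition (cochart d) (cochart c) z" if "z \<in> ?D" for z
  proof -
    obtain r p where "z = (snd d r, p)" "r \<in> fst d" "r \<in> fst c" using \<open>z \<in> ?D\<close> by (cases z) auto
    then show ?thesis using d c
      by (simp add: transition_def chart_inv_cochart covector_coord_change[of d _ c])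
  qed
  have sm_fst: "smooth_on ?D fst" and sm_snd: "smooth_on ?D snd"
    using smooth_on_bounded_linear[OF bounded_linear_fst op smooth_on_id[OF op]]
      smooth_on_bounded_linear[OF bounded_linear_snd op smooth_on_id[OF op]] by auto
  have "smooth_on ?D ?F"
  proof (intro smooth_on_Pair smooth_on_adjoint_apply[where L = "\<lambda>z. jac c d (chart_inv d (fst z))"] op
    sm_snd)
    show "smooth_on ?D (\<lambda>z. transition d c (fst z))"
      by (rule smooth_on_compose[OF op open_overlap[OF d(1) c(1)] smooth_transition[OF d(1) c(1)]
        sm_fst]) auto
    show "linear (jac c d (chart_inv d (fst z)))" if "z \<in> ?D" for z
      using that c d by (auto intro: linear_jac)
    show "smooth_on ?D (\<lambda>z. jac c d (chart_inv d (fst z)) b)" for b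
      by (rule smooth_on_compose[OF op open_overlap[OF d(1) c(1)] smooth_jac'[OF d(1) c(1)] sm_fst]) auto
  qed
  then have "smooth_on ?D (transition (cochart d) (cochart c))"
    by (rule smooth_on_cong[OF op, THEN iffD1, rotated]) (rule F)
  then have "(transition (cochart d) (cochart c) has_derivative
      frechet_derivative (transition (cochart d) (cochart c)) (at ?z)) (at ?z)"
    using d c by (intro smooth_on_has_derivative[OF op]) auto
  from has_vector_derivative_direction[OF this, of "(0, ccoord d q w)"]
  have 1: "((\<lambda>s. transition (cochart d) (cochart c) (snd d q, ccoord d q a + s *\<^sub>R ccoord d q w))
    has_vector_derivative vector_coord cotb (cochart c) (q, a) (vlift A (q, a) w)) (at 0)"
    using d vlift_eq[of d "(q, a)" w] by (simp add: vector_coord_def)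
  have "transition (cochart d) (cochart c) (snd d q, ccoord d q a + s *\<^sub>R ccoord d q w)
    = (snd c q, ccoord c q a + s *\<^sub>R ccoord c q w)" for s
    using d c chart_inv_cochart_left[of d q "a + s *\<^sub>R w"]
    by (simp add: transition_def linear_add[OF linear_covector_coord] linear_cmul[OF
      linear_covector_coord])
  then have 2: "((\<lambda>s. transition (cochart d) (cochart c) (snd d q, ccoord d q a + s *\<^sub>R ccoord d q w))
    has_vector_derivative (0, ccoord c q w)) (at 0)"
    by (simp only:) (auto intro!: derivative_eq_intros)
  show ?thesis using vector_derivative_at[OF 1] vector_derivative_at[OF 2] by simp
qed

text \<open>Lets the vanishing of Y at the critical point be read as the vanishing of its fiber
  component.\<close>

lemma vlift_inj: "\<alpha> \<in> points cotb \<Longrightarrow> vlift A \<alpha> w = 0 \<longleftrightarrow> w = 0"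
proof -
  assume "\<alpha> \<in> points cotb"
  then obtain d where d: "d \<in> A" "fst \<alpha> \<in> fst d" "chart_at cotb \<alpha> = cochart d"
    by (rule chart_at_cotangent)
  have "ccoord d (fst \<alpha>) w = 0 \<longleftrightarrow> w = 0"
    using cocoord_inv_covector_coord[OF d(1,2), of w] linear_0[OF linear_covector_coord[OF d(1,2)]]
      linear_0[OF linear_cocoord_inv[OF d(1,2)]] by metis
  then show ?thesis using vlift_eq[OF d, of w] by (simp add: zero_prod_def)
qed

text \<open>The fiber component w will come from Y by pointwise choice, with no regularity. It
  inherits smoothness because its components in an induced chart are those of the vertical half of
  Y.\<close>

lemma smooth_vector_field_vlift:
  assumes Y: "smooth_vector_field_on (points cotb) cotb Y"
    and w: "\<And>\<alpha>. \<alpha> \<in> points cotb \<Longrightarrow> Y \<alpha> = vlift A \<alpha> (w \<alpha>)" and c: "c \<in> A"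
  shows "smooth_on (phase c) (\<lambda>z. ccoord c (chart_inv c (fst z)) (w (chart_inv (cochart c) z)))"
proof -
  let ?C = "cochart c" and ?D = "phase c"
  let ?TC = "(fst ?C \<times> UNIV, \<lambda>(q, v). (snd ?C q, vector_coord cotb ?C q v)) ::
    (('q \<times> 'e) \<times> ('e \<times> 'e), ('e \<times> 'e) \<times> ('e \<times> 'e)) chart"
  have op: "open ?D" by (simp add: open_Times open_chart c)
  note C = cochart_in[OF c]
  then have TC: "?TC \<in> tangent_atlas cotb" unfolding tangent_atlas_def by (rule image_eqI[OF refl])
  have "smooth_on (snd ?C ` (points cotb \<inter> fst ?C \<inter> (\<lambda>q. (q, Y q)) -` fst ?TC)) (snd ?TC \<circ> (\<lambda>q. (q, Y
    q)) \<circ> chart_inv ?C)"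
    by (rule bspec[OF bspec[OF conjunct2[OF Y[unfolded smooth_vector_field_on_def smooth_map_on_def]]
      C] TC])
  moreover have "points cotb \<inter> fst ?C \<inter> (\<lambda>q. (q, Y q)) -` fst ?TC = fst c \<times> UNIV"
    using cotangent_chart_domain[OF c] by auto
  ultimately have "smooth_on ?D (snd ?TC \<circ> (\<lambda>q. (q, Y q)) \<circ> chart_inv ?C)"
    using cochart_image_UNIV[OF c] by metis
  from smooth_on_bounded_linear[OF bounded_linear_compose[OF bounded_linear_snd bounded_linear_snd] op
    this]
  have "smooth_on ?D (\<lambda>z. snd (vector_coord cotb ?C (chart_inv ?C z) (Y (chart_inv ?C z))))" by simp
  then show ?thesis
  proof (rule smooth_on_cong[OF op, THEN iffD1, rotated])
    fix z assume "z \<in> ?D"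
    then obtain q p where z: "z = (snd c q, p)" "q \<in> fst c" by (cases z) auto
    then have "Y (chart_inv ?C z) = vlift A (q, cocoord_inv c q p) (w (chart_inv ?C z))"
      using c w[of "chart_inv ?C z"] chart_points[of c q] by (simp add: chart_inv_cochart
        points_cotangent)
    then show "snd (vector_coord cotb ?C (chart_inv ?C z) (Y (chart_inv ?C z))) =
        ccoord c (chart_inv c (fst z)) (w (chart_inv ?C z))"
      using z c by (simp add: chart_inv_cochart vector_coord_vlift)
  qed
qed

end

section \<open>Parallel transport of covectors\<close>

lemma has_vector_derivative_chain:
  assumes "(z has_vector_derivative z') (at s)" "(F has_derivative F') (at (z s))"
  shows "((\<lambda>t. F (z t)) has_vector_derivative F' z') (at s)"
  using has_derivative_compose[OF assms(1)[unfolded has_vector_derivative_def] assms(2)]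
  by (simp add: has_vector_derivative_def linear_cmul[OF has_derivative_linear[OF assms(2)]])

locale connection_geometry = atlas_geometry A for A :: "('q, 'e::euclidean_space) atlas" +
  fixes nabla :: "'q \<Rightarrow> 'e \<Rightarrow> ('q \<Rightarrow> 'e) \<Rightarrow> 'e"
  assumes conn: "torsion_free_connection A nabla"
begin

abbreviation "bderiv \<equiv> base_deriv A nabla"

context
  fixes S X Y
  assumes S: "openin (atlas_topology A) S"
    and X: "smooth_vector_field_on S A X" and Y: "smooth_vector_field_on S A Y"
begin

lemmas conn_all = conn[unfolded torsion_free_connection_def, THEN spec, THEN spec, THEN spec, THEN mp,
    OF conjI[OF S conjI[OF X Y]]]

lemma nabla_linear: "q \<in> S \<Longrightarrow> linear (\<lambda>v. nabla q v X)"
  using conn_all[THEN conjunct1] by blast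

lemma nabla_add: "q \<in> S \<Longrightarrow> nabla q v (\<lambda>r. X r + Y r) = nabla q v X + nabla q v Y"
  using conn_all[THEN conjunct2, THEN conjunct1] by blast

lemma nabla_scaleR: "smooth_fun_on S A f \<Longrightarrow> q \<in> S \<Longrightarrow>
    nabla q v (\<lambda>r. f r *\<^sub>R X r) = dfun A f q v *\<^sub>R X q + f q *\<^sub>R nabla q v X"
  using conn_all[THEN conjunct2, THEN conjunct2, THEN conjunct1] by blast

lemma nabla_cong: "(\<And>q. q \<in> S \<Longrightarrow> X q = Y q) \<Longrightarrow> q \<in> S \<Longrightarrow> nabla q v X = nabla q v Y"
  using conn_all[THEN conjunct2, THEN conjunct2, THEN conjunct2, THEN conjunct1] by blast

lemma smooth_nabla: "smooth_vector_field_on S A (\<lambda>q. nabla q (X q) Y)"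
  using conn_all[THEN conjunct2, THEN conjunct2, THEN conjunct2, THEN conjunct2, THEN conjunct1] by blast

lemma nabla_torsion: "smooth_fun_on S A f \<Longrightarrow> q \<in> S \<Longrightarrow>
    dfun A f q (nabla q (X q) Y - nabla q (Y q) X) =
    dfun A (\<lambda>r. dfun A f r (Y r)) q (X q) - dfun A (\<lambda>r. dfun A f r (X r)) q (Y q)"
  using conn_all[THEN conjunct2, THEN conjunct2, THEN conjunct2, THEN conjunct2, THEN conjunct2] by blast

end

section \<open>Local vector fields and their covariant derivatives\<close>

lemma smooth_vector_field_on_add:
  assumes S: "openin (atlas_topology A) S"
    and X: "smooth_vector_field_on S A X" and Y: "smooth_vector_field_on S A Y"
  shows "smooth_vector_field_on S A (\<lambda>q. X q + Y q)"
  unfolding smooth_vector_field_on_iff[OF S]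
proof
  fix c assume c: "c \<in> A"
  have op: "open (snd c ` (S \<inter> fst c))" using S c by (simp add: openin_iff)
  have "smooth_on (snd c ` (S \<inter> fst c)) (\<lambda>x. vcoord c (chart_inv c x) (X (chart_inv c x))
      + vcoord c (chart_inv c x) (Y (chart_inv c x)))"
    using X Y c by (intro smooth_on_add op) (simp_all add: smooth_vector_field_on_iff[OF S])
  then show "smooth_on (snd c ` (S \<inter> fst c)) (\<lambda>x. vcoord c (chart_inv c x) (X (chart_inv c x) + Y
    (chart_inv c x)))"
    by (rule smooth_on_cong[OF op, THEN iffD1, rotated]) (use c in \<open>auto simp: linear_add[OF
      linear_vector_coord]\<close>)
qed

lemma smooth_vector_field_on_scaleR:
  assumes S: "openin (atlas_topology A) S"
    and X: "smooth_vector_field_on S A X" and f: "smooth_fun_on S A f"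
  shows "smooth_vector_field_on S A (\<lambda>q. f q *\<^sub>R X q)"
  unfolding smooth_vector_field_on_iff[OF S]
proof
  fix c assume c: "c \<in> A"
  have op: "open (snd c ` (S \<inter> fst c))" using S c by (simp add: openin_iff)
  have "smooth_on (snd c ` (S \<inter> fst c)) (\<lambda>x. (f \<circ> chart_inv c) x *\<^sub>R vcoord c (chart_inv c x) (X
    (chart_inv c x)))"
  proof (rule smooth_on_scaleR[OF op])
    show "smooth_on (snd c ` (S \<inter> fst c)) (\<lambda>x. (f \<circ> chart_inv c) x)"
      using f c by (simp only: smooth_fun_on_base_iff[OF S])
  qed (use X c in \<open>simp add: smooth_vector_field_on_iff[OF S]\<close>)
  then show "smooth_on (snd c ` (S \<inter> fst c)) (\<lambda>x. vcoord c (chart_inv c x) (f (chart_inv c x) *\<^sub>R X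
    (chart_inv c x)))"
    by (rule smooth_on_cong[OF op, THEN iffD1, rotated]) (use c in \<open>auto simp: linear_cmul[OF
      linear_vector_coord]\<close>)
qed

lemma smooth_vector_field_on_zero:
  assumes S: "openin (atlas_topology A) S"
  shows "smooth_vector_field_on S A (\<lambda>q. 0)"
  unfolding smooth_vector_field_on_iff[OF S]
proof
  fix c assume c: "c \<in> A"
  have op: "open (snd c ` (S \<inter> fst c))" using S c by (simp add: openin_iff)
  show "smooth_on (snd c ` (S \<inter> fst c)) (\<lambda>x. vcoord c (chart_inv c x) 0)"
    by (rule smooth_on_cong[OF op, THEN iffD1, rotated, OF smooth_on_const[OF op, of 0]])
      (use c in \<open>auto simp: linear_0[OF linear_vector_coord]\<close>)
qed

lemma smooth_vector_field_on_sum: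
  assumes S: "openin (atlas_topology A) S" and "finite I"
    and "\<And>i. i \<in> I \<Longrightarrow> smooth_vector_field_on S A (X i)"
  shows "smooth_vector_field_on S A (\<lambda>q. \<Sum>i\<in>I. X i q)"
  using assms(2,3)
  by (induction I rule: finite_induct) (auto intro: smooth_vector_field_on_zero
    smooth_vector_field_on_add S)

lemma nabla_sum:
  assumes S: "openin (atlas_topology A) S" and "finite I"
    and "\<And>i. i \<in> I \<Longrightarrow> smooth_vector_field_on S A (X i)" and q: "q \<in> S"
  shows "nabla q v (\<lambda>q. \<Sum>i\<in>I. X i q) = (\<Sum>i\<in>I. nabla q v (X i))"
  using assms(2,3)
proof (induction I rule: finite_induct)
  case empty
  show ?case
    \<comment> \<open>Additivity at the zero field makes its covariant derivative equal to twice
      itself.\<close>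
    using nabla_add[OF S smooth_vector_field_on_zero[OF S] smooth_vector_field_on_zero[OF S] q, of v]
      by simp
next
  case (insert i I)
  have "smooth_vector_field_on S A (\<lambda>q. \<Sum>i\<in>I. X i q)"
    using insert by (intro smooth_vector_field_on_sum S) auto
  then show ?case
    using nabla_add[OF S _ _ q, of "X i" "\<lambda>q. \<Sum>i\<in>I. X i q" v] insert by simp
qed

lemma smooth_frame: "c \<in> A \<Longrightarrow> smooth_vector_field_on (fst c) A (\<lambda>q. frame c q b)"
  unfolding smooth_vector_field_on_iff[OF openin_chart]
proof
  fix d assume c: "c \<in> A" and d: "d \<in> A"
  have "smooth_on (snd d ` (fst c \<inter> fst d)) (\<lambda>x. jac c d (chart_inv d x) b)"
    using smooth_jac'[OF d c] by (simp add: Int_commute)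
  then show "smooth_on (snd d ` (fst c \<inter> fst d)) (\<lambda>x. vcoord d (chart_inv d x) (frame c (chart_inv d x)
    b))"
    by (rule smooth_on_cong[THEN iffD1, rotated 2])
      (use c d open_overlap[OF d c] in \<open>auto simp: vector_coord_change[of c _ d] Int_commute\<close>)
qed

lemma smooth_vector_field_on_mono:
  assumes "smooth_vector_field_on S A X" "openin (atlas_topology A) S" "openin (atlas_topology A) S'"
    "S' \<subseteq> S"
  shows "smooth_vector_field_on S' A X"
  unfolding smooth_vector_field_on_iff[OF assms(3)]
proof
  fix c assume c: "c \<in> A"
  have "smooth_on (snd c ` (S \<inter> fst c)) (\<lambda>x. vcoord c (chart_inv c x) (X (chart_inv c x)))"
    using assms(1) c by (simp add: smooth_vector_field_on_iff[OF assms(2)])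
  then show "smooth_on (snd c ` (S' \<inter> fst c)) (\<lambda>x. vcoord c (chart_inv c x) (X (chart_inv c x)))"
    by (rule smooth_on_subset) (use assms(4) in auto)
qed

lemma smooth_component:
  assumes S: "openin (atlas_topology A) S" and X: "smooth_vector_field_on S A X" and c: "c \<in> A"
  shows "smooth_fun_on (S \<inter> fst c) A (\<lambda>r. vcoord c r (X r) \<bullet> b)"
  unfolding smooth_fun_on_base_iff[OF openin_Int[OF S openin_chart[OF c]]]
proof
  fix d assume d: "d \<in> A"
  let ?D = "snd d ` (S \<inter> fst c \<inter> fst d)"
  have op: "open ?D"
    using openin_Int[OF S openin_chart[OF c]] d by (simp add: openin_iff)
  have sub1: "?D \<subseteq> snd d ` (fst d \<inter> fst c)" and sub2: "?D \<subseteq> snd d ` (S \<inter> fst d)" by auto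
  have "smooth_on ?D (\<lambda>x. jac d c (chart_inv d x) (vcoord d (chart_inv d x) (X (chart_inv d x))))"
  proof (rule smooth_on_linear_apply[where L = "\<lambda>x. jac d c (chart_inv d x)"
        and v = "\<lambda>x. vcoord d (chart_inv d x) (X (chart_inv d x))", OF op])
    show "linear (jac d c (chart_inv d x))" if "x \<in> ?D" for x
      using that c d by (auto intro: linear_jac)
    show "smooth_on ?D (\<lambda>x. vcoord d (chart_inv d x) (X (chart_inv d x)))"
      by (rule smooth_on_subset[OF _ sub2]) (use X d in \<open>simp add: smooth_vector_field_on_iff[OF S]\<close>)
    show "smooth_on ?D (\<lambda>x. jac d c (chart_inv d x) b)" for b
      by (rule smooth_on_subset[OF smooth_jac[OF d c] sub1])
  qed
  from smooth_on_bounded_linear[OF bounded_linear_inner_left op this]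
  have "smooth_on ?D (\<lambda>x. jac d c (chart_inv d x) (vcoord d (chart_inv d x) (X (chart_inv d x))) \<bullet> b)" .
  then show "smooth_on ?D ((\<lambda>r. vcoord c r (X r) \<bullet> b) \<circ> chart_inv d)"
    by (rule smooth_on_cong[OF op, THEN iffD1, rotated])
      (use c d in \<open>auto simp: vector_coord_change[of d _ c]\<close>)
qed

text \<open>
  \<open>christoffel c q v b\<close> collects the Christoffel symbols of the chart \<open>c\<close>, and \<open>transport c q v p\<close>
  is the right-hand side of the equation \<open>p' = transport c q v p\<close> of parallel transport of
  covectors.
\<close>

definition christoffel :: "('q, 'e) chart \<Rightarrow> 'q \<Rightarrow> 'e \<Rightarrow> 'e \<Rightarrow> 'e"
  where "christoffel c q v b = vcoord c q (nabla q (frame c q v) (\<lambda>r. frame c r b))"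

definition transport :: "('q, 'e) chart \<Rightarrow> 'q \<Rightarrow> 'e \<Rightarrow> 'e \<Rightarrow> 'e"
  where "transport c q v p = (\<Sum>b\<in>Basis. (p \<bullet> christoffel c q v b) *\<^sub>R b)"

lemma linear_christoffel:
  assumes c: "c \<in> A" "q \<in> fst c"
  shows "linear (\<lambda>v. christoffel c q v b)"
proof -
  have "linear (\<lambda>v. nabla q v (\<lambda>r. frame c r b))"
    by (rule nabla_linear[OF openin_chart smooth_frame smooth_frame]) (use c in auto)
  from linear_compose[OF linear_compose[OF linear_frame[OF c] this] linear_vector_coord[OF c]]
  show ?thesis by (simp add: christoffel_def o_def)
qed

lemma smooth_christoffel:
  assumes c: "c \<in> A"
  shows "smooth_on (snd c ` fst c) (\<lambda>x. christoffel c (chart_inv c x) v b)"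
  using smooth_nabla[OF openin_chart[OF c] smooth_frame[OF c, of v] smooth_frame[OF c, of b],
      unfolded smooth_vector_field_on_iff[OF openin_chart[OF c]], THEN bspec, OF c]
  by (simp add: christoffel_def)

lemma inner_transport: "b \<in> Basis \<Longrightarrow> transport c q v p \<bullet> b = p \<bullet> christoffel c q v b"
  by (simp add: transport_def inner_sum_left inner_Basis if_distrib cong: if_cong)

lemma linear_transport_left: "c \<in> A \<Longrightarrow> q \<in> fst c \<Longrightarrow> linear (\<lambda>v. transport c q v p)"
  using linear_christoffel by (auto simp: linear_iff transport_def inner_right_distrib scaleR_add_left
    sum.distrib scaleR_sum_right)

lemma linear_transport: "linear (transport c q v)"
  by (auto simp: linear_iff transport_def inner_left_distrib scaleR_add_left sum.distrib
    scaleR_sum_right)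

lemma smooth_transport:
  assumes c: "c \<in> A" and op: "open D" and x: "smooth_on D x" "\<And>z. z \<in> D \<Longrightarrow> x z \<in> snd c ` fst c"
    and p: "smooth_on D p"
  shows "smooth_on D (\<lambda>z. transport c (chart_inv c (x z)) v (p z))"
  unfolding transport_def
proof (intro smooth_on_sum smooth_on_scaleR smooth_on_inner smooth_on_const op p)
  fix b
  show "smooth_on D (\<lambda>z. christoffel c (chart_inv c (x z)) v b)"
    by (rule smooth_on_compose[OF op open_chart[OF c] smooth_christoffel[OF c] x(1)]) (use x(2) in auto)
qed

text \<open>The torsion condition speaks of brackets acting on functions, so it is tested on the
  coordinate functions of c. Their derivatives along coordinate fields are constant, which kills
  both second derivatives on the right-hand side.\<close>

lemma christoffel_symmetric:
  assumes c: "c \<in> A" and q: "q \<in> fst c"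
  shows "christoffel c q b b' = christoffel c q b' b"
proof -
  let ?X = "\<lambda>b r. frame c r b" and ?N = "nabla q (frame c q b) (\<lambda>r. frame c r b') - nabla q (frame c q
    b') (\<lambda>r. frame c r b)"
  have "vcoord c q ?N \<bullet> e = 0" for e
  proof -
    let ?f = "\<lambda>r. snd c r \<bullet> e"
    have "smooth_fun_on (fst c) A ?f"
      unfolding smooth_fun_on_base_iff[OF openin_chart[OF c]]
    proof
      fix d assume d: "d \<in> A"
      have op: "open (snd d ` (fst c \<inter> fst d))" using open_overlap[OF d c] by (simp add: Int_commute)
      have "smooth_on (snd d ` (fst c \<inter> fst d)) (\<lambda>x. transition d c x \<bullet> e)"
        using smooth_on_bounded_linear[OF bounded_linear_inner_left op, of "transition d c" e]
          smooth_transition[OF d c]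
        by (simp add: Int_commute)
      then show "smooth_on (snd d ` (fst c \<inter> fst d)) (?f \<circ> chart_inv d)"
        by (simp add: transition_def o_def)
    qed
    from nabla_torsion[OF openin_chart[OF c] smooth_frame[OF c, of b] smooth_frame[OF c, of b'] this q]
    have 1: "dfun A ?f q ?N = dfun A (\<lambda>r. dfun A ?f r (frame c r b')) q (frame c q b) - dfun A (\<lambda>r.
      dfun A ?f r (frame c r b)) q (frame c q b')" .
    have d: "dfun A ?f r v = vcoord c r v \<bullet> e" if "r \<in> fst c" for r v
    proof (rule dfun_chart[OF c that])
      have "((\<lambda>x. x \<bullet> e) has_derivative (\<lambda>v. v \<bullet> e)) (at (snd c r))"
        by (auto intro!: derivative_eq_intros)
      then show "(?f \<circ> chart_inv c has_derivative (\<lambda>v. v \<bullet> e)) (at (snd c r))"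
        by (rule has_derivative_transform_within_open[OF _ open_chart[OF c]]) (use that c in auto)
    qed
    have "dfun A (\<lambda>r. dfun A ?f r (frame c r w)) q v = 0" for v w
    proof (rule dfun_chart[OF c q, where f' = "\<lambda>v. 0"])
      show "((\<lambda>r. dfun A ?f r (frame c r w)) \<circ> chart_inv c has_derivative (\<lambda>v. 0)) (at (snd c q))"
        by (rule has_derivative_transform_within_open[OF has_derivative_const[of "w \<bullet> e"] open_chart[OF
          c]])
          (use q c d in auto)
    qed
    then show ?thesis using 1 d[OF q] by simp
  qed
  then have "vcoord c q ?N = 0" by (metis inner_eq_zero_iff)
  then show ?thesis
    by (simp add: christoffel_def linear_diff[OF linear_vector_coord[OF c q]])
qed

text \<open>Locality allows X to be replaced near q by its expansion in the coordinate fields; then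
  additivity and the Leibniz rule apply. All of this takes place on the common domain of X and the
  chart.\<close>

lemma nabla_chart:
  assumes S: "openin (atlas_topology A) S" and X: "smooth_vector_field_on S A X"
    and c: "c \<in> A" and q: "q \<in> S" "q \<in> fst c"
  shows "nabla q v X = (\<Sum>b\<in>Basis. dfun A (\<lambda>r. vcoord c r (X r) \<bullet> b) q v *\<^sub>R frame c q b
    + (vcoord c q (X q) \<bullet> b) *\<^sub>R nabla q v (\<lambda>r. frame c r b))"
proof -
  let ?S = "S \<inter> fst c" and ?f = "\<lambda>b r. vcoord c r (X r) \<bullet> b"
  have S': "openin (atlas_topology A) ?S" by (rule openin_Int[OF S openin_chart[OF c]])
  have fr: "smooth_vector_field_on ?S A (\<lambda>r. frame c r b)" for b
    by (rule smooth_vector_field_on_mono[OF smooth_frame[OF c] openin_chart[OF c] S']) simp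
  have X': "smooth_vector_field_on ?S A X"
    by (rule smooth_vector_field_on_mono[OF X S S']) simp
  have f: "smooth_fun_on ?S A (?f b)" for b by (rule smooth_component[OF S X c])
  have sm: "smooth_vector_field_on ?S A (\<lambda>r. ?f b r *\<^sub>R frame c r b)" for b
    by (rule smooth_vector_field_on_scaleR[OF S' fr f])
  have "X r = (\<Sum>b\<in>Basis. ?f b r *\<^sub>R frame c r b)" if "r \<in> ?S" for r
    using linear_eq_sum_Basis[OF linear_frame[OF c], of r "vcoord c r (X r)"] c that by simp
  then have "nabla q v X = nabla q v (\<lambda>r. \<Sum>b\<in>Basis. ?f b r *\<^sub>R frame c r b)"
    using q by (intro nabla_cong[OF S' X' smooth_vector_field_on_sum[OF S' finite_Basis sm]]) auto
  also have "\<dots> = (\<Sum>b\<in>Basis. nabla q v (\<lambda>r. ?f b r *\<^sub>R frame c r b))"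
    using q by (intro nabla_sum[OF S' finite_Basis sm]) auto
  also have "\<dots> = (\<Sum>b\<in>Basis. dfun A (?f b) q v *\<^sub>R frame c q b + ?f b q *\<^sub>R nabla q v (\<lambda>r. frame c r b))"
    using q by (intro sum.cong refl nabla_scaleR[OF S' fr fr f]) auto
  finally show ?thesis .
qed

section \<open>Horizontal curves in coordinates\<close>

lemma inner_coords: "c \<in> A \<Longrightarrow> q \<in> fst c \<Longrightarrow> ccoord c q a \<bullet> vcoord c q v = a \<bullet> v"
  by (simp add: inner_covector_coord)

text \<open>Testing horizontality against the coordinate fields of c turns it into an equation for
  each component of the covector. J collects the times at which the curve is in the chart and is
  open by continuity.\<close>

lemma horizontal_curve_chart:
  assumes u: "horizontal_curve A nabla I u" and I: "open I" and s: "s \<in> I"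
    and c: "c \<in> A" and q: "fst (u s) \<in> fst c"
  obtains J x' where "open J" "s \<in> J" "\<forall>t\<in>J. fst (u t) \<in> fst c"
    "((\<lambda>t. (snd c (fst (u t)), ccoord c (fst (u t)) (snd (u t)))) has_vector_derivative
      (x', transport c (fst (u s)) x' (ccoord c (fst (u s)) (snd (u s))))) (at s)"
    "velocity A (fst \<circ> u) s = frame c (fst (u s)) x'"
proof -
  let ?x = "\<lambda>t. snd c (fst (u t))" and ?p = "\<lambda>t. ccoord c (fst (u t)) (snd (u t))"
  define J where "J = {t \<in> I. fst (u t) \<in> fst c}"
  have sm: "smooth_map_on I euclidean_atlas cotb u"
    using u by (simp add: horizontal_curve_def)
  then have "continuous_map (subtopology (atlas_topology euclidean_atlas) I) (atlas_topology cotb) u"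
    by (simp add: smooth_map_on_def)
  moreover have "openin (atlas_topology cotb) (fst (cochart c))"
    unfolding openin_atlas_topology[OF inj_cotangent_atlas]
    using open_overlap_cotangent[OF _ cochart_in[OF c]] cotangent_chart_domain[OF c] by (auto simp:
      Int_commute)
  ultimately have "openin (subtopology (atlas_topology euclidean_atlas) I) {t \<in> I. u t \<in> fst (cochart
    c)}"
    using openin_continuous_map_preimage[of "subtopology (atlas_topology euclidean_atlas) I"
      "atlas_topology cotb" u "fst (cochart c)"]
    by (simp add: topspace_euclidean_atlas)
  moreover have "{t \<in> I. u t \<in> fst (cochart c)} = J" by (auto simp: J_def mem_Times_iff)
  moreover have "openin (atlas_topology euclidean_atlas) I" using I by (simp add: openin_euclidean_atlas)
  ultimately have J: "open J"
    using openin_open_subtopology openin_euclidean_atlas by metis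
  have sJ: "s \<in> J" using s q by (simp add: J_def)
  have Jc: "fst (u t) \<in> fst c" if "t \<in> J" for t using that by (simp add: J_def)
  have "smooth_on (snd (UNIV, id) ` (I \<inter> fst (UNIV, id) \<inter> u -` fst (cochart c))) (snd (cochart c) \<circ> u \<circ>
    chart_inv (UNIV, id))"
    using sm cochart_in[OF c] by (auto simp: smooth_map_on_def euclidean_atlas_def)
  moreover have "snd (UNIV, id) ` (I \<inter> fst (UNIV, id) \<inter> u -` fst (cochart c)) = J"
    by (auto simp: J_def mem_Times_iff)
  moreover have "snd (cochart c) \<circ> u \<circ> chart_inv (UNIV, id) = (\<lambda>t. (?x t, ?p t))"
    by (auto simp: fun_eq_iff cochart_def split: prod.splits)
  ultimately have z: "smooth_on J (\<lambda>t. (?x t, ?p t))" by simp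
  from smooth_on_has_derivative[OF J smooth_on_bounded_linear[OF bounded_linear_fst J z] sJ]
  have "(?x has_derivative frechet_derivative ?x (at s)) (at s)" by simp
  then obtain x' where x': "(?x has_vector_derivative x') (at s)"
    by (metis differentiable_def vector_derivative_works)
  have vel: "velocity A (fst \<circ> u) s = frame c (fst (u s)) x'"
    using velocity_chart[OF c J sJ, of "fst \<circ> u" x'] x' Jc by simp
  let ?p' = "transport c (fst (u s)) x' (?p s)"
  have "((\<lambda>t. ?p t \<bullet> b) has_vector_derivative ?p' \<bullet> b) (at s)" if b: "b \<in> Basis" for b
  proof -
    have "((\<lambda>t. snd (u t) \<bullet> frame c (fst (u t)) b) has_real_derivative
        snd (u s) \<bullet> nabla (fst (u s)) (velocity A (fst \<circ> u) s) (\<lambda>r. frame c r b)) (at s)"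
      using u s q openin_chart[OF c] smooth_frame[OF c] unfolding horizontal_curve_def by blast
    moreover have "snd (u s) \<bullet> nabla (fst (u s)) (velocity A (fst \<circ> u) s) (\<lambda>r. frame c r b) = ?p' \<bullet> b"
      unfolding inner_transport[OF b] vel christoffel_def by (simp add: inner_coords c q)
    ultimately have "((\<lambda>t. snd (u t) \<bullet> frame c (fst (u t)) b) has_vector_derivative ?p' \<bullet> b) (at s)"
      by (simp add: has_real_derivative_iff_has_vector_derivative)
    then show ?thesis
      by (rule has_vector_derivative_transform_within_open[OF _ J sJ]) (simp add: inner_covector_coord
        c Jc)
  qed
  then have "((\<lambda>t. \<Sum>b\<in>Basis. (?p t \<bullet> b) *\<^sub>R b) has_vector_derivative (\<Sum>b\<in>Basis. (?p' \<bullet> b) *\<^sub>R b)) (at s)"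
    by (intro has_vector_derivative_sum bounded_linear.has_vector_derivative[OF
      bounded_linear_scaleR_left])
  then have "(?p has_vector_derivative ?p') (at s)"
    by (simp only: euclidean_representation)
  with x' have "((\<lambda>t. (?x t, ?p t)) has_vector_derivative (x', ?p')) (at s)"
    by (rule has_vector_derivative_Pair)
  then show thesis using that[OF J sJ _ _ vel] Jc by blast
qed

text \<open>The base curve is a straight line in coordinates with velocity v; above it the transport
  equation is linear and is solved with the initial value a. The solution must then be shown to be
  horizontal against every local vector field, not only against coordinate fields.\<close>

lemma horizontal_curve_exists:
  assumes c: "c \<in> A" and q: "q \<in> fst c"
  shows "\<exists>\<epsilon>>0. \<exists>u. horizontal_curve A nabla {-\<epsilon><..<\<epsilon>} u \<and> u 0 = (q, a) \<and> velocity A (fst \<circ> u) 0 = frame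
    c q v"
proof -
  let ?x = "\<lambda>s::real. snd c q + s *\<^sub>R v"
  let ?U = "snd c ` fst c"
  let ?V = "?x -` ?U"
  have U: "open ?U" by (rule open_chart[OF c])
  have V: "open ?V" by (intro open_vimage U continuous_intros)
  have "0 \<in> ?V" using q by simp
  \<comment> \<open>A closed interval is wanted, as the bound on the coefficients of the equation
    comes from compactness.\<close>
  then obtain \<delta>0 where \<delta>0: "\<delta>0 > 0" "cball 0 \<delta>0 \<subseteq> ?V"
    using V open_contains_cball by blast
  then have \<delta>: "{-\<delta>0..\<delta>0} \<subseteq> ?V" by (auto simp: subset_iff)
  define N where "N s p = transport c (chart_inv c (?x s)) v p" for s p
  have N_lin: "linear (N s)" for s unfolding N_def using linear_transport by (simp add: linear_iff)
  have x_sm: "smooth_on ?V ?x"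
    by (intro smooth_on_add smooth_on_scaleR smooth_on_const smooth_on_id V)
  have N_sm: "smooth_on ?V (\<lambda>s. N s b)" for b
    unfolding N_def by (rule smooth_transport[OF c V x_sm _ smooth_on_const[OF V]]) auto
  obtain \<epsilon> p where \<epsilon>: "\<epsilon> > 0" "\<epsilon> \<le> \<delta>0" and p0: "p 0 = ccoord c q a"
    and p: "\<And>s. s \<in> {-\<epsilon><..<\<epsilon>} \<Longrightarrow> (p has_vector_derivative N s (p s)) (at s)"
    using linear_ode_exists[OF \<delta>0(1) N_lin continuous_on_subset[OF smooth_on_continuous[OF N_sm] \<delta>]] by
      metis
  let ?I = "{-\<epsilon><..<\<epsilon>}"
  have "?I \<subseteq> {-\<delta>0..\<delta>0}" using \<epsilon> by auto
  then have IV: "?I \<subseteq> ?V" using \<delta> by blast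
  have I: "open ?I" by simp
  have xU: "?x s \<in> ?U" if "s \<in> ?I" for s using IV that by blast
  have p_sm: "smooth_on ?I p"
    by (rule linear_ode_smooth[OF I N_lin smooth_on_subset[OF N_sm IV] p])
  define \<gamma> where "\<gamma> s = chart_inv c (?x s)" for s
  have \<gamma>: "\<gamma> s \<in> fst c" "snd c (\<gamma> s) = ?x s" if "s \<in> ?I" for s
    unfolding \<gamma>_def using chart_inv_in[OF xU[OF that]] chart_inv_right[OF xU[OF that]] by auto
  define u where "u s = (\<gamma> s, cocoord_inv c (\<gamma> s) (p s))" for s
  have u_p: "ccoord c (\<gamma> s) (snd (u s)) = p s" if "s \<in> ?I" for s
    using \<gamma>[OF that] c by (simp add: u_def)
  have x': "(?x has_vector_derivative v) (at s)" for s
    by (auto intro!: derivative_eq_intros)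
  have x'': "((\<lambda>t. snd c (\<gamma> t)) has_vector_derivative v) (at s)" if "s \<in> ?I" for s
    by (rule has_vector_derivative_transform_within_open[OF x' I that]) (simp add: \<gamma>)
  have vel: "velocity A (fst \<circ> u) s = frame c (\<gamma> s) v" if "s \<in> ?I" for s
    using velocity_chart[OF c I that \<gamma>(1) x''[OF that]] by (simp add: u_def o_def)
  have "smooth_map_on ?I euclidean_atlas cotb u"
  proof (rule smooth_map_cotangentI)
    show "\<forall>C\<in>euclidean_atlas. inj_on (snd C) (fst C)" by (simp add: euclidean_atlas_def)
    show "openin (atlas_topology euclidean_atlas) ?I" by (simp add: openin_euclidean_atlas)
    fix C :: "(real, real) chart" assume "C \<in> euclidean_atlas"
    then have C: "C = (UNIV, id)" by (simp add: euclidean_atlas_def)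
    have "smooth_on ?I (\<lambda>s. snd c (\<gamma> s))"
      by (rule smooth_on_cong[OF I, THEN iffD1, rotated, OF smooth_on_subset[OF x_sm IV]]) (simp add: \<gamma>)
    moreover have "smooth_on ?I (\<lambda>s. ccoord c (\<gamma> s) (cocoord_inv c (\<gamma> s) (p s)))"
      by (rule smooth_on_cong[OF I, THEN iffD1, rotated, OF p_sm]) (simp add: \<gamma> c)
    moreover have "fst ` u ` ?I \<subseteq> fst c" using \<gamma> by (auto simp: u_def)
    ultimately show "\<exists>c\<in>A. fst ` u ` (?I \<inter> fst C) \<subseteq> fst c \<and>
      smooth_on (snd C ` (?I \<inter> fst C)) (\<lambda>z. snd c (fst (u (chart_inv C z)))) \<and>
      smooth_on (snd C ` (?I \<inter> fst C)) (\<lambda>z. ccoord c (fst (u (chart_inv C z))) (snd (u (chart_inv C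
        z))))"
      unfolding C using c by (intro bexI[of _ c]) (simp_all add: u_def)
  qed
  moreover have "((\<lambda>t. snd (u t) \<bullet> X (fst (u t))) has_real_derivative
      snd (u s) \<bullet> nabla (fst (u s)) (velocity A (fst \<circ> u) s) X) (at s)"
    if s: "s \<in> ?I" and S: "openin (atlas_topology A) S" "fst (u s) \<in> S" and X: "smooth_vector_field_on
      S A X" for s S X
  proof -
    let ?D = "snd c ` (S \<inter> fst c)" and ?X = "\<lambda>x. vcoord c (chart_inv c x) (X (chart_inv c x))"
    have D: "open ?D" using S(1) c by (simp add: openin_iff)
    have fst_u: "fst (u t) = \<gamma> t" for t by (simp add: u_def)
    have sD: "?x s \<in> ?D" using S(2) \<gamma>[OF s] by (force simp: fst_u)
    have "smooth_on ?D ?X" using X c by (simp add: smooth_vector_field_on_iff[OF S(1)])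
    from smooth_on_has_derivative[OF D this sD]
    obtain X' where X': "(?X has_derivative X') (at (?x s))" by blast
    note dX = has_vector_derivative_chain[OF x' X']
    have eq: "p t \<bullet> ?X (?x t) = snd (u t) \<bullet> X (fst (u t))" if "t \<in> ?I" for t
      using inner_coords[OF c \<gamma>(1)[OF that], of "snd (u t)" "X (\<gamma> t)"] u_p[OF that]
      unfolding fst_u by (simp add: \<gamma>_def)
    \<comment> \<open>The product rule yields one term with the derivative of the components of X
      and one with the derivative of p. The Leibniz expansion of the covariant derivative splits in
      the same way.\<close>
    have "((\<lambda>t. snd (u t) \<bullet> X (fst (u t))) has_vector_derivative (p s \<bullet> X' v + N s (p s) \<bullet> ?X (?x s)))
      (at s)"
      by (rule has_vector_derivative_transform_within_open[OF
            bounded_bilinear.has_vector_derivative[OF bounded_bilinear_inner p[OF s] dX] I s eq])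
    moreover have "snd (u s) \<bullet> nabla (fst (u s)) (velocity A (fst \<circ> u) s) X = p s \<bullet> X' v + N s (p s) \<bullet>
      ?X (?x s)"
    proof -
      have \<gamma>S: "\<gamma> s \<in> S" using S(2) by (simp add: fst_u)
      have df: "dfun A (\<lambda>r. vcoord c r (X r) \<bullet> b) (\<gamma> s) (frame c (\<gamma> s) v) = X' v \<bullet> b" for b
      proof -
        have "((\<lambda>r. vcoord c r (X r) \<bullet> b) \<circ> chart_inv c has_derivative (\<lambda>w. X' w \<bullet> b)) (at (snd c (\<gamma>
          s)))"
          using has_derivative_inner_left[OF X', of b] \<gamma>[OF s] by (simp add: o_def)
        from dfun_chart[OF c \<gamma>(1)[OF s] this] show ?thesis using c \<gamma>[OF s] by simp
      qed
      have "vcoord c (\<gamma> s) (nabla (\<gamma> s) (frame c (\<gamma> s) v) X)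
          = (\<Sum>b\<in>Basis. (X' v \<bullet> b) *\<^sub>R b + (?X (?x s) \<bullet> b) *\<^sub>R christoffel c (\<gamma> s) v b)"
        unfolding nabla_chart[OF S(1) X c \<gamma>S \<gamma>(1)[OF s]] df
        using linear_vector_coord[OF c \<gamma>(1)[OF s]] c \<gamma>[OF s]
        by (simp add: linear_sum linear_add linear_cmul christoffel_def \<gamma>_def[symmetric])
      also have "\<dots> = X' v + (\<Sum>b\<in>Basis. (?X (?x s) \<bullet> b) *\<^sub>R christoffel c (\<gamma> s) v b)"
        by (simp add: sum.distrib euclidean_representation)
      finally have 1: "vcoord c (\<gamma> s) (nabla (\<gamma> s) (frame c (\<gamma> s) v) X)
        = X' v + (\<Sum>b\<in>Basis. (?X (?x s) \<bullet> b) *\<^sub>R christoffel c (\<gamma> s) v b)" .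
      have "snd (u s) \<bullet> nabla (\<gamma> s) (frame c (\<gamma> s) v) X = p s \<bullet> vcoord c (\<gamma> s) (nabla (\<gamma> s) (frame c (\<gamma>
        s) v) X)"
        using inner_coords[OF c \<gamma>(1)[OF s]] u_p[OF s] by metis
      also have "\<dots> = p s \<bullet> X' v + (\<Sum>b\<in>Basis. (?X (?x s) \<bullet> b) * (p s \<bullet> christoffel c (\<gamma> s) v b))"
        unfolding 1 by (simp add: inner_right_distrib inner_sum_right)
      also have "(\<Sum>b\<in>Basis. (?X (?x s) \<bullet> b) * (p s \<bullet> christoffel c (\<gamma> s) v b)) = N s (p s) \<bullet> ?X (?x s)"
        unfolding N_def transport_def \<gamma>_def[symmetric] by (simp add: inner_sum_left) (simp add:
          inner_commute mult.commute)
      finally show ?thesis unfolding fst_u vel[OF s] .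
    qed
    ultimately show ?thesis by (simp add: has_real_derivative_iff_has_vector_derivative)
  qed
  ultimately have "horizontal_curve A nabla ?I u" unfolding horizontal_curve_def by blast
  moreover have "u 0 = (q, a)"
    using p0 c q by (simp add: u_def \<gamma>_def)
  moreover have "velocity A (fst \<circ> u) 0 = frame c q v"
    using vel[of 0] \<epsilon> c q by (simp add: \<gamma>_def)
  ultimately show ?thesis using \<epsilon>(1) by blast
qed

subsection \<open>Base derivatives in a chart\<close>

text \<open>Every tangent vector is the velocity of some horizontal curve through (q, a), so two
  candidates for the definite description agree on all vectors.\<close>

lemma base_deriv_eqI:
  assumes c: "c \<in> A" "q \<in> fst c"
    and \<beta>: "\<And>\<epsilon> u. \<epsilon> > 0 \<Longrightarrow> horizontal_curve A nabla {-\<epsilon><..<\<epsilon>} u \<Longrightarrow> u 0 = (q, a) \<Longrightarrow>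
      ((\<lambda>s. F (u s)) has_real_derivative (\<beta> \<bullet> velocity A (fst \<circ> u) 0)) (at 0)"
  shows "bderiv F (q, a) = \<beta>"
  unfolding base_deriv_def
proof (rule the_equality)
  fix \<beta>' assume \<beta>': "\<forall>\<epsilon>>0. \<forall>u. horizontal_curve A nabla {-\<epsilon><..<\<epsilon>} u \<and> u 0 = (q, a) \<longrightarrow>
      ((\<lambda>s. F (u s)) has_real_derivative (\<beta>' \<bullet> velocity A (fst \<circ> u) 0)) (at 0)"
  have "\<beta>' \<bullet> v = \<beta> \<bullet> v" for v
  proof -
    obtain \<epsilon> u where "\<epsilon> > 0" "horizontal_curve A nabla {-\<epsilon><..<\<epsilon>} u" "u 0 = (q, a)"
      "velocity A (fst \<circ> u) 0 = frame c q (vcoord c q v)"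
      using horizontal_curve_exists[OF c] by metis
    then show ?thesis using \<beta> \<beta>' DERIV_unique c by (metis frame_vector_coord)
  qed
  then show "\<beta>' = \<beta>" using vector_eq_rdot by blast
qed (use \<beta> in blast)

text \<open>Only the diagonal is treated, as \<open>Upsilon\<close> enters the method with equal
  first two arguments. Uniqueness is tested with both curves equal.\<close>

lemma base_deriv2_eqI:
  assumes c: "c \<in> A" "q \<in> fst c"
    and \<beta>: "\<And>\<epsilon> u1 u2. \<epsilon> > 0 \<Longrightarrow> horizontal_curve A nabla {-\<epsilon><..<\<epsilon>} u1 \<Longrightarrow> horizontal_curve A nabla
      {-\<epsilon><..<\<epsilon>} u2 \<Longrightarrow>
       (\<And>s. s \<in> {-\<epsilon><..<\<epsilon>} \<Longrightarrow> fst (u1 s) = fst (u2 s)) \<Longrightarrow> u1 0 = (q, a) \<Longrightarrow> u2 0 = (q, a) \<Longrightarrow>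
      ((\<lambda>s. F (u1 s) (u2 s)) has_real_derivative (\<beta> \<bullet> velocity A (fst \<circ> u1) 0)) (at 0)"
  shows "base_deriv2 A nabla F (q, a) (q, a) = \<beta>"
  unfolding base_deriv2_def
proof (rule the_equality)
  fix \<beta>' assume \<beta>': "\<forall>\<epsilon>>0. \<forall>u1 u2. horizontal_curve A nabla {-\<epsilon><..<\<epsilon>} u1 \<and> horizontal_curve A nabla
    {-\<epsilon><..<\<epsilon>} u2 \<and>
       (\<forall>s\<in>{-\<epsilon><..<\<epsilon>}. fst (u1 s) = fst (u2 s)) \<and> u1 0 = (q, a) \<and> u2 0 = (q, a) \<longrightarrow>
      ((\<lambda>s. F (u1 s) (u2 s)) has_real_derivative (\<beta>' \<bullet> velocity A (fst \<circ> u1) 0)) (at 0)"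
  have "\<beta>' \<bullet> v = \<beta> \<bullet> v" for v
  proof -
    obtain \<epsilon> u where u: "\<epsilon> > 0" "horizontal_curve A nabla {-\<epsilon><..<\<epsilon>} u" "u 0 = (q, a)"
      "velocity A (fst \<circ> u) 0 = frame c q (vcoord c q v)"
      using horizontal_curve_exists[OF c] by metis
    then have "((\<lambda>s. F (u s) (u s)) has_real_derivative (\<beta>' \<bullet> v)) (at 0)"
      using \<beta>' c by (metis frame_vector_coord)
    moreover have "((\<lambda>s. F (u s) (u s)) has_real_derivative (\<beta> \<bullet> v)) (at 0)"
      using \<beta>[OF u(1,2,2) refl u(3,3)] u(4) c by simp
    ultimately show ?thesis by (rule DERIV_unique)
  qed
  then show "\<beta>' = \<beta>" using vector_eq_rdot by blast
qed (use \<beta> in blast)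

lemma smooth_fun_cotangent_has_derivative:
  assumes F: "smooth_fun cotb F" and c: "c \<in> A" "q \<in> fst c"
  shows "(F \<circ> chart_inv (cochart c) has_derivative
    frechet_derivative (F \<circ> chart_inv (cochart c)) (at (snd c q, p))) (at (snd c q, p))"
  by (rule smooth_on_has_derivative[of "phase c"])
    (use F c in \<open>auto simp: smooth_fun_cotangent_iff open_Times open_chart\<close>)

lemma covector_representation:
  assumes c: "c \<in> A" "q \<in> fst c" and "linear l"
  obtains \<beta> where "\<And>v. \<beta> \<bullet> frame c q v = l v"
proof
  fix v
  have "cocoord_inv c q (\<Sum>b\<in>Basis. l b *\<^sub>R b) \<bullet> frame c q v = (\<Sum>b\<in>Basis. l b *\<^sub>R b) \<bullet> v"
    by (simp add: inner_cocoord_inv[OF c] c)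
  also have "\<dots> = (\<Sum>b\<in>Basis. l b * (b \<bullet> v))"
    by (simp add: inner_sum_left)
  also have "\<dots> = l v"
    using linear_eq_sum_Basis[OF assms(3), of v] by (simp add: inner_commute mult.commute)
  finally show "cocoord_inv c q (\<Sum>b\<in>Basis. l b *\<^sub>R b) \<bullet> frame c q v = l v" .
qed

lemma covector_eqI:
  assumes c: "c \<in> A" "q \<in> fst c" and eq: "\<And>v. \<beta> \<bullet> frame c q v = \<beta>' \<bullet> frame c q v"
  shows "\<beta> = \<beta>'"
proof (rule vector_eq_rdot[THEN iffD1], rule allI)
  show "\<beta> \<bullet> v = \<beta>' \<bullet> v" for v using eq[of "vcoord c q v"] c by simp
qed

lemma linear_base_derivative:
  assumes "linear l" "c \<in> A" "q \<in> fst c"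
  shows "linear (\<lambda>v. l (v, transport c q v p))"
proof -
  have "linear (\<lambda>v. (v, transport c q v p))"
    using linear_transport_left[OF assms(2,3)] by (simp add: linear_iff)
  from linear_compose[OF this assms(1)] show ?thesis by (simp add: o_def)
qed

text \<open>A horizontal curve over v has the velocity \<open>(v, transport c q v p)\<close> in the
  chart, p being the components of a. The base derivative is the differential of F on this
  horizontal lift.\<close>

lemma base_deriv_chart:
  assumes F: "smooth_fun cotb F" and c: "c \<in> A" "q \<in> fst c"
  shows "bderiv F (q, a) \<bullet> frame c q v =
    frechet_derivative (F \<circ> chart_inv (cochart c)) (at (snd c q, ccoord c q a))
      (v, transport c q v (ccoord c q a))"
proof -
  let ?p = "ccoord c q a"
  let ?F = "F \<circ> chart_inv (cochart c)"
  let ?F' = "frechet_derivative ?F (at (snd c q, ?p))"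
  note F' = smooth_fun_cotangent_has_derivative[OF F c, of ?p]
  obtain \<beta> where \<beta>: "\<And>v. \<beta> \<bullet> frame c q v = ?F' (v, transport c q v ?p)"
    using covector_representation[OF c linear_base_derivative[OF has_derivative_linear[OF F'] c]] by
      metis
  have "bderiv F (q, a) = \<beta>"
  proof (rule base_deriv_eqI[OF c])
    fix \<epsilon> u assume u: "\<epsilon> > 0" "horizontal_curve A nabla {-\<epsilon><..<\<epsilon>} u" "u 0 = (q, a)"
    have 0: "0 \<in> {-\<epsilon><..<\<epsilon>}" "fst (u 0) \<in> fst c" using u c by auto
    obtain J x' where J: "open J" "0 \<in> J" "\<forall>t\<in>J. fst (u t) \<in> fst c"
      and z: "((\<lambda>t. (snd c (fst (u t)), ccoord c (fst (u t)) (snd (u t)))) has_vector_derivative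
      (x', transport c (fst (u 0)) x' (ccoord c (fst (u 0)) (snd (u 0))))) (at 0)"
      and vel: "velocity A (fst \<circ> u) 0 = frame c (fst (u 0)) x'"
      by (rule horizontal_curve_chart[OF u(2) open_greaterThanLessThan 0(1) c(1) 0(2)])
    have "(?F has_derivative ?F') (at (snd c (fst (u 0)), ccoord c (fst (u 0)) (snd (u 0))))"
      using F' u(3) by simp
    from has_vector_derivative_chain[OF z this]
    have "((\<lambda>t. ?F (snd c (fst (u t)), ccoord c (fst (u t)) (snd (u t)))) has_vector_derivative
        \<beta> \<bullet> velocity A (fst \<circ> u) 0) (at 0)"
      using u(3) vel \<beta> by simp
    then have "((\<lambda>t. F (u t)) has_vector_derivative \<beta> \<bullet> velocity A (fst \<circ> u) 0) (at 0)"
      by (rule has_vector_derivative_transform_within_open[OF _ J(1,2)]) (simp add: J(3) c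
        chart_inv_cochart_left)
    then show "((\<lambda>s. F (u s)) has_real_derivative \<beta> \<bullet> velocity A (fst \<circ> u) 0) (at 0)"
      by (simp add: has_real_derivative_iff_has_vector_derivative)
  qed
  then show ?thesis using \<beta> by simp
qed

end

section \<open>Metrics and simple functions\<close>

context connection_geometry
begin

context
  fixes \<rho>
  assumes rm: "riemannian_metric A \<rho>"
begin

lemma
  assumes "q \<in> points A"
  shows bilinear_metric: "bilinear (\<rho> q)" and metric_sym: "\<rho> q v w = \<rho> q w v"
    and metric_pos: "v \<noteq> 0 \<Longrightarrow> \<rho> q v v > 0"
  using rm[unfolded riemannian_metric_def, THEN conjunct1, THEN bspec, OF assms] by blast+

lemma linear_metric_right: "q \<in> points A \<Longrightarrow> linear (\<lambda>w. \<rho> q v w)"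
  and linear_metric_left: "q \<in> points A \<Longrightarrow> linear (\<lambda>v. \<rho> q v w)"
  using bilinear_metric by (auto simp: bilinear_def)

lemma metric_cancel:
  assumes q: "q \<in> points A" and eq: "\<And>w. \<rho> q v w = \<rho> q v' w"
  shows "v = v'"
proof -
  have "\<rho> q (v - v') (v - v') = 0"
    using linear_diff[OF linear_metric_left[OF q]] eq by simp
  then show ?thesis using metric_pos[OF q, of "v - v'"] by force
qed

lemma sharp_unique:
  assumes q: "q \<in> points A" and v: "\<And>w. \<rho> q v w = a \<bullet> w"
  shows "sharp \<rho> (q, a) = v"
  unfolding sharp_def using v metric_cancel[OF q] by (intro the_equality) auto

lemma metric_eq_flat: "q \<in> points A \<Longrightarrow> \<rho> q v w = (\<Sum>b\<in>Basis. \<rho> q v b *\<^sub>R b) \<bullet> w"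
  using linear_eq_sum_Basis[OF linear_metric_right, of q v w]
  by (simp add: inner_sum_left) (simp add: inner_commute mult.commute)

lemma sharp_surj: "q \<in> points A \<Longrightarrow> \<exists>a. sharp \<rho> (q, a) = v"
  using sharp_unique[OF _ metric_eq_flat] by blast

text \<open>Lowering the index is linear, and injective by positive definiteness, hence onto in
  finite dimension. Every covector therefore has a representing vector, and the description in
  \<open>sharp\<close> is met.\<close>

lemma metric_sharp:
  assumes q: "q \<in> points A"
  shows "\<rho> q (sharp \<rho> (q, a)) w = a \<bullet> w"
proof -
  let ?f = "\<lambda>v. \<Sum>b\<in>Basis. \<rho> q v b *\<^sub>R b"
  have lin: "linear ?f"
    using linear_metric_left[OF q] by (simp add: linear_iff scaleR_add_left sum.distrib scaleR_sum_right)
  moreover have "inj ?f"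
  proof (rule injI)
    fix v v' assume "?f v = ?f v'"
    then have "\<rho> q v w = \<rho> q v' w" for w
      unfolding metric_eq_flat[OF q, of v w] metric_eq_flat[OF q, of v' w] by (simp only:)
    then show "v = v'" by (rule metric_cancel[OF q])
  qed
  ultimately have "surj ?f" by (rule linear_injective_imp_surjective) simp
  then obtain v where v: "a = ?f v" by blast
  have "\<rho> q v w = a \<bullet> w" for w
    unfolding v by (rule metric_eq_flat[OF q])
  then show ?thesis using sharp_unique[OF q, of v a] by simp
qed

lemma linear_sharp:
  assumes q: "q \<in> points A"
  shows "linear (\<lambda>a. sharp \<rho> (q, a))"
proof (rule linearI)
  show "sharp \<rho> (q, a + b) = sharp \<rho> (q, a) + sharp \<rho> (q, b)" for a b
    by (rule sharp_unique[OF q])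
      (simp add: linear_add[OF linear_metric_left[OF q]] metric_sharp[OF q] inner_left_distrib)
  show "sharp \<rho> (q, t *\<^sub>R a) = t *\<^sub>R sharp \<rho> (q, a)" for t a
    by (rule sharp_unique[OF q]) (simp add: linear_cmul[OF linear_metric_left[OF q]] metric_sharp[OF q])
qed

lemma sharp_sym: "q \<in> points A \<Longrightarrow> a \<bullet> sharp \<rho> (q, b) = b \<bullet> sharp \<rho> (q, a)"
  using metric_sharp[of q a "sharp \<rho> (q, b)"] metric_sharp[of q b "sharp \<rho> (q, a)"]
    metric_sym[of q "sharp \<rho> (q, a)" "sharp \<rho> (q, b)"] by metis

lemma sharp_eq_0: "q \<in> points A \<Longrightarrow> sharp \<rho> (q, a) = 0 \<longleftrightarrow> a = 0"
  using metric_sharp[of q a a] linear_0[OF linear_sharp[of q]] linear_0[OF linear_metric_left[of q a]]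
    by auto

lemma sharp_pos: "q \<in> points A \<Longrightarrow> a \<noteq> 0 \<Longrightarrow> a \<bullet> sharp \<rho> (q, a) > 0"
  using metric_sharp[of q a "sharp \<rho> (q, a)"] metric_pos[of q "sharp \<rho> (q, a)"] sharp_eq_0 by auto

text \<open>Makes the \<open>inv\<close> in step 4 a genuine inverse.\<close>

lemma bij_sharp:
  assumes q: "q \<in> points A"
  shows "bij (\<lambda>a. sharp \<rho> (q, a))"
proof (rule bijI)
  show "inj (\<lambda>a. sharp \<rho> (q, a))"
    using linear_injective_0[OF linear_sharp[OF q]] sharp_eq_0[OF q] by blast
  show "surj (\<lambda>a. sharp \<rho> (q, a))" using sharp_surj[OF q] unfolding surj_def by metis
qed

lemma kinetic_add:
  assumes q: "q \<in> points A"
  shows "kinetic \<rho> (q, a + b) = kinetic \<rho> (q, a) + kinetic \<rho> (q, b) + 2 * kinetic_form \<rho> (q, a) (q, b)"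
  using linear_add[OF linear_sharp[OF q]] sharp_sym[OF q, of b a]
  by (simp add: kinetic_def kinetic_form_def inner_left_distrib inner_right_distrib algebra_simps)

lemma kinetic_scaleR: "q \<in> points A \<Longrightarrow> kinetic \<rho> (q, t *\<^sub>R a) = t\<^sup>2 * kinetic \<rho> (q, a)"
  using linear_cmul[OF linear_sharp] by (simp add: kinetic_def power2_eq_square)

lemma smooth_metric_coord:
  assumes c: "c \<in> A"
  shows "smooth_on (snd c ` fst c) (\<lambda>x. \<rho> (chart_inv c x) (frame c (chart_inv c x) v) (frame c
    (chart_inv c x) w))"
proof -
  have "smooth_fun_on (fst c) A (\<lambda>q. \<rho> q (frame c q v) (frame c q w))"
    by (rule rm[unfolded riemannian_metric_def, THEN conjunct2, THEN spec, THEN spec, THEN spec, THEN mp,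
          OF conjI[OF openin_chart[OF c] conjI[OF smooth_frame[OF c, of v] smooth_frame[OF c, of w]]]])
  from this[unfolded smooth_fun_on_base_iff[OF openin_chart[OF c]], THEN bspec, OF c]
  show ?thesis by (simp add: o_def)
qed

lemma bilinear_metric_coord:
  assumes c: "c \<in> A" "q \<in> fst c"
  shows "bilinear (\<lambda>v w. \<rho> q (frame c q v) (frame c q w))"
  using linear_compose[OF linear_frame[OF c] linear_metric_left[OF chart_points[OF c]]]
    linear_compose[OF linear_frame[OF c] linear_metric_right[OF chart_points[OF c]]]
  by (simp add: bilinear_def o_def)

lemma frame_eq_0: "c \<in> A \<Longrightarrow> q \<in> fst c \<Longrightarrow> frame c q v = 0 \<longleftrightarrow> v = 0"
  using vector_coord_frame[of c q v] linear_0[OF linear_vector_coord[of c q]] linear_0[OF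
    linear_frame[of c q]] by metis

text \<open>\<open>smooth_riesz\<close> for the components of the metric, applied to the basis
  vectors of the model space as constant maps. A numbering of the basis supplies the sequence of
  vectors that it requires.\<close>

lemma smooth_sharp:
  assumes c: "c \<in> A" and op: "open D" and x: "smooth_on D x" "\<And>z. z \<in> D \<Longrightarrow> x z \<in> snd c ` fst c"
    and p: "smooth_on D p"
  shows "smooth_on D (\<lambda>z. vcoord c (chart_inv c (x z))
    (sharp \<rho> (chart_inv c (x z), cocoord_inv c (chart_inv c (x z)) (p z))))"
proof -
  define Q where "Q z = chart_inv c (x z)" for z
  have Q: "Q z \<in> fst c" "Q z \<in> points A" if "z \<in> D" for z
    unfolding Q_def using chart_inv_in[OF x(2)[OF that]] chart_points[OF c] by auto
  define g where "g z v w = \<rho> (Q z) (frame c (Q z) v) (frame c (Q z) w)" for z v w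
  obtain f :: "nat \<Rightarrow> 'e" and n where f: "bij_betw f {0..<n} Basis"
    using ex_bij_betw_nat_finite[OF finite_Basis] by blast
  then have f_Basis: "f ` {..<n} = Basis" by (simp add: bij_betw_def atLeast0LessThan)
  have bil: "bilinear (g z)" if "z \<in> D" for z
    unfolding g_def using bilinear_metric_coord[OF c Q(1)[OF that]] by simp
  have sm: "smooth_on D (\<lambda>z. g z b b')" for b b'
    unfolding g_def Q_def by (rule smooth_on_compose[OF op open_chart[OF c] smooth_metric_coord[OF c]
      x(1)]) (use x(2) in auto)
  have "f i \<notin> span (f ` {..<i})" if "i < n" for i
  proof -
    have "f j \<noteq> f i" if "j < i" for j
      using inj_on_eq_iff[of f "{0..<n}" j i] f \<open>i < n\<close> that by (auto simp: bij_betw_def)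
    then have "f ` {..<i} \<subseteq> Basis - {f i}"
      using f that by (auto simp: bij_betw_def)
    moreover have "f i \<notin> span (Basis - {f i})"
      using independent_Basis f that by (auto simp: dependent_def bij_betw_def)
    ultimately show ?thesis using span_mono by blast
  qed
  then have "\<exists>v. smooth_on D v \<and> (\<forall>z\<in>D. v z \<in> span ((\<lambda>j. f j) ` {..<n}) \<and> (\<forall>i<n. g z (v z) (f i) = p z
    \<bullet> f i))"
    by (intro smooth_riesz[where w = "\<lambda>i z. f i"] op bil sm smooth_on_const smooth_on_inner p)
      (auto simp: g_def metric_sym[OF Q(2)] metric_pos[OF Q(2)] frame_eq_0[OF c Q(1)] linear_iff
        inner_right_distrib)
  then obtain v where v: "smooth_on D v" and v_eq: "\<And>z i. z \<in> D \<Longrightarrow> i < n \<Longrightarrow> g z (v z) (f i) = p z \<bullet> f i"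
    by blast
  have "v z = vcoord c (Q z) (sharp \<rho> (Q z, cocoord_inv c (Q z) (p z)))" if z: "z \<in> D" for z
  proof -
    have "g z (v z) b = p z \<bullet> b" if "b \<in> Basis" for b
      using that v_eq[OF z] f_Basis by (metis imageE lessThan_iff)
    then have "g z (v z) w = p z \<bullet> w" for w
      using linear_eq_sum_Basis[of "g z (v z)" w] bil[OF z] inner_sum_right[of "p z" "\<lambda>b. (w \<bullet> b) *\<^sub>R
        b" Basis]
      by (simp add: bilinear_def euclidean_representation)
    then have "\<rho> (Q z) (frame c (Q z) (v z)) w = cocoord_inv c (Q z) (p z) \<bullet> w" for w
      using c Q(1)[OF z] by (simp add: inner_cocoord_inv g_def) (metis frame_vector_coord)
    from sharp_unique[OF Q(2)[OF z] this] show ?thesis using c Q(1)[OF z] by simp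
  qed
  then show ?thesis
    unfolding Q_def[symmetric] by (rule smooth_on_cong[OF op, THEN iffD1, rotated, OF v])
qed

end

section \<open>Simple functions in charts and their fiber derivatives\<close>

lemma simple_kinetic: "riemannian_metric A \<rho> \<Longrightarrow> simple_on_cotangent A (kinetic \<rho>) \<rho> (\<lambda>_. 0)"
proof -
  assume "riemannian_metric A \<rho>"
  moreover have "openin (atlas_topology A) (points A)" by (metis openin_topspace topspace_eq)
  then have "smooth_fun A (\<lambda>_. 0)"
    by (simp add: smooth_fun_on_base_iff o_def openin_iff smooth_on_const)
  ultimately show ?thesis by (simp add: simple_on_cotangent_def)
qed

context
  fixes H \<rho> h
  assumes simple: "simple_on_cotangent A H \<rho> h"
begin

lemma simple_metric: "riemannian_metric A \<rho>"
  using simple by (simp add: simple_on_cotangent_def)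

lemma simple_eq: "q \<in> points A \<Longrightarrow> H (q, a) = kinetic \<rho> (q, a) + h q"
  using simple by (simp add: simple_on_cotangent_def points_cotangent)

lemma smooth_potential: "c \<in> A \<Longrightarrow> smooth_on (snd c ` fst c) (h \<circ> chart_inv c)"
proof -
  assume c: "c \<in> A"
  have op: "openin (atlas_topology A) (points A)" by (metis openin_topspace topspace_eq)
  have "points A \<inter> fst c = fst c" using chart_points[OF c] by auto
  then show ?thesis
    using simple c smooth_fun_on_base_iff[OF op, of h] by (auto simp: simple_on_cotangent_def)
qed

text \<open>Along a line in the fiber H is quadratic in s, and the symmetry of the metric merges the
  two mixed terms.\<close>

lemma simple_line_derivative:
  assumes q: "q \<in> points A"
  shows "((\<lambda>s. H (q, a + s *\<^sub>R \<sigma>)) has_real_derivative (\<sigma> \<bullet> sharp \<rho> (q, a))) (at 0)"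
proof -
  let ?S = "\<lambda>a. sharp \<rho> (q, a)"
  let ?f = "\<lambda>s. 1/2 * (a \<bullet> ?S a) + s * (\<sigma> \<bullet> ?S a) + 1/2 * s\<^sup>2 * (\<sigma> \<bullet> ?S \<sigma>) + h q"
  have "H (q, a + s *\<^sub>R \<sigma>) = ?f s" for s
    using linear_add[OF linear_sharp[OF simple_metric q], of a "s *\<^sub>R \<sigma>"]
      linear_cmul[OF linear_sharp[OF simple_metric q], of s \<sigma>] sharp_sym[OF simple_metric q, of a \<sigma>]
    by (simp add: simple_eq[OF q] kinetic_def inner_left_distrib inner_right_distrib power2_eq_square
      algebra_simps)
  moreover have "(?f has_real_derivative (\<sigma> \<bullet> ?S a)) (at 0)"
    by (auto intro!: derivative_eq_intros)
  ultimately show ?thesis by simp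
qed

lemma fiber_deriv_simple:
  assumes q: "q \<in> points A"
  shows "fiber_deriv H (q, a) = sharp \<rho> (q, a)"
  unfolding fiber_deriv_def
proof (rule the_equality)
  fix v assume "\<forall>\<sigma>. ((\<lambda>s. H (fst (q, a), snd (q, a) + s *\<^sub>R \<sigma>)) has_real_derivative \<sigma> \<bullet> v) (at 0)"
  then have "\<sigma> \<bullet> v = \<sigma> \<bullet> sharp \<rho> (q, a)" for \<sigma>
    using simple_line_derivative[OF q] DERIV_unique by (metis fst_conv snd_conv)
  then show "v = sharp \<rho> (q, a)" using vector_eq_ldot by blast
qed (use simple_line_derivative[OF q] in simp)

lemma simple_chart:
  assumes c: "c \<in> A" and x: "x \<in> snd c ` fst c"
  shows "(H \<circ> chart_inv (cochart c)) (x, p) = 1/2 * (p \<bullet> vcoord c (chart_inv c x)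
    (sharp \<rho> (chart_inv c x, cocoord_inv c (chart_inv c x) p))) + (h \<circ> chart_inv c) x"
  using simple_eq[OF chart_points[OF c chart_inv_in[OF x]]] c x
  by (simp add: chart_inv_cochart kinetic_def inner_cocoord_inv[OF c chart_inv_in[OF x]])

lemma smooth_simple: "smooth_fun cotb H"
  unfolding smooth_fun_cotangent_iff
proof
  fix c assume c: "c \<in> A"
  let ?D = "phase c"
  have op: "open ?D" by (simp add: open_Times open_chart c)
  have fst: "smooth_on ?D fst" and snd: "smooth_on ?D snd"
    using smooth_on_bounded_linear[OF bounded_linear_fst op smooth_on_id[OF op]]
      smooth_on_bounded_linear[OF bounded_linear_snd op smooth_on_id[OF op]] by auto
  have 1: "smooth_on ?D (\<lambda>z. vcoord c (chart_inv c (fst z))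
    (sharp \<rho> (chart_inv c (fst z), cocoord_inv c (chart_inv c (fst z)) (snd z))))"
    by (rule smooth_sharp[OF simple_metric c op fst _ snd]) auto
  have 2: "smooth_on ?D (\<lambda>z. (h \<circ> chart_inv c) (fst z))"
    by (rule smooth_on_compose[OF op open_chart[OF c] smooth_potential[OF c] fst]) auto
  show "smooth_on ?D (H \<circ> chart_inv (cochart c))"
  proof (rule smooth_on_cong[OF op, THEN iffD1, rotated,
          OF smooth_on_add[OF op smooth_on_mult[OF op smooth_on_const[OF op, of "1/2"]
            smooth_on_inner[OF op snd 1]] 2]])
    fix z assume "z \<in> ?D"
    then obtain x p where z: "z = (x, p)" "x \<in> snd c ` fst c" by blast
    then show "1/2 * (snd z \<bullet> vcoord c (chart_inv c (fst z))
        (sharp \<rho> (chart_inv c (fst z), cocoord_inv c (chart_inv c (fst z)) (snd z)))) + (h \<circ> chart_inv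
          c) (fst z)
        = (H \<circ> chart_inv (cochart c)) z"
      using simple_chart[OF c z(2), of p] by simp
  qed
qed

lemma simple_has_derivative:
  "c \<in> A \<Longrightarrow> q \<in> fst c \<Longrightarrow> (H \<circ> chart_inv (cochart c) has_derivative
    frechet_derivative (H \<circ> chart_inv (cochart c)) (at (snd c q, p))) (at (snd c q, p))"
  by (rule smooth_fun_cotangent_has_derivative[OF smooth_simple])

lemma simple_derivative_fiber:
  assumes c: "c \<in> A" "q \<in> fst c"
  shows "frechet_derivative (H \<circ> chart_inv (cochart c)) (at (snd c q, ccoord c q a)) (0, r)
    = r \<bullet> vcoord c q (sharp \<rho> (q, a))"
proof -
  let ?p = "ccoord c q a" and ?F = "H \<circ> chart_inv (cochart c)" and ?\<sigma> = "cocoord_inv c q r"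
  note q = chart_points[OF c]
  have eq: "?F ((snd c q, ?p) + s *\<^sub>R (0, r)) = H (q, a + s *\<^sub>R ?\<sigma>)" for s
    using c by (simp add: chart_inv_cochart linear_add[OF linear_cocoord_inv] linear_cmul[OF
      linear_cocoord_inv])
  have "((\<lambda>s. ?F ((snd c q, ?p) + s *\<^sub>R (0, r))) has_vector_derivative (?\<sigma> \<bullet> sharp \<rho> (q, a))) (at 0)"
    unfolding eq using simple_line_derivative[OF q]
    by (simp add: has_real_derivative_iff_has_vector_derivative)
  from vector_derivative_unique_at[OF has_vector_derivative_direction[OF simple_has_derivative[OF c]]
    this]
  show ?thesis by (simp add: inner_cocoord_inv[OF c])
qed

end

text \<open>The covector \<eta> is the differential of the potential, which sees only the base point
  and thus does not depend on a.\<close>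

lemma base_deriv_simple:
  assumes simple: "simple_on_cotangent A H \<rho> h" and q: "q \<in> points A"
  shows "\<exists>\<eta>. \<forall>a. bderiv H (q, a) = bderiv (kinetic \<rho>) (q, a) + \<eta>"
proof -
  note c = chart_at[OF q]
  let ?c = "chart_at A q" and ?K = "kinetic \<rho>"
  note K = simple_kinetic[OF simple_metric[OF simple]]
  have h': "(h \<circ> chart_inv ?c has_derivative frechet_derivative (h \<circ> chart_inv ?c) (at (snd ?c q))) (at
    (snd ?c q))"
    (is "(_ has_derivative ?h') _")
    using c by (intro smooth_on_has_derivative[OF open_chart smooth_potential[OF simple]]) auto
  obtain \<eta> where \<eta>: "\<And>v. \<eta> \<bullet> frame ?c q v = ?h' v"
    using covector_representation[OF c has_derivative_linear[OF h']] by metis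
  have "bderiv H (q, a) = bderiv ?K (q, a) + \<eta>" for a
  proof -
    let ?p = "ccoord ?c q a"
    let ?K' = "frechet_derivative (?K \<circ> chart_inv (cochart ?c)) (at (snd ?c q, ?p))"
    have "((h \<circ> chart_inv ?c) \<circ> fst has_derivative ?h' \<circ> fst) (at (snd ?c q, ?p))"
      by (rule diff_chain_at) (use h' in \<open>auto intro!: derivative_eq_intros\<close>)
    from has_derivative_add[OF simple_has_derivative[OF K c, of ?p] this]
    have 1: "((\<lambda>z. (?K \<circ> chart_inv (cochart ?c)) z + ((h \<circ> chart_inv ?c) \<circ> fst) z) has_derivative
        (\<lambda>w. ?K' w + (?h' \<circ> fst) w)) (at (snd ?c q, ?p))" .
    have "(H \<circ> chart_inv (cochart ?c) has_derivative (\<lambda>w. ?K' w + (?h' \<circ> fst) w)) (at (snd ?c q, ?p))"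
    proof (rule has_derivative_transform_within_open[OF 1])
      show "open (snd ?c ` fst ?c \<times> (UNIV :: 'e set))" by (simp add: open_Times open_chart c)
      show "(snd ?c q, ?p) \<in> snd ?c ` fst ?c \<times> UNIV" using c by simp
      fix z assume "z \<in> snd ?c ` fst ?c \<times> (UNIV :: 'e set)"
      then show "(?K \<circ> chart_inv (cochart ?c)) z + ((h \<circ> chart_inv ?c) \<circ> fst) z = (H \<circ> chart_inv
        (cochart ?c)) z"
        using simple_chart[OF simple c(1), of "fst z" "snd z"] simple_chart[OF K c(1), of "fst z" "snd
          z"] by auto
    qed
    from has_derivative_unique[OF simple_has_derivative[OF simple c] this]
    have eq: "frechet_derivative (H \<circ> chart_inv (cochart ?c)) (at (snd ?c q, ?p)) w = ?K' w + (?h' \<circ>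
      fst) w" for w
      by metis
    show ?thesis
      by (rule covector_eqI[OF c]) (simp add: inner_left_distrib \<eta> base_deriv_chart[OF smooth_simple[OF
        simple] c]
          base_deriv_chart[OF smooth_simple[OF K] c] eq)
  qed
  then show ?thesis by blast
qed

text \<open>Two derivatives of the same function are compared: the kinetic energy after scaling the
  fiber by t is t^2 times the kinetic energy.\<close>

lemma kinetic_derivative_scaleR:
  assumes rm: "riemannian_metric A \<rho>" and c: "c \<in> A" "q \<in> fst c"
  shows "frechet_derivative (kinetic \<rho> \<circ> chart_inv (cochart c)) (at (snd c q, t *\<^sub>R p)) (v, t *\<^sub>R r)
    = t\<^sup>2 * frechet_derivative (kinetic \<rho> \<circ> chart_inv (cochart c)) (at (snd c q, p)) (v, r)"
proof -
  let ?F = "kinetic \<rho> \<circ> chart_inv (cochart c)" and ?L = "\<lambda>z::'e \<times> 'e. (fst z, t *\<^sub>R snd z)"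
  let ?F' = "\<lambda>p. frechet_derivative ?F (at (snd c q, p))"
  note F' = simple_has_derivative[OF simple_kinetic[OF rm] c]
  have L: "(?L has_derivative ?L) (at (snd c q, p))"
    by (auto intro!: derivative_eq_intros)
  have "(?F has_derivative ?F' (t *\<^sub>R p)) (at (?L (snd c q, p)))" using F'[of "t *\<^sub>R p"] by simp
  from has_derivative_compose[OF L this]
  have 1: "((\<lambda>z. ?F (?L z)) has_derivative (\<lambda>w. ?F' (t *\<^sub>R p) (?L w))) (at (snd c q, p))" .
  have "((\<lambda>z. ?F (?L z)) has_derivative (\<lambda>w. t\<^sup>2 * ?F' p w)) (at (snd c q, p))"
  proof (rule has_derivative_transform_within_open[OF has_derivative_mult_right[OF F'[of p]]])
    show "open (phase c)" by (simp add: open_Times open_chart c)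
    show "(snd c q, p) \<in> phase c" using c by simp
    fix z assume "z \<in> phase c"
    then obtain r p where z: "z = (snd c r, p)" "r \<in> fst c" by (cases z) auto
    then show "t\<^sup>2 * ?F z = ?F (?L z)"
      using kinetic_scaleR[OF rm chart_points[OF c(1) z(2)]] c(1)
      by (simp add: chart_inv_cochart linear_cmul[OF linear_cocoord_inv])
  qed
  from has_derivative_unique[OF 1 this] have "?F' (t *\<^sub>R p) (?L (v, r)) = t\<^sup>2 * ?F' p (v, r)" by metis
  then show ?thesis by simp
qed

text \<open>Transport is linear in the covector, so scaling the fiber maps horizontal lifts to
  horizontal lifts and homogeneity of degree two survives.\<close>

lemma base_deriv_kinetic_scaleR:
  assumes rm: "riemannian_metric A \<rho>" and q: "q \<in> points A"
  shows "bderiv (kinetic \<rho>) (q, t *\<^sub>R a) = t\<^sup>2 *\<^sub>R bderiv (kinetic \<rho>) (q, a)"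
proof (rule covector_eqI[OF chart_at[OF q]])
  note c = chart_at[OF q]
  show "bderiv (kinetic \<rho>) (q, t *\<^sub>R a) \<bullet> frame (chart_at A q) q v =
      (t\<^sup>2 *\<^sub>R bderiv (kinetic \<rho>) (q, a)) \<bullet> frame (chart_at A q) q v" for v
    by (simp add: base_deriv_chart[OF smooth_simple[OF simple_kinetic[OF rm]] c]
        linear_cmul[OF linear_covector_coord[OF c]] linear_cmul[OF linear_transport]
          kinetic_derivative_scaleR[OF rm c])
qed

text \<open>Polarization: with K the kinetic energy, the form is half of K(a1 + a2) - K(a1) - K(a2).
  At a1 = a2 its derivative is that of K times (4 - 1 - 1) / 2 = 1.\<close>

lemma base_deriv2_kinetic_form:
  assumes rm: "riemannian_metric A \<rho>" and q: "q \<in> points A"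
  shows "base_deriv2 A nabla (kinetic_form \<rho>) (q, a) (q, a) = bderiv (kinetic \<rho>) (q, a)"
proof (rule base_deriv2_eqI[OF chart_at[OF q]])
  note c = chart_at[OF q]
  let ?c = "chart_at A q" and ?p = "ccoord (chart_at A q) q a"
  let ?F = "kinetic \<rho> \<circ> chart_inv (cochart ?c)"
  let ?F' = "\<lambda>p. frechet_derivative ?F (at (snd ?c q, p))"
  note F' = simple_has_derivative[OF simple_kinetic[OF rm] c]
  fix \<epsilon> u1 u2 assume \<epsilon>: "\<epsilon> > 0"
    and u: "horizontal_curve A nabla {-\<epsilon><..<\<epsilon>} u1" "horizontal_curve A nabla {-\<epsilon><..<\<epsilon>} u2"
    and same: "\<And>s. s \<in> {-\<epsilon><..<\<epsilon>} \<Longrightarrow> fst (u1 s) = fst (u2 s)"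
    and u0: "u1 0 = (q, a)" "u2 0 = (q, a)"
  have 0: "0 \<in> {-\<epsilon><..<\<epsilon>}" "fst (u1 0) \<in> fst ?c" "fst (u2 0) \<in> fst ?c" using \<epsilon> u0 c by auto
  obtain J1 x1 where J1: "open J1" "0 \<in> J1" "\<forall>t\<in>J1. fst (u1 t) \<in> fst ?c"
    and z1: "((\<lambda>t. (snd ?c (fst (u1 t)), ccoord ?c (fst (u1 t)) (snd (u1 t)))) has_vector_derivative
      (x1, transport ?c (fst (u1 0)) x1 (ccoord ?c (fst (u1 0)) (snd (u1 0))))) (at 0)"
    and vel: "velocity A (fst \<circ> u1) 0 = frame ?c (fst (u1 0)) x1"
    by (rule horizontal_curve_chart[OF u(1) open_greaterThanLessThan 0(1) c(1) 0(2)])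
  obtain J2 x2 where J2: "open J2" "0 \<in> J2" "\<forall>t\<in>J2. fst (u2 t) \<in> fst ?c"
    and z2: "((\<lambda>t. (snd ?c (fst (u2 t)), ccoord ?c (fst (u2 t)) (snd (u2 t)))) has_vector_derivative
      (x2, transport ?c (fst (u2 0)) x2 (ccoord ?c (fst (u2 0)) (snd (u2 0))))) (at 0)"
    and "velocity A (fst \<circ> u2) 0 = frame ?c (fst (u2 0)) x2"
    by (rule horizontal_curve_chart[OF u(2) open_greaterThanLessThan 0(1) c(1) 0(3)])
  let ?x = "\<lambda>t. snd ?c (fst (u1 t))"
  let ?p1 = "\<lambda>t. ccoord ?c (fst (u1 t)) (snd (u1 t))" and ?p2 = "\<lambda>t. ccoord ?c (fst (u2 t)) (snd (u2 t))"
  have x1: "(?x has_vector_derivative x1) (at 0)"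
    and p1: "(?p1 has_vector_derivative transport ?c q x1 ?p) (at 0)"
    using bounded_linear.has_vector_derivative[OF bounded_linear_fst z1]
      bounded_linear.has_vector_derivative[OF bounded_linear_snd z1] u0
    by simp_all
  have x2: "((\<lambda>t. snd ?c (fst (u2 t))) has_vector_derivative x2) (at 0)"
    and p2: "(?p2 has_vector_derivative transport ?c q x2 ?p) (at 0)"
    using bounded_linear.has_vector_derivative[OF bounded_linear_fst z2]
      bounded_linear.has_vector_derivative[OF bounded_linear_snd z2] u0
    by simp_all
  \<comment> \<open>Both curves lie over the same base curve, so their base velocities in the chart
    agree.\<close>
  have "(?x has_vector_derivative x2) (at 0)"
    by (rule has_vector_derivative_transform_within_open[OF x2 open_greaterThanLessThan 0(1)]) (simp
      add: same)
  then have x12: "x2 = x1" using vector_derivative_unique_at[OF _ x1] by blast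
  let ?r = "transport ?c q x1 ?p"
  have F1: "((\<lambda>t. ?F (?x t, ?p1 t)) has_vector_derivative ?F' ?p (x1, ?r)) (at 0)"
    by (rule has_vector_derivative_chain[where F = ?F and F' = "?F' ?p", OF
      has_vector_derivative_Pair[OF x1 p1]])
      (use F'[of ?p] in \<open>simp only: u0 fst_conv snd_conv\<close>)
  have F2: "((\<lambda>t. ?F (?x t, ?p2 t)) has_vector_derivative ?F' ?p (x1, ?r)) (at 0)"
    by (rule has_vector_derivative_chain[where F = ?F and F' = "?F' ?p", OF
      has_vector_derivative_Pair[OF x1 p2[unfolded x12]]])
      (use F'[of ?p] in \<open>simp only: u0 fst_conv snd_conv\<close>)
  have "((\<lambda>t. ?F (?x t, ?p1 t + ?p2 t)) has_vector_derivative ?F' (2 *\<^sub>R ?p) (x1, ?r + ?r)) (at 0)"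
    by (rule has_vector_derivative_chain[where F = ?F and F' = "?F' (2 *\<^sub>R ?p)",
          OF has_vector_derivative_Pair[OF x1 has_vector_derivative_add[OF p1 p2[unfolded x12]]]])
      (use F'[of "2 *\<^sub>R ?p"] in \<open>simp only: u0 fst_conv snd_conv scaleR_2\<close>)
  \<comment> \<open>At time 0 the covector and its derivative are doubled; homogeneity of degree two
    gives the factor 4.\<close>
  then have F12: "((\<lambda>t. ?F (?x t, ?p1 t + ?p2 t)) has_vector_derivative 4 * ?F' ?p (x1, ?r)) (at 0)"
    using kinetic_derivative_scaleR[OF rm c, of 2 ?p x1 ?r] by (simp add: scaleR_2)
  have "((\<lambda>t. 1/2 * (?F (?x t, ?p1 t + ?p2 t) - ?F (?x t, ?p1 t) - ?F (?x t, ?p2 t)))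
    has_vector_derivative
      1/2 * (4 * ?F' ?p (x1, ?r) - ?F' ?p (x1, ?r) - ?F' ?p (x1, ?r))) (at 0)"
    by (intro has_vector_derivative_mult_right has_vector_derivative_diff F1 F2 F12)
  then have D: "((\<lambda>t. 1/2 * (?F (?x t, ?p1 t + ?p2 t) - ?F (?x t, ?p1 t) - ?F (?x t, ?p2 t)))
    has_vector_derivative
      bderiv (kinetic \<rho>) (q, a) \<bullet> velocity A (fst \<circ> u1) 0) (at 0)"
    using u0 by (simp add: vel base_deriv_chart[OF smooth_simple[OF simple_kinetic[OF rm]] c])
  have "((\<lambda>t. kinetic_form \<rho> (u1 t) (u2 t)) has_vector_derivative
      bderiv (kinetic \<rho>) (q, a) \<bullet> velocity A (fst \<circ> u1) 0) (at 0)"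
  proof (rule has_vector_derivative_transform_within_open[OF D])
    show "open (J1 \<inter> {-\<epsilon><..<\<epsilon>})" "0 \<in> J1 \<inter> {-\<epsilon><..<\<epsilon>}" using J1 0 by auto
    fix t assume t: "t \<in> J1 \<inter> {-\<epsilon><..<\<epsilon>}"
    define r where "r = fst (u1 t)"
    obtain a1 a2 where u_t: "u1 t = (r, a1)" "u2 t = (r, a2)"
      using same[of t] t by (metis IntD2 r_def prod.collapse)
    have r: "r \<in> fst ?c" using J1(3) t by (simp add: r_def)
    show "1/2 * (?F (?x t, ?p1 t + ?p2 t) - ?F (?x t, ?p1 t) - ?F (?x t, ?p2 t)) = kinetic_form \<rho> (u1
      t) (u2 t)"
      using chart_inv_cochart_left[OF c(1) r, of "a1 + a2"] kinetic_add[OF rm chart_points[OF c(1) r],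
        of a1 a2] c r
      by (simp add: u_t chart_inv_cochart_left linear_add[OF linear_covector_coord[OF c(1) r]])
  qed
  then show "((\<lambda>s. kinetic_form \<rho> (u1 s) (u2 s)) has_real_derivative
      bderiv (kinetic \<rho>) (q, a) \<bullet> velocity A (fst \<circ> u1) 0) (at 0)"
    by (simp add: has_real_derivative_iff_has_vector_derivative)
qed

lemma Upsilon_eq:
  assumes "riemannian_metric A \<rho>" "riemannian_metric A \<rho>h" "q \<in> points A"
  shows "Upsilon A nabla \<rho> \<rho>h (q, a) (q, a) (q, \<sigma>) =
    bderiv (kinetic \<rho>h) (q, a) \<bullet> sharp \<rho> (q, \<sigma>) - bderiv (kinetic \<rho>) (q, a) \<bullet> sharp \<rho>h (q, \<sigma>)"
  using assms by (simp add: Upsilon_def base_deriv2_kinetic_form fiber_deriv_simple[OF simple_kinetic])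

subsection \<open>Poisson brackets\<close>

text \<open>Symmetry of the Christoffel symbols in another guise; this is where the absence of
  torsion enters the Poisson bracket.\<close>

lemma transport_symmetric:
  assumes c: "c \<in> A" "q \<in> fst c"
  shows "transport c q v p \<bullet> w = transport c q w p \<bullet> v"
proof -
  have *: "transport c q v p \<bullet> w = (\<Sum>b\<in>Basis. \<Sum>b'\<in>Basis. (w \<bullet> b) * (v \<bullet> b') * (p \<bullet> christoffel c q b'
    b))" for v w
  proof -
    have "transport c q v p \<bullet> w = (\<Sum>b\<in>Basis. (p \<bullet> christoffel c q v b) * (b \<bullet> w))"
      by (simp add: transport_def inner_sum_left)
    also have "\<dots> = (\<Sum>b\<in>Basis. (p \<bullet> (\<Sum>b'\<in>Basis. (v \<bullet> b') *\<^sub>R christoffel c q b' b)) * (b \<bullet> w))"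
      using linear_eq_sum_Basis[OF linear_christoffel[OF c], of v] by simp
    also have "\<dots> = (\<Sum>b\<in>Basis. \<Sum>b'\<in>Basis. (w \<bullet> b) * (v \<bullet> b') * (p \<bullet> christoffel c q b' b))"
      by (simp add: inner_sum_right sum_distrib_right sum_distrib_left inner_commute[of w] mult_ac)
    finally show ?thesis .
  qed
  show ?thesis
    unfolding * by (subst sum.swap) (simp add: christoffel_symmetric[OF c] mult_ac)
qed

text \<open>In a canonical chart each partial derivative along the base differs from the base
  derivative by a transport term. The two terms cancel in the antisymmetric bracket by
  \<open>transport_symmetric\<close>.\<close>

lemma poisson_eq_base_deriv:
  assumes F: "simple_on_cotangent A F \<rho>F f" and G: "simple_on_cotangent A G \<rho>G g" and q: "q \<in> points A"
  shows "poisson A F G (q, a) = bderiv F (q, a) \<bullet> sharp \<rho>G (q, a) - bderiv G (q, a) \<bullet> sharp \<rho>F (q, a)"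
proof -
  have "(q, a) \<in> points cotb" using q by (simp add: points_cotangent)
  then obtain d where "d \<in> A" "fst (q, a) \<in> fst d" and dd: "chart_at cotb (q, a) = cochart d"
    by (rule chart_at_cotangent)
  then have d: "d \<in> A" "q \<in> fst d" by simp_all
  let ?p = "ccoord d q a"
  let ?F' = "frechet_derivative (F \<circ> chart_inv (cochart d)) (at (snd d q, ?p))"
  let ?G' = "frechet_derivative (G \<circ> chart_inv (cochart d)) (at (snd d q, ?p))"
  let ?f = "vcoord d q (sharp \<rho>F (q, a))" and ?g = "vcoord d q (sharp \<rho>G (q, a))"
  have F_lin: "linear ?F'" and G_lin: "linear ?G'"
    using has_derivative_linear[OF simple_has_derivative[OF F d]] has_derivative_linear[OF
      simple_has_derivative[OF G d]] by auto
  have F_lin1: "linear (\<lambda>v. ?F' (v, 0))" and G_lin1: "linear (\<lambda>v. ?G' (v, 0))"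
    using linear_compose[OF _ F_lin, of "\<lambda>v. (v, 0)"] linear_compose[OF _ G_lin, of "\<lambda>v. (v, 0)"] by
      (auto simp: linear_iff o_def)
  have F_split: "?F' (v, r) = ?F' (v, 0) + r \<bullet> ?f" for v r
    using linear_add[OF F_lin, of "(v, 0)" "(0, r)"] simple_derivative_fiber[OF F d, of a r] by simp
  have G_split: "?G' (v, r) = ?G' (v, 0) + r \<bullet> ?g" for v r
    using linear_add[OF G_lin, of "(v, 0)" "(0, r)"] simple_derivative_fiber[OF G d, of a r] by simp
  have "poisson A F G (q, a) = (\<Sum>b\<in>Basis. ?F' (b, 0) * (b \<bullet> ?g) - ?G' (b, 0) * (b \<bullet> ?f))"
    by (simp add: poisson_def d_dq_def d_dp_def dfun_def dd simple_derivative_fiber[OF F d]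
      simple_derivative_fiber[OF G d])
  also have "\<dots> = ?F' (?g, 0) - ?G' (?f, 0)"
    unfolding linear_eq_sum_Basis[OF F_lin1, of ?g] linear_eq_sum_Basis[OF G_lin1, of ?f]
    by (simp add: sum_subtractf inner_commute mult.commute)
  also have "\<dots> = ?F' (?g, transport d q ?g ?p) - ?G' (?f, transport d q ?f ?p)"
    unfolding F_split[of ?g "transport d q ?g ?p"] G_split[of ?f "transport d q ?f ?p"] using
      transport_symmetric[OF d, of ?g ?p ?f] by simp
  also have "\<dots> = bderiv F (q, a) \<bullet> sharp \<rho>G (q, a) - bderiv G (q, a) \<bullet> sharp \<rho>F (q, a)"
    using base_deriv_chart[OF smooth_simple[OF F] d, of a ?g] base_deriv_chart[OF smooth_simple[OF G]
      d, of a ?f] d by simp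
  finally show ?thesis .
qed

text \<open>The Hamiltonian part contributes the bracket, the vertical part the pairing with the
  fiber derivative of F. This turns the Lyapunov inequality into a statement about
  covectors.\<close>

lemma dfun_hamiltonian_vlift:
  assumes F: "simple_on_cotangent A F \<rho>F f" and q: "q \<in> points A"
  shows "dfun cotb F (q, a) (hamiltonian_vf A G (q, a) + vlift A (q, a) w) = poisson A F G (q, a) + w \<bullet>
    sharp \<rho>F (q, a)"
proof -
  have "(q, a) \<in> points cotb" using q by (simp add: points_cotangent)
  then obtain d where d': "d \<in> A" "fst (q, a) \<in> fst d" "chart_at cotb (q, a) = cochart d"
    by (rule chart_at_cotangent)
  then have d: "d \<in> A" "q \<in> fst d" by simp_all
  let ?p = "ccoord d q a"
  let ?F' = "frechet_derivative (F \<circ> chart_inv (cochart d)) (at (snd d q, ?p))"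
  have lin: "linear ?F'" using has_derivative_linear[OF simple_has_derivative[OF F d]] .
  have lin1: "linear (\<lambda>v. ?F' (v, 0))" and lin2: "linear (\<lambda>v. ?F' (0, v))"
    using linear_compose[OF _ lin, of "\<lambda>v. (v, 0)"] linear_compose[OF _ lin, of "\<lambda>v. (0, v)"] by (auto
      simp: linear_iff o_def)
  have dfun: "dfun cotb F (q, a) v = ?F' v" for v by (simp add: dfun_def d'(3))
  let ?P = "\<Sum>b\<in>Basis. d_dp A G (q, a) b *\<^sub>R b" and ?Q = "\<Sum>b\<in>Basis. d_dq A G (q, a) b *\<^sub>R b"
  have "dfun cotb F (q, a) (hamiltonian_vf A G (q, a) + vlift A (q, a) w) = ?F' (?P, 0) - ?F' (0, ?Q) +
    ?F' (0, ccoord d q w)"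
    unfolding dfun hamiltonian_vf_def vlift_eq[OF d', of w]
    using linear_add[OF lin, of "(?P, 0)" "(0, - ?Q + ccoord d q w)"] linear_add[OF lin2, of "- ?Q"
      "ccoord d q w"] linear_neg[OF lin2, of ?Q]
    by simp
  also have "?F' (0, ccoord d q w) = w \<bullet> sharp \<rho>F (q, a)"
    by (simp add: simple_derivative_fiber[OF F d] inner_coords d)
  also have "?F' (?P, 0) - ?F' (0, ?Q) = poisson A F G (q, a)"
    unfolding linear_sum[OF lin1] linear_sum[OF lin2] linear_cmul[OF lin1] linear_cmul[OF lin2]
    by (simp add: poisson_def d_dq_def[of A F] d_dp_def[of A F] dfun sum_subtractf mult.commute)
  finally show ?thesis .
qed

subsection \<open>Critical points\<close>

text \<open>An interior minimum kills the whole differential in a chart, in particular its values on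
  horizontal lifts. The lemma serves the Lyapunov function at \<open>\<alpha>0\<close>.\<close>

lemma base_deriv_min:
  assumes F: "smooth_fun cotb F" and q: "q \<in> points A"
    and min: "\<And>\<alpha>. \<alpha> \<in> points cotb \<Longrightarrow> F (q, a) \<le> F \<alpha>"
  shows "bderiv F (q, a) = 0"
proof -
  note c = chart_at[OF q]
  let ?c = "chart_at A q"
  let ?F = "F \<circ> chart_inv (cochart ?c)" and ?z = "(snd ?c q, ccoord ?c q a)"
  have "frechet_derivative ?F (at ?z) = (\<lambda>v. 0)"
  proof (rule differential_zero_maxmin)
    show "?z \<in> snd ?c ` fst ?c \<times> UNIV" using c by simp
    show "open (snd ?c ` fst ?c \<times> (UNIV :: 'e set))" by (simp add: open_Times open_chart c)
    show "(?F has_derivative frechet_derivative ?F (at ?z)) (at ?z)"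
      by (rule smooth_fun_cotangent_has_derivative[OF F c])
    show "(\<forall>y\<in>snd ?c ` fst ?c \<times> UNIV. ?F y \<le> ?F ?z) \<or> (\<forall>y\<in>snd ?c ` fst ?c \<times> UNIV. ?F ?z \<le> ?F y)"
      using c min chart_points[OF c(1)] by (auto simp: chart_inv_cochart points_cotangent)
  qed
  then show ?thesis by (intro covector_eqI[OF c]) (simp add: base_deriv_chart[OF F c])
qed

text \<open>The components of the Hamiltonian vector field are, up to sign, all partial derivatives
  in a canonical chart, so a zero of it is a zero of the differential. The vertical part of the
  latter is the fiber derivative, whence a = 0.\<close>

lemma hamiltonian_vf_zero:
  assumes F: "simple_on_cotangent A F \<rho>F f" and q: "q \<in> points A" and 0: "hamiltonian_vf A F (q, a) = 0"
  shows "a = 0" and "bderiv F (q, a) = 0"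
proof -
  have "(q, a) \<in> points cotb" using q by (simp add: points_cotangent)
  then obtain d where d': "d \<in> A" "fst (q, a) \<in> fst d" "chart_at cotb (q, a) = cochart d"
    by (rule chart_at_cotangent)
  then have d: "d \<in> A" "q \<in> fst d" by simp_all
  let ?p = "ccoord d q a"
  let ?F' = "frechet_derivative (F \<circ> chart_inv (cochart d)) (at (snd d q, ?p))"
  have lin: "linear ?F'" using has_derivative_linear[OF simple_has_derivative[OF F d]] .
  have dfun: "dfun cotb F (q, a) v = ?F' v" for v by (simp add: dfun_def d'(3))
  have "(\<Sum>b\<in>Basis. d_dp A F (q, a) b *\<^sub>R b) = 0" "(\<Sum>b\<in>Basis. d_dq A F (q, a) b *\<^sub>R b) = 0"
    using 0 by (auto simp: hamiltonian_vf_def zero_prod_def)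
  then have dp: "?F' (0, b) = 0" and dq: "?F' (b, 0) = 0" if "b \<in> Basis" for b
    using that independent_Basis finite_Basis
    by (auto simp: d_dp_def d_dq_def dfun independent_explicit)
  have "?F' b = 0" if "b \<in> Basis" for b
    using that dp dq by (auto simp: Basis_prod_def)
  then have F0: "?F' v = 0" for v using linear_eq_sum_Basis[OF lin, of v] by simp
  show "bderiv F (q, a) = 0"
    by (rule covector_eqI[OF d]) (simp add: F0 base_deriv_chart[OF smooth_simple[OF F] d])
  have "r \<bullet> vcoord d q (sharp \<rho>F (q, a)) = 0" for r
    using F0 simple_derivative_fiber[OF F d, of a r] by simp
  then have "vcoord d q (sharp \<rho>F (q, a)) = 0" by (metis inner_eq_zero_iff)
  then have "sharp \<rho>F (q, a) = 0" using frame_vector_coord[OF d] linear_0[OF linear_frame[OF d]] by metis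
  then show "a = 0" using sharp_eq_0[OF simple_metric[OF F] q] by simp
qed

end

section \<open>The simple LCB method\<close>

context connection_geometry
begin

text \<open>Smoothness of a fiber preserving map in a form to which the \<open>smooth_on\<close>
  rules apply directly: only the fiber component matters, and the same base chart serves source and
  target. \<open>smooth_fiber_rep_imp\<close> leads back to
  \<open>smooth_fiber_preserving\<close>.\<close>

definition smooth_fiber_rep :: "('q \<times> 'e \<Rightarrow> 'e) \<Rightarrow> bool"
  where "smooth_fiber_rep y \<longleftrightarrow> (\<forall>c\<in>A. smooth_on (phase c)
    (\<lambda>z. ccoord c (chart_inv c (fst z)) (y (chart_inv (cochart c) z))))"

lemma open_cochart_image: "c \<in> A \<Longrightarrow> open (phase c)"
  by (simp add: open_Times open_chart)

lemma smooth_fst_cochart: "c \<in> A \<Longrightarrow> smooth_on (phase c) (fst :: 'e \<times> 'e \<Rightarrow> 'e)"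
  by (rule smooth_on_bounded_linear[OF bounded_linear_fst open_cochart_image smooth_on_id[OF
    open_cochart_image]])

lemma smooth_snd_cochart: "c \<in> A \<Longrightarrow> smooth_on (phase c) (snd :: 'e \<times> 'e \<Rightarrow> 'e)"
  by (rule smooth_on_bounded_linear[OF bounded_linear_snd open_cochart_image smooth_on_id[OF
    open_cochart_image]])

lemma smooth_fiber_rep_add:
  assumes "smooth_fiber_rep y1" "smooth_fiber_rep y2"
  shows "smooth_fiber_rep (\<lambda>\<alpha>. y1 \<alpha> + y2 \<alpha>)"
  unfolding smooth_fiber_rep_def
proof
  fix c assume c: "c \<in> A"
  note op = open_cochart_image[OF c]
  show "smooth_on (phase c)
    (\<lambda>z. ccoord c (chart_inv c (fst z)) (y1 (chart_inv (cochart c) z) + y2 (chart_inv (cochart c) z)))"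
    by (rule smooth_on_cong[OF op, THEN iffD1, rotated, OF smooth_on_add[OF op
            assms(1)[unfolded smooth_fiber_rep_def, THEN bspec, OF c] assms(2)[unfolded
              smooth_fiber_rep_def, THEN bspec, OF c]]])
      (use c in \<open>auto simp: linear_add[OF linear_covector_coord]\<close>)
qed

lemma smooth_fiber_rep_diff:
  assumes "smooth_fiber_rep y1" "smooth_fiber_rep y2"
  shows "smooth_fiber_rep (\<lambda>\<alpha>. y1 \<alpha> - y2 \<alpha>)"
  unfolding smooth_fiber_rep_def
proof
  fix c assume c: "c \<in> A"
  note op = open_cochart_image[OF c]
  show "smooth_on (phase c)
    (\<lambda>z. ccoord c (chart_inv c (fst z)) (y1 (chart_inv (cochart c) z) - y2 (chart_inv (cochart c) z)))"
    by (rule smooth_on_cong[OF op, THEN iffD1, rotated, OF smooth_on_diff[OF op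
            assms(1)[unfolded smooth_fiber_rep_def, THEN bspec, OF c] assms(2)[unfolded
              smooth_fiber_rep_def, THEN bspec, OF c]]])
      (use c in \<open>auto simp: linear_diff[OF linear_covector_coord]\<close>)
qed

lemma smooth_fiber_rep_imp: "smooth_fiber_rep y \<Longrightarrow> smooth_fiber_preserving A y"
  by (rule smooth_fiber_preservingI) (simp add: smooth_fiber_rep_def)

text \<open>The components are derivatives of F along the horizontal lifts of the basis vectors, and
  these lifts depend smoothly on the point.\<close>

lemma smooth_base_deriv:
  assumes F: "smooth_fun cotb F"
  shows "smooth_fiber_rep (bderiv F)"
  unfolding smooth_fiber_rep_def
proof
  fix c assume c: "c \<in> A"
  let ?D = "phase c" and ?F = "F \<circ> chart_inv (cochart c)"
  note op = open_cochart_image[OF c]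
  have F_sm: "smooth_on ?D ?F" using F c by (simp add: smooth_fun_cotangent_iff)
  have lin: "linear (frechet_derivative ?F (at z))" if "z \<in> ?D" for z
    using has_derivative_linear[OF smooth_on_has_derivative[OF op F_sm that]] .
  have transport_sm: "smooth_on ?D (\<lambda>z. transport c (chart_inv c (fst z)) b (snd z))" for b
    by (rule smooth_transport[OF c op smooth_fst_cochart[OF c] _ smooth_snd_cochart[OF c]]) auto
  have "smooth_on ?D (\<lambda>z. frechet_derivative ?F (at z) (b, transport c (chart_inv c (fst z)) b (snd
    z)))" for b
    by (rule smooth_on_linear_apply[where L = "\<lambda>z. frechet_derivative ?F (at z)"
          and v = "\<lambda>z. (b, transport c (chart_inv c (fst z)) b (snd z))",
          OF op lin smooth_on_Pair[OF op smooth_on_const[OF op] transport_sm]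
            smooth_on_frechet_derivative[OF F_sm]])
  then have "smooth_on ?D (\<lambda>z. \<Sum>b\<in>Basis. frechet_derivative ?F (at z) (b, transport c (chart_inv c (fst
    z)) b (snd z)) *\<^sub>R b)"
    by (intro smooth_on_sum smooth_on_scaleR smooth_on_const op)
  then show "smooth_on ?D (\<lambda>z. ccoord c (chart_inv c (fst z)) (bderiv F (chart_inv (cochart c) z)))"
  proof (rule smooth_on_cong[OF op, THEN iffD1, rotated])
    fix z assume "z \<in> ?D"
    then obtain q p where z: "z = (snd c q, p)" and q: "q \<in> fst c" by (cases z) auto
    let ?\<beta> = "ccoord c q (bderiv F (q, cocoord_inv c q p))"
    have "?\<beta> = (\<Sum>b\<in>Basis. (?\<beta> \<bullet> b) *\<^sub>R b)" by (simp only: euclidean_representation)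
    then show "(\<Sum>b\<in>Basis. frechet_derivative ?F (at z) (b, transport c (chart_inv c (fst z)) b (snd z))
      *\<^sub>R b)
        = ccoord c (chart_inv c (fst z)) (bderiv F (chart_inv (cochart c) z))"
      using c q by (simp add: z chart_inv_cochart inner_covector_coord base_deriv_chart[OF F c q])
  qed
qed

lemma smooth_sharp_rep:
  assumes rm: "riemannian_metric A \<rho>" and y: "smooth_fiber_rep y" and c: "c \<in> A"
  shows "smooth_on (phase c) (\<lambda>z. vcoord c (chart_inv c (fst z))
    (sharp \<rho> (chart_inv c (fst z), y (chart_inv (cochart c) z))))"
proof -
  note op = open_cochart_image[OF c]
  show ?thesis
    by (rule smooth_on_cong[OF op, THEN iffD1, rotated, OF smooth_sharp[OF rm c op
      smooth_fst_cochart[OF c] _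
            y[unfolded smooth_fiber_rep_def, THEN bspec, OF c]]]) (use c in auto)
qed

lemma smooth_fiber_rep_id: "smooth_fiber_rep snd"
  unfolding smooth_fiber_rep_def
proof
  fix c assume c: "c \<in> A"
  show "smooth_on (phase c) (\<lambda>z. ccoord c (chart_inv c (fst z)) (snd (chart_inv (cochart c) z)))"
    by (rule smooth_on_cong[OF open_cochart_image[OF c], THEN iffD1, rotated, OF smooth_snd_cochart[OF
      c]])
      (use c in \<open>auto simp: chart_inv_cochart\<close>)
qed

text \<open>Serves \<open>\<mu>\<close>, which explains the sign.\<close>

lemma smooth_fun_inner_sharp:
  assumes rm: "riemannian_metric A \<rho>" and y: "smooth_fiber_rep y"
  shows "smooth_fun cotb (\<lambda>\<alpha>. - (y \<alpha> \<bullet> sharp \<rho> \<alpha>))"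
  unfolding smooth_fun_cotangent_iff
proof
  fix c assume c: "c \<in> A"
  note op = open_cochart_image[OF c]
  show "smooth_on (phase c) ((\<lambda>\<alpha>. - (y \<alpha> \<bullet> sharp \<rho> \<alpha>)) \<circ> chart_inv (cochart c))"
  proof (rule smooth_on_cong[OF op, THEN iffD1, rotated, OF smooth_on_uminus[OF op smooth_on_inner[OF op
            y[unfolded smooth_fiber_rep_def, THEN bspec, OF c] smooth_sharp_rep[OF rm
              smooth_fiber_rep_id c]]]])
    fix z assume "z \<in> phase c"
    then obtain q p where z: "z = (snd c q, p)" and q: "q \<in> fst c" by (cases z) auto
    then show "- (ccoord c (chart_inv c (fst z)) (y (chart_inv (cochart c) z)) \<bullet>
        vcoord c (chart_inv c (fst z)) (sharp \<rho> (chart_inv c (fst z), snd (chart_inv (cochart c) z))))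
        = ((\<lambda>\<alpha>. - (y \<alpha> \<bullet> sharp \<rho> \<alpha>)) \<circ> chart_inv (cochart c)) z"
      using c by (simp add: chart_inv_cochart inner_coords)
  qed
qed

section \<open>The covector that represents the Poisson bracket\<close>

context
  fixes H \<rho> h Hh \<rho>h hh
  assumes H: "simple_on_cotangent A H \<rho> h" and Hh: "simple_on_cotangent A Hh \<rho>h hh"
begin

text \<open>The map \<open>D\<close> of the overview, kept in the literal form in which step 4
  subtracts it.\<close>

definition bracket_covector :: "'q \<times> 'e \<Rightarrow> 'e"
  where "bracket_covector \<alpha> = inv (\<lambda>a. fiber_deriv Hh (fst \<alpha>, a))
    (fiber_deriv H (fst \<alpha>, bderiv Hh \<alpha>) - fiber_deriv Hh (fst \<alpha>, bderiv H \<alpha>))"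

lemma sharp_bracket_covector:
  assumes q: "q \<in> points A"
  shows "sharp \<rho>h (q, bracket_covector (q, a)) =
    sharp \<rho> (q, bderiv Hh (q, a)) - sharp \<rho>h (q, bderiv H (q, a))"
  using surj_f_inv_f[OF bij_is_surj[OF bij_sharp[OF simple_metric[OF Hh] q]]]
  by (simp add: bracket_covector_def fiber_deriv_simple[OF H q] fiber_deriv_simple[OF Hh q])

text \<open>Symmetry of the two metrics moves both sharp operators onto \<sigma>, which yields the
  description of \<open>D\<close> by its pairings.\<close>

lemma bracket_covector_inner:
  assumes q: "q \<in> points A"
  shows "bracket_covector (q, a) \<bullet> sharp \<rho>h (q, \<sigma>) =
    bderiv Hh (q, a) \<bullet> sharp \<rho> (q, \<sigma>) - bderiv H (q, a) \<bullet> sharp \<rho>h (q, \<sigma>)"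
  unfolding sharp_sym[OF simple_metric[OF Hh] q, of "bracket_covector (q, a)"]
    sharp_bracket_covector[OF q]
  by (simp add: inner_diff_right sharp_sym[OF simple_metric[OF H] q, of \<sigma>] sharp_sym[OF
    simple_metric[OF Hh] q, of \<sigma>])

text \<open>The inverse in the definition is never differentiated: its argument has smooth
  components \<open>?V\<close>, and lowering the index with the metric \<open>\<rho>h\<close> gives
  the components of the covector.\<close>

lemma smooth_bracket_covector: "smooth_fiber_rep bracket_covector"
  unfolding smooth_fiber_rep_def
proof
  fix c assume c: "c \<in> A"
  let ?D = "phase c" and ?q = "\<lambda>z::'e \<times> 'e. chart_inv c (fst z)"
  let ?\<alpha> = "chart_inv (cochart c)"
  let ?V = "\<lambda>z. vcoord c (?q z) (sharp \<rho> (?q z, bderiv Hh (?\<alpha> z)))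
    - vcoord c (?q z) (sharp \<rho>h (?q z, bderiv H (?\<alpha> z)))"
  let ?g = "\<lambda>z v w. \<rho>h (?q z) (frame c (?q z) v) (frame c (?q z) w)"
  note op = open_cochart_image[OF c]
  have V: "smooth_on ?D ?V"
    by (intro smooth_on_diff op smooth_sharp_rep smooth_base_deriv smooth_simple[OF H] smooth_simple[OF
      Hh]
        simple_metric[OF H] simple_metric[OF Hh] c)
  have g: "smooth_on ?D (\<lambda>z. ?g z b b')" for b b'
    by (rule smooth_on_compose[OF op open_chart[OF c] smooth_metric_coord[OF simple_metric[OF Hh] c]
      smooth_fst_cochart[OF c]]) auto
  have bil: "bilinear (?g z)" if "z \<in> ?D" for z
    using that bilinear_metric_coord[OF simple_metric[OF Hh] c] c by auto
  have "smooth_on ?D (\<lambda>z. ?g z (?V z) b)" for b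
    by (rule smooth_on_bilinear_apply[where g = ?g and v = ?V and w = "\<lambda>z. b", OF op bil V
      smooth_on_const[OF op] g])
  then have "smooth_on ?D (\<lambda>z. \<Sum>b\<in>Basis. ?g z (?V z) b *\<^sub>R b)"
    by (intro smooth_on_sum smooth_on_scaleR smooth_on_const op)
  then show "smooth_on ?D (\<lambda>z. ccoord c (?q z) (bracket_covector (?\<alpha> z)))"
  proof (rule smooth_on_cong[OF op, THEN iffD1, rotated])
    fix z assume "z \<in> ?D"
    then obtain q p where z: "z = (snd c q, p)" and q: "q \<in> fst c" by (cases z) auto
    note qA = chart_points[OF c q]
    let ?a = "cocoord_inv c q p"
    let ?\<beta> = "ccoord c q (bracket_covector (q, ?a))"
    have V_eq: "frame c q (?V z) = sharp \<rho>h (q, bracket_covector (q, ?a))"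
      using c q by (simp add: z chart_inv_cochart sharp_bracket_covector[OF qA] linear_diff[OF
        linear_frame[OF c q]])
    have "?\<beta> = (\<Sum>b\<in>Basis. (?\<beta> \<bullet> b) *\<^sub>R b)" by (simp only: euclidean_representation)
    also have "\<dots> = (\<Sum>b\<in>Basis. ?g z (?V z) b *\<^sub>R b)"
      using V_eq c q metric_sharp[OF simple_metric[OF Hh] qA] by (simp add: z inner_covector_coord)
    finally show "(\<Sum>b\<in>Basis. ?g z (?V z) b *\<^sub>R b) = ccoord c (?q z) (bracket_covector (?\<alpha> z))"
      using c q by (simp add: z chart_inv_cochart)
  qed
qed

section \<open>Orthogonal projection onto the actuated subbundle\<close>

lemma ghat_eq: "q \<in> points A \<Longrightarrow> ghat Hh q a b = a \<bullet> sharp \<rho>h (q, b)"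
  by (simp add: ghat_def fiber_deriv_simple[OF Hh])

lemma What_iff: "q \<in> points A \<Longrightarrow> a \<in> What \<rho>h W q \<longleftrightarrow> (\<forall>w\<in>W q. w \<bullet> sharp \<rho>h (q, a) = 0)"
  by (simp add: What_def annihilator_def fiber_deriv_simple[OF simple_kinetic[OF simple_metric[OF Hh]]])

text \<open>The difference of two candidates lies in W and is orthogonal to W, so positivity makes
  it zero.\<close>

lemma proj_unique:
  assumes q: "q \<in> points A" and W: "subspace (W q)" and w: "w \<in> W q" "\<And>\<sigma>. \<sigma> \<in> W q \<Longrightarrow> (a - w) \<bullet> sharp \<rho>h
    (q, \<sigma>) = 0"
  shows "proj Hh W (q, a) = w"
  unfolding proj_def
proof (rule the_equality)
  show "w \<in> W (fst (q, a)) \<and> (\<forall>\<sigma>\<in>W (fst (q, a)). ghat Hh (fst (q, a)) (snd (q, a) - w) \<sigma> = 0)"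
    using w q by (simp add: ghat_eq)
  fix w' assume "w' \<in> W (fst (q, a)) \<and> (\<forall>\<sigma>\<in>W (fst (q, a)). ghat Hh (fst (q, a)) (snd (q, a) - w') \<sigma> = 0)"
  then have w': "w' \<in> W q" "\<And>\<sigma>. \<sigma> \<in> W q \<Longrightarrow> (a - w') \<bullet> sharp \<rho>h (q, \<sigma>) = 0"
    using q by (simp_all add: ghat_eq)
  have "w' - w \<in> W q" using W w' w by (simp add: subspace_diff)
  from w(2)[OF this] w'(2)[OF this] have "(w' - w) \<bullet> sharp \<rho>h (q, w' - w) = 0"
    by (simp add: inner_diff_left)
  then show "w' = w" using sharp_pos[OF simple_metric[OF Hh] q, of "w' - w"] by force
qed

text \<open>Gram-Schmidt over a local frame of W, in the coordinates of c; m holds the components of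
  the covector to be projected. Membership and orthogonality are recorded as well, because
  \<open>proj\<close> is a definite description and its existence part comes from here.\<close>

lemma proj_local:
  fixes m :: "'e \<times> 'e \<Rightarrow> 'e"
  assumes W: "subbundle A k W" and c: "c \<in> A" and q0: "q0 \<in> fst c"
    and m: "smooth_on (phase c) m"
  shows "\<exists>T. open T \<and> snd c q0 \<in> T \<and> T \<subseteq> snd c ` fst c \<and>
    smooth_on (T \<times> UNIV) (\<lambda>z. ccoord c (chart_inv c (fst z))
      (proj Hh W (chart_inv c (fst z), cocoord_inv c (chart_inv c (fst z)) (m z)))) \<and>
    (\<forall>z\<in>T \<times> UNIV. proj Hh W (chart_inv c (fst z), cocoord_inv c (chart_inv c (fst z)) (m z)) \<in> W
      (chart_inv c (fst z)) \<and>
      (\<forall>\<sigma>\<in>W (chart_inv c (fst z)). (cocoord_inv c (chart_inv c (fst z)) (m z) -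
        proj Hh W (chart_inv c (fst z), cocoord_inv c (chart_inv c (fst z)) (m z))) \<bullet> sharp \<rho>h
          (chart_inv c (fst z), \<sigma>) = 0))"
proof -
  have W_sub: "subspace (W q)" and W_dim: "dim (W q) = k" if "q \<in> points A" for q
    using W that by (auto simp: subbundle_def)
  from W[unfolded subbundle_def, THEN bspec, OF chart_points[OF c q0]]
  obtain S w where S: "openin (atlas_topology A) S" "q0 \<in> S"
    and w: "\<And>i. i < k \<Longrightarrow> smooth_covector_field_on S A (w i)"
    and span: "\<And>r. r \<in> S \<Longrightarrow> span ((\<lambda>i. w i r) ` {..<k}) = W r"
    by blast
  let ?T = "snd c ` (S \<inter> fst c)" and ?q = "\<lambda>z::'e \<times> 'e. chart_inv c (fst z)"
  let ?D = "?T \<times> (UNIV :: 'e set)" and ?U = "phase c"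
  have T: "open ?T" using S c by (simp add: openin_iff)
  then have op: "open ?D" by (simp add: open_Times)
  have sub: "?D \<subseteq> ?U" by auto
  have q: "?q z \<in> fst c" "?q z \<in> S" "?q z \<in> points A" if "z \<in> ?D" for z
    using that c chart_points[OF c] by auto
  have fst_sm: "smooth_on ?D fst" by (rule smooth_on_subset[OF smooth_fst_cochart[OF c] sub])
  have m_sm: "smooth_on ?D m" by (rule smooth_on_subset[OF m sub])
  \<comment> \<open>The inner product \<open>ghat\<close> in the coordinates of c.\<close>
  define g where "g z p1 p2 = p1 \<bullet> vcoord c (?q z) (sharp \<rho>h (?q z, cocoord_inv c (?q z) p2))" for z p1
    p2
  have g_sharp: "g z p1 p2 = cocoord_inv c (?q z) p1 \<bullet> sharp \<rho>h (?q z, cocoord_inv c (?q z) p2)" if "z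
    \<in> ?D" for z p1 p2
    unfolding g_def using q[OF that] c by (simp add: inner_cocoord_inv)
  have g_lin: "linear (\<lambda>p. vcoord c (?q z) (sharp \<rho>h (?q z, cocoord_inv c (?q z) p)))" if "z \<in> ?D" for z
    using linear_compose[OF linear_compose[OF linear_cocoord_inv[OF c q(1)[OF that]] linear_sharp[OF
      simple_metric[OF Hh] q(3)[OF that]]]
        linear_vector_coord[OF c q(1)[OF that]]] by (simp add: o_def)
  have bil: "bilinear (g z)" if "z \<in> ?D" for z
    using g_lin[OF that] unfolding bilinear_def linear_iff g_def by (simp add: inner_left_distrib
      inner_right_distrib)
  have g_sym: "g z p1 p2 = g z p2 p1" if "z \<in> ?D" for z p1 p2
    unfolding g_sharp[OF that] by (rule sharp_sym[OF simple_metric[OF Hh] q(3)[OF that]])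
  have inv_nz: "cocoord_inv c (?q z) p \<noteq> 0" if "z \<in> ?D" "p \<noteq> 0" for z p
    using that covector_coord_inv[OF c q(1)[OF that(1)], of p] linear_0[OF linear_covector_coord[OF c
      q(1)[OF that(1)]]] by metis
  have g_pos: "g z p p > 0" if "z \<in> ?D" "p \<noteq> 0" for z p
    unfolding g_sharp[OF that(1)] by (rule sharp_pos[OF simple_metric[OF Hh] q(3)[OF that(1)] inv_nz[OF
      that]])
  have g_sm: "smooth_on ?D (\<lambda>z. g z b b')" for b b'
  proof -
    have "smooth_on ?D (\<lambda>z. vcoord c (?q z) (sharp \<rho>h (?q z, cocoord_inv c (?q z) b')))"
      by (rule smooth_sharp[OF simple_metric[OF Hh] c op fst_sm _ smooth_on_const[OF op]]) auto
    then show ?thesis unfolding g_def by (intro smooth_on_inner smooth_on_const op)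
  qed
  define wc where "wc i z = ccoord c (?q z) (w i (?q z))" for i and z :: "'e \<times> 'e"
  have wc_inv: "cocoord_inv c (?q z) (wc i z) = w i (?q z)" if "z \<in> ?D" for i z
    unfolding wc_def using q[OF that] c by simp
  have wc_sm: "smooth_on ?D (wc i)" if "i < k" for i
    unfolding wc_def by (rule smooth_on_compose[OF op T smooth_covector_field_onD[OF S(1) w[OF that] c]
      fst_sm]) auto
  have image_inv: "cocoord_inv c (?q z) ` (\<lambda>j. wc j z) ` I = (\<lambda>j. w j (?q z)) ` I" if "z \<in> ?D" for z I
    using wc_inv[OF that] by (simp add: image_image)
  have span_inv: "cocoord_inv c (?q z) p \<in> span ((\<lambda>j. w j (?q z)) ` I)" if "z \<in> ?D" "p \<in> span ((\<lambda>j. wc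
    j z) ` I)" for z p I
    using that linear_span_image[OF linear_cocoord_inv[OF c q(1)[OF that(1)]], of "(\<lambda>j. wc j z) ` I"]
      image_inv[OF that(1), of I] by auto
  \<comment> \<open>Spanning covectors whose number equals the dimension are independent: if one of
    them lay in the span of its predecessors, the other k - 1 would already span W.\<close>
  have indep: "wc i z \<notin> span ((\<lambda>j. wc j z) ` {..<i})" if i: "i < k" and z: "z \<in> ?D" for i z
  proof
    assume "wc i z \<in> span ((\<lambda>j. wc j z) ` {..<i})"
    then have 1: "w i (?q z) \<in> span ((\<lambda>j. w j (?q z)) ` {..<i})"
      using span_inv[OF z] wc_inv[OF z] by metis
    let ?B = "(\<lambda>j. w j (?q z)) ` ({..<k} - {i})"
    have "span ((\<lambda>j. w j (?q z)) ` {..<i}) \<subseteq> span ?B"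
      using i by (intro span_mono image_mono) auto
    then have "w j (?q z) \<in> span ?B" if "j < k" for j
      using 1 that span_base[of "w j (?q z)" ?B] by (cases "j = i") auto
    then have "span ((\<lambda>j. w j (?q z)) ` {..<k}) \<subseteq> span ?B"
      by (intro span_minimal subspace_span) auto
    then have "W (?q z) \<subseteq> span ?B" using span[OF q(2)[OF z]] by simp
    then have "dim (W (?q z)) \<le> card ?B" by (rule dim_le_card) simp
    also have "\<dots> \<le> card ({..<k} - {i})" by (rule card_image_le) simp
    also have "\<dots> < k" using i by simp
    finally show False using W_dim[OF q(3)[OF z]] by simp
  qed
  \<comment> \<open>The functional is the inner product with m, so the vector that represents it on
    W is the orthogonal projection of m.\<close>
  have "\<exists>v. smooth_on ?D v \<and> (\<forall>z\<in>?D. v z \<in> span ((\<lambda>j. wc j z) ` {..<k}) \<and> (\<forall>i<k. g z (v z) (wc i z) = g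
    z (m z) (wc i z)))"
  proof (rule smooth_riesz[OF op bil g_sym g_pos g_sm wc_sm indep])
    show "linear (g z (m z))" if "z \<in> ?D" for z using bil[OF that] by (simp add: bilinear_def)
    show "smooth_on ?D (\<lambda>z. g z (m z) b)" for b
      by (rule smooth_on_bilinear_apply[where w = "\<lambda>z. b", OF op bil m_sm smooth_on_const[OF op] g_sm])
  qed
  then obtain v where v: "smooth_on ?D v" and v_span: "\<And>z. z \<in> ?D \<Longrightarrow> v z \<in> span ((\<lambda>j. wc j z) ` {..<k})"
    and v_eq: "\<And>z i. z \<in> ?D \<Longrightarrow> i < k \<Longrightarrow> g z (v z) (wc i z) = g z (m z) (wc i z)" by blast
  have v_W: "cocoord_inv c (?q z) (v z) \<in> W (?q z)" if "z \<in> ?D" for z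
    using span_inv[OF that v_span[OF that]] span[OF q(2)[OF that]] by simp
  have v_orth: "(cocoord_inv c (?q z) (m z) - cocoord_inv c (?q z) (v z)) \<bullet> sharp \<rho>h (?q z, \<sigma>) = 0"
    if z: "z \<in> ?D" and \<sigma>: "\<sigma> \<in> W (?q z)" for z \<sigma>
  proof -
    let ?e = "cocoord_inv c (?q z) (m z) - cocoord_inv c (?q z) (v z)"
    have "\<sigma> \<in> span ((\<lambda>j. w j (?q z)) ` {..<k})" using \<sigma> span[OF q(2)[OF z]] by simp
    then show ?thesis
    proof (rule span_induct)
      show "subspace {\<sigma>. ?e \<bullet> sharp \<rho>h (?q z, \<sigma>) = 0}"
        using linear_sharp[OF simple_metric[OF Hh] q(3)[OF z]] linear_0[OF linear_sharp[OF
          simple_metric[OF Hh] q(3)[OF z]]]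
        by (simp add: subspace_def linear_iff inner_right_distrib)
      fix \<sigma> assume "\<sigma> \<in> (\<lambda>j. w j (?q z)) ` {..<k}"
      then obtain i where i: "i < k" "\<sigma> = w i (?q z)" by auto
      show "?e \<bullet> sharp \<rho>h (?q z, \<sigma>) = 0"
        using v_eq[OF z i(1)] unfolding g_sharp[OF z] wc_inv[OF z] i(2) by (simp add: inner_diff_left)
    qed
  qed
  have P: "proj Hh W (?q z, cocoord_inv c (?q z) (m z)) = cocoord_inv c (?q z) (v z)" if "z \<in> ?D" for z
    by (rule proj_unique[where W = W, OF q(3)[OF that] W_sub[OF q(3)[OF that]] v_W[OF that] v_orth[OF
      that]])
  have "smooth_on ?D (\<lambda>z. ccoord c (?q z) (proj Hh W (?q z, cocoord_inv c (?q z) (m z))))"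
    by (rule smooth_on_cong[OF op, THEN iffD1, rotated, OF v]) (use P q c in simp)
  moreover have "snd c q0 \<in> ?T" using S(2) q0 by blast
  ultimately show ?thesis
    using T P v_W v_orth by (intro exI[of _ ?T]) auto
qed

text \<open>Pointwise existence, read off from the local construction with constant
  components.\<close>

lemma proj_in: "subbundle A k W \<Longrightarrow> q \<in> points A \<Longrightarrow> proj Hh W (q, a) \<in> W q"
  and proj_orth: "subbundle A k W \<Longrightarrow> q \<in> points A \<Longrightarrow> \<sigma> \<in> W q \<Longrightarrow> (a - proj Hh W (q, a)) \<bullet> sharp \<rho>h (q, \<sigma>) =
    0"
proof -
  assume W: "subbundle A k W" and q: "q \<in> points A"
  note c = chart_at[OF q]
  let ?c = "chart_at A q" and ?q = "\<lambda>z::'e \<times> 'e. chart_inv (chart_at A q) (fst z)"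
    and ?a = "\<lambda>z::'e \<times> 'e. cocoord_inv (chart_at A q) (chart_inv (chart_at A q) (fst z)) (ccoord
      (chart_at A q) q a)"
  obtain T where T: "snd ?c q \<in> T"
    and P: "\<forall>z\<in>T \<times> (UNIV :: 'e set). proj Hh W (?q z, ?a z) \<in> W (?q z) \<and>
      (\<forall>\<sigma>\<in>W (?q z). (?a z -
        proj Hh W (?q z, ?a z)) \<bullet> sharp \<rho>h (?q z, \<sigma>) = 0)"
    using proj_local[OF W c smooth_on_const[OF open_cochart_image[OF c(1)], of "ccoord ?c q a"]] by blast
  from P[THEN bspec, of "(snd ?c q, 0)"] T c
  have *: "proj Hh W (q, a) \<in> W q \<and> (\<forall>\<sigma>\<in>W q. (a - proj Hh W (q, a)) \<bullet> sharp \<rho>h (q, \<sigma>) = 0)" by simp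
  show "proj Hh W (q, a) \<in> W q" using * by blast
  show "(a - proj Hh W (q, a)) \<bullet> sharp \<rho>h (q, \<sigma>) = 0" if "\<sigma> \<in> W q" using * that by blast
qed

text \<open>The frames of W give smoothness near each base point only; being local, it extends to
  the whole chart.\<close>

lemma smooth_proj:
  assumes W: "subbundle A k W" and y: "smooth_fiber_rep y"
  shows "smooth_fiber_rep (\<lambda>\<alpha>. proj Hh W (fst \<alpha>, y \<alpha>))"
  unfolding smooth_fiber_rep_def
proof
  fix c assume c: "c \<in> A"
  let ?D = "phase c" and ?q = "\<lambda>z::'e \<times> 'e. chart_inv c (fst z)" and ?\<alpha> = "chart_inv (cochart c)"
  let ?m = "\<lambda>z. ccoord c (?q z) (y (?\<alpha> z))"
  have m: "smooth_on ?D ?m" using y c by (simp add: smooth_fiber_rep_def)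
  show "smooth_on ?D (\<lambda>z. ccoord c (?q z) (proj Hh W (fst (?\<alpha> z), y (?\<alpha> z))))"
  proof (rule smooth_on_local[OF open_cochart_image[OF c]])
    fix z0 assume z0: "z0 \<in> ?D"
    then obtain q0 where q0: "q0 \<in> fst c" "fst z0 = snd c q0" by auto
    obtain T where T: "open T" "snd c q0 \<in> T" "T \<subseteq> snd c ` fst c"
      and sm: "smooth_on (T \<times> UNIV) (\<lambda>z. ccoord c (?q z) (proj Hh W (?q z, cocoord_inv c (?q z) (?m
        z))))"
      using proj_local[OF W c q0(1) m] by blast
    have op: "open (T \<times> (UNIV :: 'e set))" using T(1) by (simp add: open_Times)
    have "smooth_on (T \<times> UNIV) (\<lambda>z. ccoord c (?q z) (proj Hh W (fst (?\<alpha> z), y (?\<alpha> z))))"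
    proof (rule smooth_on_cong[OF op, THEN iffD1, rotated, OF sm])
      fix z assume "z \<in> T \<times> (UNIV :: 'e set)"
      then obtain q p where z: "z = (snd c q, p)" and q: "q \<in> fst c" using T(3) by (cases z) auto
      then show "ccoord c (?q z) (proj Hh W (?q z, cocoord_inv c (?q z) (?m z))) =
          ccoord c (?q z) (proj Hh W (fst (?\<alpha> z), y (?\<alpha> z)))"
        using c by (simp add: chart_inv_cochart)
    qed
    moreover have "?D \<inter> (T \<times> UNIV) = T \<times> UNIV" using T(3) by blast
    moreover have "z0 \<in> T \<times> UNIV" using q0 T(2) by (simp add: mem_Times_iff)
    ultimately show "\<exists>V. open V \<and> z0 \<in> V \<and> smooth_on (?D \<inter> V) (\<lambda>z. ccoord c (?q z) (proj Hh W (fst (?\<alpha>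
      z), y (?\<alpha> z))))"
      using op by (intro exI[of _ "T \<times> UNIV"]) simp
  qed
qed

end

text \<open>The values at t = 1, -1 and at t = 2, -2 force C + L = 0 and 8 C + 2 L = 0.\<close>

lemma odd_forms_vanish:
  fixes C L :: real
  assumes "\<And>t. t ^ 3 * C + t * L \<le> 0"
  shows "C = 0" "L = 0"
  using assms[of 1] assms[of "-1"] assms[of 2] assms[of "-2"] by simp_all

text \<open>
  On \<open>What\<close> the Poisson bracket is a cubic plus a linear form in the covector. It is non-positive
  there, hence zero by oddness, and scaling separates the two forms.
\<close>

lemma poisson_vanishes_on_What:
  assumes H: "simple_on_cotangent A H \<rho> h" and Hh: "simple_on_cotangent A Hh \<rho>h hh"
    and q: "q \<in> points A" and \<sigma>: "\<sigma> \<in> What \<rho>h W q"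
    and le: "\<And>\<sigma>. \<sigma> \<in> What \<rho>h W q \<Longrightarrow> poisson A Hh H (q, \<sigma>) \<le> 0"
  shows "poisson A Hh H (q, \<sigma>) = 0"
    and "bderiv Hh (q, a) \<bullet> sharp \<rho> (q, \<sigma>) - bderiv H (q, a) \<bullet> sharp \<rho>h (q, \<sigma>)
      = Upsilon A nabla \<rho> \<rho>h (q, a) (q, a) (q, \<sigma>)"
proof -
  let ?S = "\<lambda>a. sharp \<rho> (q, a)" and ?Sh = "\<lambda>a. sharp \<rho>h (q, a)"
  let ?K = "\<lambda>a. bderiv (kinetic \<rho>) (q, a)" and ?Kh = "\<lambda>a. bderiv (kinetic \<rho>h) (q, a)"
  note rm = simple_metric[OF H] simple_metric[OF Hh]
  obtain \<eta> where \<eta>: "\<And>a. bderiv H (q, a) = ?K a + \<eta>" using base_deriv_simple[OF H q] by blast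
  obtain \<eta>h where \<eta>h: "\<And>a. bderiv Hh (q, a) = ?Kh a + \<eta>h" using base_deriv_simple[OF Hh q] by blast
  \<comment> \<open>C pairs base derivatives of kinetic energies, quadratic in the covector, with a
    linear sharp; L gathers the differentials of the potentials.\<close>
  define C where "C = ?Kh \<sigma> \<bullet> ?S \<sigma> - ?K \<sigma> \<bullet> ?Sh \<sigma>"
  define L where "L = \<eta>h \<bullet> ?S \<sigma> - \<eta> \<bullet> ?Sh \<sigma>"
  have eq: "poisson A Hh H (q, t *\<^sub>R \<sigma>) = t ^ 3 * C + t * L" for t
    unfolding poisson_eq_base_deriv[OF Hh H q] \<eta> \<eta>h C_def L_def
      base_deriv_kinetic_scaleR[OF rm(1) q] base_deriv_kinetic_scaleR[OF rm(2) q]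
      linear_cmul[OF linear_sharp[OF rm(1) q]] linear_cmul[OF linear_sharp[OF rm(2) q]]
    by (simp add: inner_left_distrib algebra_simps power3_eq_cube power2_eq_square)
  have "t *\<^sub>R \<sigma> \<in> What \<rho>h W q" for t
    using \<sigma> by (simp add: What_iff[OF H Hh q] linear_cmul[OF linear_sharp[OF rm(2) q]])
  from le[OF this] have "t ^ 3 * C + t * L \<le> 0" for t unfolding eq .
  note vanish = odd_forms_vanish[OF this]
  show "poisson A Hh H (q, \<sigma>) = 0" using eq[of 1] vanish by simp
  \<comment> \<open>The potentials contribute only L, in which a does not occur. Its vanishing
    therefore gives the identity for every covector a, not just for a in What.\<close>
  show "bderiv Hh (q, a) \<bullet> ?S \<sigma> - bderiv H (q, a) \<bullet> ?Sh \<sigma>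
      = Upsilon A nabla \<rho> \<rho>h (q, a) (q, a) (q, \<sigma>)"
    using vanish(2) unfolding Upsilon_eq[OF rm q] \<eta> \<eta>h L_def by (simp add: inner_left_distrib)
qed

lemma given_by_simple_LCB_methodI:
  assumes H: "simple_on_cotangent A H \<rho> h" and Hh: "simple_on_cotangent A Hh \<rho>h hh"
    and W: "subbundle A k W"
    and crit: "critical_point cotb (hamiltonian_vf A H) \<alpha>0"
    and Y: "smooth_vector_field_on (points cotb) cotb Y"
    and y_W: "\<And>\<alpha>. \<alpha> \<in> points cotb \<Longrightarrow> y \<alpha> \<in> W (fst \<alpha>)"
    and y_Y: "\<And>\<alpha>. \<alpha> \<in> points cotb \<Longrightarrow> Y \<alpha> = vlift A \<alpha> (y \<alpha>)"
    and lyap: "lyapunov_function cotb (\<lambda>\<alpha>. hamiltonian_vf A H \<alpha> + Y \<alpha>) \<alpha>0 Hh"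
  shows "given_by_simple_LCB_method A nabla H \<rho> W \<alpha>0 Y"
proof -
  note rm = simple_metric[OF H] and rmh = simple_metric[OF Hh]
  let ?Sh = "\<lambda>q a. sharp \<rho>h (q, a)"
  define D where "D = bracket_covector H Hh"
  define P where "P \<alpha> = proj Hh W (fst \<alpha>, D \<alpha>)" for \<alpha>
  define zpar where "zpar \<alpha> = y \<alpha> + P \<alpha>" for \<alpha>
  define zperp where "zperp \<alpha> = P \<alpha> - D \<alpha>" for \<alpha>
  \<comment> \<open>Minus the derivative of the Lyapunov function along X_H + Y.\<close>
  define \<mu> where "\<mu> \<alpha> = - ((y \<alpha> + D \<alpha>) \<bullet> sharp \<rho>h \<alpha>)" for \<alpha>
  have pts: "(q, a) \<in> points cotb" if "q \<in> points A" for q a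
    using that by (simp add: points_cotangent)
  have W_sub: "subspace (W q)" if "q \<in> points A" for q
    using W that by (auto simp: subbundle_def)
  have y_rep: "smooth_fiber_rep y"
    unfolding smooth_fiber_rep_def using smooth_vector_field_vlift[OF Y y_Y] by blast
  have D_rep: "smooth_fiber_rep D" unfolding D_def by (rule smooth_bracket_covector[OF H Hh])
  have P_rep: "smooth_fiber_rep P"
    unfolding P_def[abs_def] by (rule smooth_proj[OF H Hh W D_rep])
  have zpar_rep: "smooth_fiber_rep zpar"
    unfolding zpar_def[abs_def] by (rule smooth_fiber_rep_add[OF y_rep P_rep])
  have zperp_rep: "smooth_fiber_rep zperp"
    unfolding zperp_def[abs_def] by (rule smooth_fiber_rep_diff[OF P_rep D_rep])
  have P_in: "P (q, a) \<in> W q" and P_orth: "\<sigma> \<in> W q \<Longrightarrow> (D (q, a) - P (q, a)) \<bullet> ?Sh q \<sigma> = 0"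
    if "q \<in> points A" for q a \<sigma>
    using proj_in[OF H Hh W that] proj_orth[OF H Hh W that] by (simp_all add: P_def)
  note ghat = ghat_eq[OF H Hh] and What = What_iff[OF H Hh]
  have D_inner: "D (q, a) \<bullet> ?Sh q \<sigma> = bderiv Hh (q, a) \<bullet> sharp \<rho> (q, \<sigma>) - bderiv H (q, a) \<bullet> ?Sh q \<sigma>"
    if "q \<in> points A" for q a \<sigma>
    unfolding D_def by (rule bracket_covector_inner[OF H Hh that])
  have D_poisson: "D (q, a) \<bullet> ?Sh q a = poisson A Hh H (q, a)" if "q \<in> points A" for q a
    unfolding poisson_eq_base_deriv[OF Hh H that] by (rule D_inner[OF that])
  have decr: "poisson A Hh H (q, a) + y (q, a) \<bullet> ?Sh q a \<le> 0" if q: "q \<in> points A" for q a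
  proof -
    have "dfun cotb Hh (q, a) (hamiltonian_vf A H (q, a) + Y (q, a)) \<le> 0"
      using lyap pts[OF q] unfolding lyapunov_function_def by blast
    then show ?thesis unfolding y_Y[OF pts[OF q]] dfun_hamiltonian_vlift[OF Hh q] .
  qed
  have y_orth: "y (q, a) \<bullet> ?Sh q \<sigma> = 0" if "q \<in> points A" "\<sigma> \<in> What \<rho>h W q" for q a \<sigma>
    using that y_W[OF pts[OF that(1), of a]] What by simp
  have What_le: "poisson A Hh H (q, \<sigma>) \<le> 0" if "q \<in> points A" "\<sigma> \<in> What \<rho>h W q" for q \<sigma>
    using decr[OF that(1), of \<sigma>] y_orth[OF that, of \<sigma>] by simp
  have 1: "positive_definite_at cotb Hh \<alpha>0"
    using lyap by (simp add: lyapunov_function_def)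
  have 2: "\<forall>\<sigma>\<in>points cotb. snd \<sigma> \<in> What \<rho>h W (fst \<sigma>) \<longrightarrow> poisson A Hh H \<sigma> = 0"
    using poisson_vanishes_on_What(1)[OF H Hh _ _ What_le] by (auto simp: points_cotangent)
  have 3: "\<forall>\<alpha>\<in>points cotb. zperp \<alpha> \<in> What \<rho>h W (fst \<alpha>) \<and>
         (\<forall>\<sigma>\<in>W (fst \<alpha>). ghat Hh (fst \<alpha>) (zperp \<alpha>) \<sigma> = 0) \<and>
         (\<forall>\<sigma>\<in>What \<rho>h W (fst \<alpha>). ghat Hh (fst \<alpha>) (zperp \<alpha>) \<sigma> = - Upsilon A nabla \<rho> \<rho>h \<alpha> \<alpha> (fst \<alpha>, \<sigma>))"
  proof
    fix \<alpha> assume "\<alpha> \<in> points cotb"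
    then obtain q a where \<alpha>: "\<alpha> = (q, a)" and q: "q \<in> points A" by (auto simp: points_cotangent)
    have orth: "zperp (q, a) \<bullet> ?Sh q \<sigma> = 0" if "\<sigma> \<in> W q" for \<sigma>
      using P_orth[OF q that, of a] by (simp add: zperp_def inner_diff_left)
    moreover have "\<sigma> \<bullet> ?Sh q (zperp (q, a)) = 0" if "\<sigma> \<in> W q" for \<sigma>
      using orth[OF that] sharp_sym[OF rmh q] by metis
    moreover have "zperp (q, a) \<bullet> ?Sh q \<sigma> = - Upsilon A nabla \<rho> \<rho>h (q, a) (q, a) (q, \<sigma>)" if \<sigma>: "\<sigma> \<in>
      What \<rho>h W q" for \<sigma>
    proof -
      \<comment> \<open>P takes values in W and is therefore invisible to What, where
        \<open>zperp\<close> acts like -D.\<close>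
      have "P (q, a) \<bullet> ?Sh q \<sigma> = 0" using \<sigma> P_in[OF q] What[OF q] by blast
      then show ?thesis
        using poisson_vanishes_on_What(2)[OF H Hh q \<sigma> What_le[OF q], of a] D_inner[OF q, of a \<sigma>]
        by (simp add: zperp_def inner_diff_left)
    qed
    ultimately show "zperp \<alpha> \<in> What \<rho>h W (fst \<alpha>) \<and>
         (\<forall>\<sigma>\<in>W (fst \<alpha>). ghat Hh (fst \<alpha>) (zperp \<alpha>) \<sigma> = 0) \<and>
         (\<forall>\<sigma>\<in>What \<rho>h W (fst \<alpha>). ghat Hh (fst \<alpha>) (zperp \<alpha>) \<sigma> = - Upsilon A nabla \<rho> \<rho>h \<alpha> \<alpha> (fst \<alpha>, \<sigma>))"
      using q by (simp add: \<alpha> ghat What)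
  qed
  have 4: "smooth_fun cotb \<mu>"
    unfolding \<mu>_def[abs_def] by (rule smooth_fun_inner_sharp[OF rmh smooth_fiber_rep_add[OF y_rep
      D_rep]])
  have 5: "\<forall>\<alpha>\<in>points cotb. \<mu> \<alpha> \<ge> 0"
    using decr D_poisson by (auto simp: points_cotangent \<mu>_def inner_left_distrib) (smt (verit))
  have 6: "\<forall>\<alpha>\<in>points cotb. zpar \<alpha> \<in> W (fst \<alpha>)"
    using y_W P_in W_sub by (auto simp: points_cotangent zpar_def subspace_add)
  \<comment> \<open>For a first argument in W, projecting the second one does not change
    \<open>ghat\<close>. The numerator thus equals the pairing of y + D with the covector, plus
    \<open>\<mu>\<close>, which is 0. The equation holds on What too, where the denominator
    vanishes, since 0 / 0 = 0 in HOL.\<close>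
  have lcb: "lcb_formula Hh W zperp zpar \<mu> \<alpha> = zpar \<alpha>" if "\<alpha> \<in> points cotb" for \<alpha>
  proof -
    obtain q a where \<alpha>: "\<alpha> = (q, a)" and q: "q \<in> points A" using \<open>\<alpha> \<in> points cotb\<close> by (auto simp:
      points_cotangent)
    have "zpar (q, a) \<in> W q" using 6 pts[OF q] by fastforce
    from proj_orth[OF H Hh W q this, of a]
    have "zpar (q, a) \<bullet> ?Sh q (proj Hh W (q, a)) = zpar (q, a) \<bullet> ?Sh q a"
      using sharp_sym[OF rmh q, of "zpar (q, a)"] by (simp add: inner_diff_left)
    then have "zpar (q, a) \<bullet> ?Sh q (proj Hh W (q, a)) + \<mu> (q, a) - zperp (q, a) \<bullet> ?Sh q a = 0"
      by (simp add: zpar_def zperp_def \<mu>_def inner_left_distrib inner_diff_left)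
    then show ?thesis using q by (simp add: \<alpha> lcb_formula_def Let_def ghat)
  qed
  obtain q0 a0 where \<alpha>0: "\<alpha>0 = (q0, a0)" by (cases \<alpha>0)
  have \<alpha>0_pts: "\<alpha>0 \<in> points cotb" and X0: "hamiltonian_vf A H \<alpha>0 = 0"
    using crit by (auto simp: critical_point_def)
  then have q0: "q0 \<in> points A" by (simp add: \<alpha>0 points_cotangent)
  \<comment> \<open>Both X_H and X_H + Y vanish at \<open>\<alpha>0\<close>. Together with the
    vanishing of the two base derivatives this makes the limit 0.\<close>
  have "Y \<alpha>0 = 0" using lyap X0 by (simp add: lyapunov_function_def critical_point_def)
  then have y0: "y \<alpha>0 = 0" using y_Y[OF \<alpha>0_pts] vlift_inj[OF \<alpha>0_pts] by simp
  have BH0: "bderiv H \<alpha>0 = 0"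
    using hamiltonian_vf_zero(2)[OF H q0] X0 by (simp add: \<alpha>0)
  have "Hh \<alpha>0 \<le> Hh \<alpha>" if "\<alpha> \<in> points cotb" for \<alpha>
    using 1 that \<alpha>0_pts unfolding positive_definite_at_def by metis
  then have BHh0: "bderiv Hh \<alpha>0 = 0"
    using base_deriv_min[OF smooth_simple[OF Hh] q0] by (simp add: \<alpha>0)
  have "sharp \<rho>h (q0, D \<alpha>0) = 0"
    using sharp_bracket_covector[OF H Hh q0, of a0] BH0 BHh0 linear_0[OF linear_sharp[OF rm q0]]
      linear_0[OF linear_sharp[OF rmh q0]]
    by (simp add: D_def \<alpha>0)
  then have D0: "D \<alpha>0 = 0" using sharp_eq_0[OF rmh q0] by simp
  have "proj Hh W (q0, 0) = 0"
    by (rule proj_unique[where W = W, OF H Hh q0 W_sub[OF q0]]) (simp_all add: subspace_0[OF W_sub[OF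
      q0]])
  then have zpar0: "zpar \<alpha>0 = 0" using y0 D0 by (simp add: zpar_def P_def \<alpha>0)
  note zpar_sm = smooth_fiber_rep_imp[OF zpar_rep]
  \<comment> \<open>Since \<open>zpar\<close> is continuous on the whole bundle, its limit at
    \<open>\<alpha>0\<close> is taken through all covectors, then restricted to the complement of
    What, and only then rewritten by the formula.\<close>
  have "continuous_map (atlas_topology cotb) (atlas_topology cotb) (\<lambda>\<alpha>. (fst \<alpha>, zpar \<alpha>))"
    using zpar_sm unfolding smooth_fiber_preserving_def smooth_map_on_def
    by (metis subtopology_topspace topspace_cotangent)
  then have "limitin (atlas_topology cotb) (\<lambda>\<alpha>. (fst \<alpha>, zpar \<alpha>)) (fst \<alpha>0, 0) (atin (atlas_topology
    cotb) \<alpha>0)"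
    by (rule limitin_continuous_map) (use \<alpha>0_pts zpar0 topspace_cotangent in auto)
  then have "limitin (atlas_topology cotb) (\<lambda>\<alpha>. (fst \<alpha>, zpar \<alpha>)) (fst \<alpha>0, 0)
      (atin_within (atlas_topology cotb) \<alpha>0 {\<alpha>. snd \<alpha> \<notin> What \<rho>h W (fst \<alpha>)})"
    by (rule limit_within_subset) simp
  moreover have "eventually (\<lambda>\<alpha>. (fst \<alpha>, zpar \<alpha>) = (fst \<alpha>, lcb_formula Hh W zperp zpar \<mu> \<alpha>))
      (atin_within (atlas_topology cotb) \<alpha>0 {\<alpha>. snd \<alpha> \<notin> What \<rho>h W (fst \<alpha>)})"
    unfolding eventually_atin_within
    by (intro disjI2 exI[of _ "points cotb"] conjI openin_points_cotangent \<alpha>0_pts) (simp add: lcb)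
  ultimately have 7: "limitin (atlas_topology cotb) (\<lambda>\<alpha>. (fst \<alpha>, lcb_formula Hh W zperp zpar \<mu> \<alpha>)) (fst
    \<alpha>0, 0)
      (atin_within (atlas_topology cotb) \<alpha>0 {\<alpha>. snd \<alpha> \<notin> What \<rho>h W (fst \<alpha>)})"
    by (rule limitin_transform_eventually[rotated])
  have 8: "\<forall>\<alpha>\<in>points cotb. snd \<alpha> \<notin> What \<rho>h W (fst \<alpha>) \<longrightarrow> zpar \<alpha> = lcb_formula Hh W zperp zpar \<mu> \<alpha>"
    using lcb by simp
  have 9: "\<forall>\<alpha>\<in>points cotb. (y \<alpha> + D \<alpha>) = zpar \<alpha> - zperp \<alpha>"
    by (simp add: zpar_def zperp_def)
  have 10: "\<forall>\<alpha>\<in>points cotb. y \<alpha> = (y \<alpha> + D \<alpha>) - inv (\<lambda>a. fiber_deriv Hh (fst \<alpha>, a))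
           (fiber_deriv H (fst \<alpha>, bderiv Hh \<alpha>) - fiber_deriv Hh (fst \<alpha>, bderiv H \<alpha>))"
    by (simp add: D_def bracket_covector_def[OF H Hh])
  have 11: "\<forall>\<alpha>\<in>points cotb. Y \<alpha> = vlift A \<alpha> (y \<alpha>)" using y_Y by blast
  show ?thesis
    unfolding given_by_simple_LCB_method_def Let_def
    apply (rule exI[of _ Hh], rule exI[of _ \<rho>h], rule exI[of _ hh], rule exI[of _ zperp], rule exI[of _
      \<mu>],
        rule exI[of _ zpar], rule exI[of _ zpar], rule exI[of _ "\<lambda>\<alpha>. y \<alpha> + D \<alpha>"], rule exI[of _ y])
    using Hh 1 2 3 4 5 6 7 8 9 10 11 zpar_sm smooth_fiber_rep_imp[OF zperp_rep]
    by (intro conjI)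
qed

end

theorem theorem44:
  fixes A :: "('q, 'e::euclidean_space) atlas"
    and nabla :: "'q \<Rightarrow> 'e \<Rightarrow> ('q \<Rightarrow> 'e) \<Rightarrow> 'e"
    and H :: "'q \<times> 'e \<Rightarrow> real"
    and \<rho> :: "'q \<Rightarrow> 'e \<Rightarrow> 'e \<Rightarrow> real"
    and h :: "'q \<Rightarrow> real"
    and k :: nat
    and W :: "'q \<Rightarrow> 'e set"
    and \<W> :: "'q \<times> 'e \<Rightarrow> ('e \<times> 'e) set"
    and \<alpha>0 :: "'q \<times> 'e"
    and Y :: "'q \<times> 'e \<Rightarrow> 'e \<times> 'e"
  assumes "manifold A"
    and "torsion_free_connection A nabla"
    and "simple_on_cotangent A H \<rho> h"
    and "subbundle A k W" and "k \<ge> 1"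
    and "\<And>\<alpha>. \<alpha> \<in> points (cotangent_atlas A) \<Longrightarrow> \<W> \<alpha> = vlift A \<alpha> ` W (fst \<alpha>)"
    and "critical_point (cotangent_atlas A) (hamiltonian_vf A H) \<alpha>0"
    and "smooth_vector_field_on (points (cotangent_atlas A)) (cotangent_atlas A) Y"
    and "\<And>\<alpha>. \<alpha> \<in> points (cotangent_atlas A) \<Longrightarrow> Y \<alpha> \<in> \<W> \<alpha>"
    and "\<exists>Hh \<rho>h hh. simple_on_cotangent A Hh \<rho>h hh \<and>
      lyapunov_function (cotangent_atlas A) (\<lambda>\<alpha>. hamiltonian_vf A H \<alpha> + Y \<alpha>) \<alpha>0 Hh"
  shows "given_by_simple_LCB_method A nabla H \<rho> W \<alpha>0 Y"
proof -
  interpret connection_geometry A nabla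
    by unfold_locales (use assms(1,2) in \<open>simp_all add: manifold_def\<close>)
  obtain Hh \<rho>h hh where Hh: "simple_on_cotangent A Hh \<rho>h hh"
    "lyapunov_function cotb (\<lambda>\<alpha>. hamiltonian_vf A H \<alpha> + Y \<alpha>) \<alpha>0 Hh"
    using assms(10) by blast
  \<comment> \<open>The preimage under the vertical lift is chosen at each point separately; its
    smoothness is recovered from that of Y.\<close>
  have "\<forall>\<alpha>\<in>points cotb. \<exists>w. w \<in> W (fst \<alpha>) \<and> Y \<alpha> = vlift A \<alpha> w"
    using assms(6,9) by blast
  then obtain y where y: "\<forall>\<alpha>\<in>points cotb. y \<alpha> \<in> W (fst \<alpha>) \<and> Y \<alpha> = vlift A \<alpha> (y \<alpha>)"
    by (rule bchoice[THEN exE])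
  show ?thesis
    by (rule given_by_simple_LCB_methodI[OF assms(3) Hh(1) assms(4,7,8) _ _ Hh(2)]) (use y in blast)+
qed

end
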